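(* Let $\mathbb{F}$ be any field of characteristic $0$. For every natural number $d>2$ and every finite basis $\mathcal{B}$ of the identities of $\mathrm{Mat}_d(\mathbb{F})$, there exist a constant $c>0$ and, for all $n$, a polynomial $f_n\in\mathbb{F}\langle X\rangle$ in $n$ variables of degree $2d+1$ which is an identity of $\mathrm{Mat}_d(\mathbb{F})$, such that for every non-commutative arithmetic circuit $F$ computing $f_n$, every $\mathcal{P}_{\mathrm{Mat}_d}(\mathbb{F})$-proof (with respect to $\mathcal B$) of $F=0$ has at least $c\,n^{2d}$ lines; i.e. any such proof requires $\Omega(n^{2d})$ lines.
   Context: $\mathbb{F}\langle X\rangle$ is the free associative algebra of non-commutative polynomials over $\mathbb{F}$ in variables $X=\{x_1,x_2,\dots\}$. A polynomial $f(x_1,\dots,x_n)\in\mathbb{F}\langle X\rangle$ is an identity of an $\mathbb{F}$-algebra $A$ if $f(a_1,\dots,a_n)=0$ for all $a_i\in A$; $\mathrm{Mat}_d(\mathbb{F})$ is the algebra of $d\times d$ matrices over $\mathbb{F}$. A substitution instance of $g(x_1,\dots,x_k)$ is $g(h_1,\dots,h_k)$ with $h_i\in\mathbb{F}\langle X\rangle$. A set $\mathcal{B}\subseteq\mathbb{F}\langle X\rangle$ of identities of $\mathrm{Mat}_d(\mathbb{F})$ is a basis of the identities if every identity of $\mathrm{Mat}_d(\mathbb{F})$ lies in the two-sided ideal generated by finitely many substitution instances of elements of $\mathcal{B}$. A non-commutative arithmetic circuit is a directed acyclic graph of in-degree at most 2 whose leaves are labelled by variables or field elements, whose other nodes are labelled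 $+$ or $\times$, whose edges are labelled by field elements, and in which the two children of each $\times$-gate are ordered; it computes a polynomial in $\mathbb{F}\langle X\rangle$ in the usual way, respecting the order at product gates. The proof system $\mathcal{P}_{\mathrm{Mat}_d}(\mathbb{F})$ (for a fixed finite basis $\mathcal{B}$) proves equations $F=G$ between non-commutative circuits. Its rules: from $F=G$ derive $G=F$; from $F=G$ and $G=H$ derive $F=H$; from $F_1=G_1$ and $F_2=G_2$ derive $F_1+F_2=G_1+G_2$ and $F_1\times F_2=G_1\times G_2$. Its axioms (with $F,G,H$ ranging over non-commutative circuits): $F=F$; $F+G=G+F$; $F+(G+H)=(F+G)+H$; $F\cdot(G\cdot H)=(F\cdot G)\cdot H$; $F\cdot(G+H)=F\cdot G+F\cdot H$; $(G+H)\cdot F=G\cdot F+H\cdot F$; $F+0=F$; $F\cdot 0=0$; $F\cdot 1=F$; field identities $c=a+b$, $d=a'\cdot b'$ for $a,a',b,b',c,d\in\mathbb{F}$ with these equations true in $\mathbb{F}$; $F=F'$ whenever $F,F'$ are syntactically identical when unwound into formulas; and, for each $h(x_1,\dots,x_k)\in\mathcal{B}$ with a fixed non-commutative circuit $H$ computing it, the axioms $H(F_1,\dots,F_k)=0$ for circuits $F_1,\dots,F_k$ (i.e. the commutativity axiom $F\cdot G=G\cdot F$ of arithmetic proofs is replaced by the basis $\mathcal{B}$). A proof is a sequence of equations (lines), each an axiom or derived from earlier ones by a rule; it is a proof of $F=0$ if that equation appears in it.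
   Formalization: "For all n" is proved for all n ≥ 2d−1; for smaller n no polynomial in n variables of degree 2d+1 is an identity of Mat_d(F) (for example, for n = 1 there is no nonzero identity at all), so the literal claim fails there. *)

theory Defs
  imports
    "HOL-Library.Poly_Mapping"
    "HOL-Library.Multiset"
    "Jordan_Normal_Form.Matrix"
begin

section \<open>Non-commutative polynomials\<close>

text \<open>
  The free algebra is the monoid algebra of the free monoid of words, so its ring structure is
  the one of \<^theory>\<open>HOL-Library.Poly_Mapping\<close>. The monoid is written additively because that
  theory expects it. Letter \<open>i\<close> stands for the variable \<open>x\<^bsub>i+1\<^esub>\<close>.
\<close>

datatype word = Word (letters: "nat list")

instantiation word :: monoid_add
begin

definition zero_word :: word where "0 = Word []"

definition plus_word :: "word \<Rightarrow> word \<Rightarrow> word" where "v + w = Word (letters v @ letters w)"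

instance by standard (simp_all add: zero_word_def plus_word_def)

end

type_synonym 'a ncpoly = "word \<Rightarrow>\<^sub>0 'a"

definition nc_const :: "'a::field \<Rightarrow> 'a ncpoly" where
  "nc_const c = Poly_Mapping.single 0 c"

definition nc_var :: "nat \<Rightarrow> 'a::field ncpoly" where
  "nc_var i = Poly_Mapping.single (Word [i]) 1"

definition nc_vars :: "'a::field ncpoly \<Rightarrow> nat set" where
  "nc_vars f = (\<Union>w\<in>Poly_Mapping.keys f. set (letters w))"

text \<open>The degree of the zero polynomial is taken to be \<open>0\<close>.\<close>

definition nc_degree :: "'a::field ncpoly \<Rightarrow> nat" where
  "nc_degree f = Max (insert 0 ((\<lambda>w. length (letters w)) ` Poly_Mapping.keys f))"

definition nc_subst :: "(nat \<Rightarrow> 'a ncpoly) \<Rightarrow> 'a::field ncpoly \<Rightarrow> 'a ncpoly" where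
  "nc_subst h g =
     (\<Sum>w\<in>Poly_Mapping.keys g.
        nc_const (Poly_Mapping.lookup g w) * prod_list (map h (letters w)))"

inductive_set two_sided_ideal :: "'r::ring_1 set \<Rightarrow> 'r set" for S where
  zero: "0 \<in> two_sided_ideal S"
| gen: "p \<in> S \<Longrightarrow> p \<in> two_sided_ideal S"
| add: "p \<in> two_sided_ideal S \<Longrightarrow> q \<in> two_sided_ideal S \<Longrightarrow> p + q \<in> two_sided_ideal S"
| mult_left: "p \<in> two_sided_ideal S \<Longrightarrow> r * p \<in> two_sided_ideal S"
| mult_right: "p \<in> two_sided_ideal S \<Longrightarrow> p * r \<in> two_sided_ideal S"


section \<open>Identities of matrix algebras\<close>

definition mat_word :: "nat \<Rightarrow> (nat \<Rightarrow> 'a mat) \<Rightarrow> word \<Rightarrow> 'a::field mat" where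
  "mat_word d A w = foldr (\<lambda>i M. A i * M) (letters w) (1\<^sub>m d)"

text \<open>The value of \<open>f\<close> at \<open>d \<times> d\<close> matrices; the sum over the monomials is taken entrywise.\<close>

definition mat_eval :: "nat \<Rightarrow> (nat \<Rightarrow> 'a mat) \<Rightarrow> 'a::field ncpoly \<Rightarrow> 'a mat" where
  "mat_eval d A f =
     mat d d (\<lambda>ij. \<Sum>w\<in>Poly_Mapping.keys f. Poly_Mapping.lookup f w * mat_word d A w $$ ij)"

definition mat_identity :: "nat \<Rightarrow> 'a::field ncpoly \<Rightarrow> bool" where
  "mat_identity d f \<longleftrightarrow>
     (\<forall>A. (\<forall>i. A i \<in> carrier_mat d d) \<longrightarrow> mat_eval d A f = 0\<^sub>m d d)"

definition subst_instances :: "'a::field ncpoly set \<Rightarrow> 'a ncpoly set" where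
  "subst_instances B = {nc_subst h g | h g. g \<in> B}"

definition identity_basis :: "nat \<Rightarrow> 'a::field ncpoly set \<Rightarrow> bool" where
  "identity_basis d B \<longleftrightarrow>
     (\<forall>g\<in>B. mat_identity d g) \<and>
     (\<forall>f. mat_identity d f \<longrightarrow>
        (\<exists>T. finite T \<and> T \<subseteq> subst_instances B \<and> f \<in> two_sided_ideal T))"


section \<open>Non-commutative circuits\<close>

text \<open>
  A gate records its label together with its incoming edges; an edge is a pair of its label and
  its source. The inputs of a product gate are ordered, those of a sum gate are not.
\<close>

datatype (dead 'a, children: 'v) gate =
    is_Var_gate: Var_gate nat
  | Const_gate 'a
  | Sum_gate "('a \<times> 'v) multiset"
  | Prod_gate "('a \<times> 'v) list"

text \<open>
  The nodes of a circuit are natural numbers, whose choice carries no information: circuits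
  that differ by a renaming of nodes present the same circuit. All notions below that build a
  circuit from others are relations that are insensitive to such renamings.
\<close>

record 'a circuit =
  nodes :: "nat set"
  gate_at :: "nat \<Rightarrow> ('a, nat) gate"
  out_node :: nat

fun fan_in_ok :: "('a, 'v) gate \<Rightarrow> bool" where
  "fan_in_ok (Var_gate i) = True"
| "fan_in_ok (Const_gate c) = True"
| "fan_in_ok (Sum_gate M) = (size M \<in> {1, 2})"
| "fan_in_ok (Prod_gate es) = (length es \<in> {1, 2})"

definition is_circuit :: "'a circuit \<Rightarrow> bool" where
  "is_circuit C \<longleftrightarrow>
     finite (nodes C) \<and> out_node C \<in> nodes C \<and>
     (\<forall>v\<in>nodes C. fan_in_ok (gate_at C v) \<and> children (gate_at C v) \<subseteq> nodes C) \<and>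
     acyclic {(u, v). v \<in> nodes C \<and> u \<in> children (gate_at C v)}"

text \<open>
  Bottom-up evaluation, where \<open>\<alpha>\<close> gives the value of a gate from the values of its children.
  On the nodes of a circuit the function \<open>val\<close> exists and is unique by acyclicity.
\<close>

definition evaluates_to :: "(('a, 'r) gate \<Rightarrow> 'r) \<Rightarrow> 'a circuit \<Rightarrow> 'r \<Rightarrow> bool" where
  "evaluates_to \<alpha> C r \<longleftrightarrow>
     (\<exists>val. (\<forall>v\<in>nodes C. val v = \<alpha> (map_gate val (gate_at C v))) \<and> val (out_node C) = r)"

fun gate_poly :: "('a::field, 'a ncpoly) gate \<Rightarrow> 'a ncpoly" where
  "gate_poly (Var_gate i) = nc_var i"
| "gate_poly (Const_gate c) = nc_const c"
| "gate_poly (Sum_gate M) = (\<Sum>(a, p)\<in>#M. nc_const a * p)"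
| "gate_poly (Prod_gate es) = prod_list (map (\<lambda>(a, p). nc_const a * p) es)"

definition computes :: "'a::field circuit \<Rightarrow> 'a ncpoly \<Rightarrow> bool" where
  "computes C p \<longleftrightarrow> is_circuit C \<and> evaluates_to gate_poly C p"

text \<open>The formula (tree) into which a circuit unwinds.\<close>

datatype 'a formula = Formula "('a, 'a formula) gate"

definition same_unwinding :: "'a circuit \<Rightarrow> 'a circuit \<Rightarrow> bool" where
  "same_unwinding F G \<longleftrightarrow>
     is_circuit F \<and> is_circuit G \<and>
     (\<exists>t. evaluates_to Formula F t \<and> evaluates_to Formula G t)"

definition const_circuit :: "'a \<Rightarrow> 'a circuit" where
  "const_circuit c = \<lparr>nodes = {0}, gate_at = (\<lambda>_. Const_gate c), out_node = 0\<rparr>"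

text \<open>A copy of \<open>F\<close> sits inside \<open>C\<close>, with its output at node \<open>u\<close>.\<close>

definition occurs_at :: "'a circuit \<Rightarrow> 'a circuit \<Rightarrow> nat \<Rightarrow> bool" where
  "occurs_at F C u \<longleftrightarrow>
     (\<exists>\<phi>. inj_on \<phi> (nodes F) \<and> \<phi> ` nodes F \<subseteq> nodes C \<and>
          (\<forall>v\<in>nodes F. gate_at C (\<phi> v) = map_gate \<phi> (gate_at F v)) \<and>
          \<phi> (out_node F) = u)"

text \<open>
  \<open>sum_form C F G\<close> says that \<open>C\<close> is of the form \<open>F + G\<close>: its output is a sum gate whose two
  inputs are \<open>F\<close> and \<open>G\<close>. The copies of \<open>F\<close> and \<open>G\<close> may share nodes or be disjoint. Likewise
  for \<open>prod_form\<close>.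
\<close>

definition sum_form :: "'a::field circuit \<Rightarrow> 'a circuit \<Rightarrow> 'a circuit \<Rightarrow> bool" where
  "sum_form C F G \<longleftrightarrow>
     is_circuit C \<and> is_circuit F \<and> is_circuit G \<and>
     (\<exists>u v. gate_at C (out_node C) = Sum_gate {#(1, u), (1, v)#} \<and>
            occurs_at F C u \<and> occurs_at G C v)"

definition prod_form :: "'a::field circuit \<Rightarrow> 'a circuit \<Rightarrow> 'a circuit \<Rightarrow> bool" where
  "prod_form C F G \<longleftrightarrow>
     is_circuit C \<and> is_circuit F \<and> is_circuit G \<and>
     (\<exists>u v. gate_at C (out_node C) = Prod_gate [(1, u), (1, v)] \<and>
            occurs_at F C u \<and> occurs_at G C v)"

text \<open>
  \<open>C\<close> is of the form \<open>H(F\<^sub>1, F\<^sub>2, \<dots>)\<close>: it contains a copy of \<open>H\<close> in which every leaf labelled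
  by a variable is replaced by (the output of a copy of) the corresponding circuit. Different
  leaves with the same variable may, but need not, be replaced by the same copy.
\<close>

definition subst_form :: "'a circuit \<Rightarrow> 'a circuit \<Rightarrow> (nat \<Rightarrow> 'a circuit) \<Rightarrow> bool" where
  "subst_form C H Fs \<longleftrightarrow>
     is_circuit C \<and> is_circuit H \<and> (\<forall>i. is_circuit (Fs i)) \<and>
     (\<exists>\<phi>. inj_on \<phi> {v \<in> nodes H. \<not> is_Var_gate (gate_at H v)} \<and>
          \<phi> ` nodes H \<subseteq> nodes C \<and> \<phi> (out_node H) = out_node C \<and>
          (\<forall>v\<in>nodes H. case gate_at H v of
             Var_gate i \<Rightarrow> occurs_at (Fs i) C (\<phi> v)
           | g \<Rightarrow> gate_at C (\<phi> v) = map_gate \<phi> g))"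


section \<open>The proof system\<close>

type_synonym 'a equation = "'a circuit \<times> 'a circuit"

text \<open>\<open>K h\<close> is the fixed circuit that computes the basis element \<open>h\<close>.\<close>

inductive_set proof_axioms ::
    "'a::field ncpoly set \<Rightarrow> ('a ncpoly \<Rightarrow> 'a circuit) \<Rightarrow> 'a equation set"
  for B K where
  refl: "is_circuit F \<Longrightarrow> (F, F) \<in> proof_axioms B K"
| add_comm: "sum_form C F G \<Longrightarrow> sum_form D G F \<Longrightarrow> (C, D) \<in> proof_axioms B K"
| add_assoc: "sum_form GH G H \<Longrightarrow> sum_form C F GH \<Longrightarrow> sum_form FG F G \<Longrightarrow> sum_form D FG H
    \<Longrightarrow> (C, D) \<in> proof_axioms B K"
| mult_assoc: "prod_form GH G H \<Longrightarrow> prod_form C F GH \<Longrightarrow> prod_form FG F G \<Longrightarrow> prod_form D FG H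
    \<Longrightarrow> (C, D) \<in> proof_axioms B K"
| distrib_left: "sum_form GH G H \<Longrightarrow> prod_form C F GH
    \<Longrightarrow> prod_form FG F G \<Longrightarrow> prod_form FH F H \<Longrightarrow> sum_form D FG FH
    \<Longrightarrow> (C, D) \<in> proof_axioms B K"
| distrib_right: "sum_form GH G H \<Longrightarrow> prod_form C GH F
    \<Longrightarrow> prod_form GF G F \<Longrightarrow> prod_form HF H F \<Longrightarrow> sum_form D GF HF
    \<Longrightarrow> (C, D) \<in> proof_axioms B K"
| add_zero: "sum_form C F (const_circuit 0) \<Longrightarrow> (C, F) \<in> proof_axioms B K"
| mult_zero: "prod_form C F (const_circuit 0) \<Longrightarrow> (C, const_circuit 0) \<in> proof_axioms B K"
| mult_one: "prod_form C F (const_circuit 1) \<Longrightarrow> (C, F) \<in> proof_axioms B K"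
| field_add: "c = a + b \<Longrightarrow> sum_form C (const_circuit a) (const_circuit b)
    \<Longrightarrow> (const_circuit c, C) \<in> proof_axioms B K"
| field_mult: "c = a * b \<Longrightarrow> prod_form C (const_circuit a) (const_circuit b)
    \<Longrightarrow> (const_circuit c, C) \<in> proof_axioms B K"
| unwinding: "same_unwinding F F' \<Longrightarrow> (F, F') \<in> proof_axioms B K"
| basis: "h \<in> B \<Longrightarrow> subst_form C (K h) Fs \<Longrightarrow> (C, const_circuit 0) \<in> proof_axioms B K"

inductive_set one_step :: "'a::field equation set \<Rightarrow> 'a equation set" for S where
  sym: "(F, G) \<in> S \<Longrightarrow> (G, F) \<in> one_step S"
| trans: "(F, G) \<in> S \<Longrightarrow> (G, H) \<in> S \<Longrightarrow> (F, H) \<in> one_step S"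
| add: "(F1, G1) \<in> S \<Longrightarrow> (F2, G2) \<in> S \<Longrightarrow> sum_form C F1 F2 \<Longrightarrow> sum_form D G1 G2
    \<Longrightarrow> (C, D) \<in> one_step S"
| mult: "(F1, G1) \<in> S \<Longrightarrow> (F2, G2) \<in> S \<Longrightarrow> prod_form C F1 F2 \<Longrightarrow> prod_form D G1 G2
    \<Longrightarrow> (C, D) \<in> one_step S"

definition is_proof ::
    "'a::field ncpoly set \<Rightarrow> ('a ncpoly \<Rightarrow> 'a circuit) \<Rightarrow> 'a equation list \<Rightarrow> bool" where
  "is_proof B K \<pi> \<longleftrightarrow>
     (\<forall>i<length \<pi>. \<pi> ! i \<in> proof_axioms B K \<or> \<pi> ! i \<in> one_step (set (take i \<pi>)))"

definition proof_of ::
    "'a::field ncpoly set \<Rightarrow> ('a ncpoly \<Rightarrow> 'a circuit) \<Rightarrow> 'a equation \<Rightarrow> 'a equation list \<Rightarrow> bool"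
  where "proof_of B K e \<pi> \<longleftrightarrow> is_proof B K \<pi> \<and> e \<in> set \<pi>"

end

theory Submission
  imports Defs "HOL-Combinatorics.Multiset_Permutations" "HOL-Library.Function_Algebras"
    "HOL-Computational_Algebra.Primes"
begin

text \<open>
  A proof with \<open>t\<close> lines puts \<open>f\<close> into the two-sided ideal generated by at most \<open>t\<close> substitution
  instances \<open>g = h (p\<^sub>1, p\<^sub>2, \<dots>)\<close> of basis elements. Map the free algebra to the exterior
  algebra on the variables and look at degree \<open>m = 2 * d + 1\<close>. The even parts of the \<open>p\<^sub>i\<close> become
  central, so \<open>h\<close> can be expanded around them; the coefficients of this Taylor expansion are again
  identities of the matrix algebra and therefore start in degree \<open>2 * d\<close>. Hence only the constant
  and linear parts of the \<open>p\<^sub>i\<close> survive, \<open>g\<close> itself becomes central up to degree \<open>m\<close>, and the ideal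
  generated by \<open>g\<close> contributes to degree \<open>m\<close> a sum of boundedly many products of \<open>m\<close> linear forms.
  So \<open>f\<close> is sent to a sum of \<open>O(t)\<close> such products, each of which has \<open>m * n\<close> parameters, whereas
  the exterior power has dimension \<open>n choose m\<close>; as a polynomial map cannot be onto a space of
  larger dimension, some element of the exterior power needs of the order of \<open>n\<^sup>m / n\<close> products.
  By the Amitsur-Levitzki theorem every element of the exterior power is the image of an identity,
  namely of a linear combination of standard polynomials.

  The Amitsur-Levitzki theorem is deduced from the fundamental trace identity
  \<open>\<Sum>\<^sub>\<sigma> sgn \<sigma> tr\<^sub>\<sigma> (X\<^sub>0, \<dots>, X\<^sub>d) = 0\<close>, where \<open>tr\<^sub>\<sigma>\<close> is the product over the cycles of \<open>\<sigma>\<close>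
  of the traces of the products along the cycle.
\<close>

section \<open>Non-commutative polynomials and substitution\<close>

text \<open>The obstacle is that a single line can enter the ideal through arbitrarily many
  multiples \<open>r * g * s\<close>; they collapse to one only if \<open>g\<close> is central. The
  degree \<open>m = 2 * d + 1\<close> is chosen for this: what remains of \<open>g\<close> has words
  of length \<open>2 * d\<close>, which are even and hence central in the exterior algebra, and
  words of length \<open>m\<close>, which already lie in the top degree. Replacing an even part by
  its constant term or an odd part by its linear term leaves an error of degree at least
  \<open>2 * d + 2\<close>, so nothing else survives. That the coefficients of the Taylor expansion
  start in degree \<open>2 * d\<close> is seen on the staircase of matrix units E00, E01, E11, E12,
  ...: a product using each of the first few once is non-zero only in increasing order.
  Characteristic 0 enters through the division by \<open>m!\<close> and by the \<open>d!\<close>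
  produced by the trace identity, and through distinct integers staying distinct in the field, which
  separates monomials and permits interpolation on arbitrarily large grids.\<close>

lemma zero_Word: "(0::word) = Word []"
  by (simp add: zero_word_def)

lemma plus_Word [simp]: "Word u + Word v = Word (u @ v)"
  by (simp add: plus_word_def)

lemma ncpoly_sum_single:
  fixes p :: "'a::field ncpoly"
  shows "p = (\<Sum>w\<in>Poly_Mapping.keys p. Poly_Mapping.single w (Poly_Mapping.lookup p w))"
  by (rule poly_mapping_eqI)
     (auto simp: lookup_sum lookup_single when_def not_in_keys_iff_lookup_eq_zero)

lemma ncpoly_induct [case_names zero single add]:
  fixes p :: "'a::field ncpoly"
  assumes "P 0" "\<And>u c. P (Poly_Mapping.single (Word u) c)" "\<And>p q. P p \<Longrightarrow> P q \<Longrightarrow> P (p + q)"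
  shows "P p"
proof -
  have "P (\<Sum>w\<in>A. Poly_Mapping.single w (Poly_Mapping.lookup p w))" if "finite A" for A
    using that
  proof induction
    case (insert w A)
    then show ?case using assms by (cases w) auto
  qed (use assms in auto)
  then show ?thesis using ncpoly_sum_single[of p] by (metis finite_keys)
qed

lemma lookup_mult_Word:
  fixes p q :: "'a::field ncpoly"
  shows "Poly_Mapping.lookup (p * q) (Word w)
    = (\<Sum>i\<le>length w. Poly_Mapping.lookup p (Word (take i w)) * Poly_Mapping.lookup q (Word (drop i w)))"
proof (induction p rule: ncpoly_induct)
  case (single u c)
  show ?case
  proof (induction q rule: ncpoly_induct)
    case (single v d)
    have "(\<Sum>i\<le>length w. (c when u = take i w) * (d when v = drop i w))
        = (\<Sum>i\<le>length w. if i = length u then (c * d when u @ v = w) else 0)"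
    proof (rule sum.cong)
      fix i assume "i \<in> {..length w}"
      then have "u = take i w \<and> v = drop i w \<longleftrightarrow> i = length u \<and> u @ v = w"
        by auto
      moreover have "(c when P) * (d when Q) = (c * d when P \<and> Q)" for P Q
        by (auto simp: when_def)
      ultimately show "(c when u = take i w) * (d when v = drop i w)
          = (if i = length u then (c * d when u @ v = w) else 0)"
        by (simp add: when_def cong: if_cong)
    qed simp
    also have "\<dots> = (c * d when u @ v = w)"
      by (auto simp: when_def)
    finally show ?case
      by (simp add: mult_single lookup_single when_def cong: if_cong)
  qed (simp_all add: ring_distribs lookup_add sum.distrib)
qed (simp_all add: ring_distribs lookup_add sum.distrib)

lemma nc_const_mult_commute: "nc_const c * p = p * nc_const (c::'a::field)"
  by (induction p rule: ncpoly_induct)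
     (simp_all add: nc_const_def mult_single ring_distribs mult.commute)

lemma nc_const_mult: "nc_const (a * b) = nc_const a * nc_const (b::'a::field)"
  by (simp add: nc_const_def mult_single)

lemma nc_const_add: "nc_const (a + b) = nc_const a + nc_const (b::'a::field)"
  by (simp add: nc_const_def single_add)

lemma nc_const_0 [simp]: "nc_const (0::'a::field) = 0"
  by (simp add: nc_const_def)

lemma nc_const_1 [simp]: "nc_const (1::'a::field) = 1"
  by (simp add: nc_const_def)

lemma nc_const_sum: "nc_const (\<Sum>i\<in>A. f i :: 'a::field) = (\<Sum>i\<in>A. nc_const (f i))"
  by (induction A rule: infinite_finite_induct) (simp_all add: nc_const_add)

lemma lookup_nc_const_mult [simp]:
  "Poly_Mapping.lookup (nc_const c * p) w = c * Poly_Mapping.lookup p (w::word)"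
  by (induction p rule: ncpoly_induct)
     (auto simp: nc_const_def mult_single ring_distribs lookup_add lookup_single when_def)

lemma nc_subst_superset:
  assumes "finite W" "Poly_Mapping.keys g \<subseteq> W"
  shows "nc_subst h g
    = (\<Sum>w\<in>W. nc_const (Poly_Mapping.lookup g w) * prod_list (map h (letters w)))"
  unfolding nc_subst_def
  by (rule sum.mono_neutral_left) (use assms in \<open>auto simp: not_in_keys_iff_lookup_eq_zero\<close>)

lemma nc_subst_add: "nc_subst h (p + q) = nc_subst h p + nc_subst h q"
proof -
  let ?W = "Poly_Mapping.keys p \<union> Poly_Mapping.keys q"
  have "finite ?W" by simp
  note * = nc_subst_superset[OF this, where h=h]
  have "nc_subst h (p + q) = (\<Sum>w\<in>?W. nc_const (Poly_Mapping.lookup (p + q) w) * prod_list (map h (letters w)))"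
    by (rule *) (rule Poly_Mapping.keys_add)
  then show ?thesis
    by (simp add: *[of p] *[of q] lookup_add nc_const_add ring_distribs sum.distrib)
qed

lemma nc_subst_0 [simp]: "nc_subst h 0 = 0"
  by (simp add: nc_subst_def)

lemma nc_subst_single:
  "nc_subst h (Poly_Mapping.single (Word u) c) = nc_const c * prod_list (map h u)"
  by (subst nc_subst_superset[of "{Word u}"]) auto

lemma nc_subst_mult: "nc_subst h (p * q) = nc_subst h p * nc_subst h (q::'a::field ncpoly)"
proof (induction p rule: ncpoly_induct)
  case (single u c)
  show ?case
  proof (induction q rule: ncpoly_induct)
    case (single v d)
    have "nc_const c * nc_const d * (P * Q) = nc_const c * P * (nc_const d * Q)" for P Q :: "'a ncpoly"
      by (metis mult.assoc nc_const_mult_commute)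
    then show ?case
      by (simp add: mult_single nc_subst_single nc_const_mult)
  qed (simp_all add: ring_distribs nc_subst_add)
qed (simp_all add: ring_distribs nc_subst_add)

lemma nc_subst_const [simp]: "nc_subst h (nc_const c) = nc_const c"
  using nc_subst_single[of h "[]" c] by (simp add: nc_const_def zero_Word)

lemma nc_subst_1 [simp]: "nc_subst h 1 = 1"
  using nc_subst_const[of h 1] by simp

lemma nc_subst_var [simp]: "nc_subst h (nc_var i) = h i"
  by (simp add: nc_var_def nc_subst_single)

lemma nc_subst_prod_list: "nc_subst h (prod_list ps) = prod_list (map (nc_subst h) ps)"
  by (induction ps) (simp_all add: nc_subst_mult)

lemma nc_subst_sum_mset: "nc_subst h (sum_mset M) = sum_mset (image_mset (nc_subst h) M)"
  by (induction M) (simp_all add: nc_subst_add)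

section \<open>Soundness of the proof system\<close>

definition is_valuation :: "(('a, 'r) gate \<Rightarrow> 'r) \<Rightarrow> 'a circuit \<Rightarrow> (nat \<Rightarrow> 'r) \<Rightarrow> bool" where
  "is_valuation \<alpha> C val \<longleftrightarrow> (\<forall>v\<in>nodes C. val v = \<alpha> (map_gate val (gate_at C v)))"

definition circuit_rel :: "'a circuit \<Rightarrow> (nat \<times> nat) set" where
  "circuit_rel C = {(u, v). v \<in> nodes C \<and> u \<in> children (gate_at C v)}"

lemma wf_circuit_rel:
  assumes "is_circuit C"
  shows "wf (circuit_rel C)"
proof (rule finite_acyclic_wf)
  have "circuit_rel C \<subseteq> nodes C \<times> nodes C"
    using assms by (auto simp: is_circuit_def circuit_rel_def)
  then show "finite (circuit_rel C)"
    using assms by (meson finite_SigmaI finite_subset is_circuit_def)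
qed (use assms in \<open>simp add: is_circuit_def circuit_rel_def\<close>)

lemma valuation_exists:
  assumes "is_circuit C"
  shows "\<exists>val. is_valuation \<alpha> C val"
proof -
  define val where "val = wfrec (circuit_rel C) (\<lambda>f v. \<alpha> (map_gate f (gate_at C v)))"
  have "val v = \<alpha> (map_gate val (gate_at C v))" if "v \<in> nodes C" for v
  proof -
    have "val v = \<alpha> (map_gate (cut val (circuit_rel C) v) (gate_at C v))"
      unfolding val_def by (subst wfrec[OF wf_circuit_rel[OF assms]]) simp
    also have "map_gate (cut val (circuit_rel C) v) (gate_at C v) = map_gate val (gate_at C v)"
      by (rule gate.map_cong) (use that in \<open>auto simp: cut_def circuit_rel_def\<close>)
    finally show ?thesis .
  qed
  then show ?thesis
    by (auto simp: is_valuation_def)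
qed

lemma valuation_unique:
  assumes "is_circuit C" "is_valuation \<alpha> C f" "is_valuation \<alpha> C g" "v \<in> nodes C"
  shows "f v = g v"
  using wf_circuit_rel[OF assms(1)] assms(4)
proof (induction v rule: wf_induct_rule)
  case (less v)
  have "map_gate f (gate_at C v) = map_gate g (gate_at C v)"
  proof (rule gate.map_cong)
    fix u assume "u \<in> children (gate_at C v)"
    then show "f u = g u"
      using less assms(1) by (auto simp: circuit_rel_def is_circuit_def)
  qed simp
  then show ?case
    using assms(2,3) less.prems by (simp add: is_valuation_def)
qed

definition circuit_val :: "(('a, 'r) gate \<Rightarrow> 'r) \<Rightarrow> 'a circuit \<Rightarrow> nat \<Rightarrow> 'r" where
  "circuit_val \<alpha> C = (SOME val. is_valuation \<alpha> C val)"

lemma is_valuation_circuit_val: "is_circuit C \<Longrightarrow> is_valuation \<alpha> C (circuit_val \<alpha> C)"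
  unfolding circuit_val_def by (rule someI_ex[OF valuation_exists])

lemma circuit_val_eq:
  assumes "is_circuit C" "v \<in> nodes C"
  shows "circuit_val \<alpha> C v = \<alpha> (map_gate (circuit_val \<alpha> C) (gate_at C v))"
  using is_valuation_circuit_val[OF assms(1), of \<alpha>] assms(2) by (simp add: is_valuation_def)

definition circuit_out :: "(('a, 'r) gate \<Rightarrow> 'r) \<Rightarrow> 'a circuit \<Rightarrow> 'r" where
  "circuit_out \<alpha> C = circuit_val \<alpha> C (out_node C)"

lemma out_node_in_nodes: "is_circuit C \<Longrightarrow> out_node C \<in> nodes C"
  by (simp add: is_circuit_def)

lemma evaluates_to_iff:
  assumes "is_circuit C"
  shows "evaluates_to \<alpha> C r \<longleftrightarrow> r = circuit_out \<alpha> C"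
proof
  assume "evaluates_to \<alpha> C r"
  then obtain val where "is_valuation \<alpha> C val" "val (out_node C) = r"
    by (auto simp: evaluates_to_def is_valuation_def)
  then show "r = circuit_out \<alpha> C"
    using valuation_unique[OF assms _ is_valuation_circuit_val[OF assms] out_node_in_nodes[OF assms]]
    by (auto simp: circuit_out_def)
next
  assume "r = circuit_out \<alpha> C"
  then show "evaluates_to \<alpha> C r"
    using is_valuation_circuit_val[OF assms]
    by (auto simp: evaluates_to_def is_valuation_def circuit_out_def)
qed

lemma computes_iff: "computes C p \<longleftrightarrow> is_circuit C \<and> p = circuit_out gate_poly C"
  by (auto simp: computes_def evaluates_to_iff)

text \<open>The valuation of \<open>C\<close>, pulled back along the embedding of \<open>F\<close>,
  satisfies the gate equations of \<open>F\<close>, so by uniqueness it is the valuation of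
  \<open>F\<close>.\<close>

lemma occurs_at_val:
  assumes "is_circuit F" "is_circuit C" "occurs_at F C u"
  shows "u \<in> nodes C" "circuit_val \<alpha> C u = circuit_out \<alpha> F"
proof -
  obtain \<phi> where \<phi>: "\<phi> ` nodes F \<subseteq> nodes C" "\<phi> (out_node F) = u"
    "\<And>v. v \<in> nodes F \<Longrightarrow> gate_at C (\<phi> v) = map_gate \<phi> (gate_at F v)"
    using assms(3) by (auto simp: occurs_at_def)
  note out = out_node_in_nodes[OF assms(1)]
  show "u \<in> nodes C"
    using \<phi> out by auto
  have "is_valuation \<alpha> F (circuit_val \<alpha> C \<circ> \<phi>)"
    unfolding is_valuation_def
  proof
    fix v assume v: "v \<in> nodes F"
    then have "circuit_val \<alpha> C (\<phi> v) = \<alpha> (map_gate (circuit_val \<alpha> C) (gate_at C (\<phi> v)))"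
      using \<phi> by (intro circuit_val_eq assms) auto
    then show "(circuit_val \<alpha> C \<circ> \<phi>) v = \<alpha> (map_gate (circuit_val \<alpha> C \<circ> \<phi>) (gate_at F v))"
      using v by (simp add: \<phi> gate.map_comp)
  qed
  from valuation_unique[OF assms(1) this is_valuation_circuit_val[OF assms(1)] out]
  show "circuit_val \<alpha> C u = circuit_out \<alpha> F"
    by (simp add: \<phi> circuit_out_def)
qed

abbreviation circuit_poly :: "'a::field circuit \<Rightarrow> 'a ncpoly" where
  "circuit_poly \<equiv> circuit_out gate_poly"

lemma sum_form_poly:
  assumes "sum_form C F G"
  shows "circuit_poly C = circuit_poly F + circuit_poly G"
proof -
  obtain u v where uv: "gate_at C (out_node C) = Sum_gate {#(1, u), (1, v)#}"
    "occurs_at F C u" "occurs_at G C v" and C: "is_circuit C" "is_circuit F" "is_circuit G"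
    using assms by (auto simp: sum_form_def)
  show ?thesis
    unfolding circuit_out_def[of _ C]
    by (subst circuit_val_eq)
       (use uv C in \<open>auto simp: out_node_in_nodes occurs_at_val(2)\<close>)
qed

lemma prod_form_poly:
  assumes "prod_form C F G"
  shows "circuit_poly C = circuit_poly F * circuit_poly G"
proof -
  obtain u v where uv: "gate_at C (out_node C) = Prod_gate [(1, u), (1, v)]"
    "occurs_at F C u" "occurs_at G C v" and C: "is_circuit C" "is_circuit F" "is_circuit G"
    using assms by (auto simp: prod_form_def)
  show ?thesis
    unfolding circuit_out_def[of _ C]
    by (subst circuit_val_eq)
       (use uv C in \<open>auto simp: out_node_in_nodes occurs_at_val(2)\<close>)
qed

lemma is_circuit_const [simp]: "is_circuit (const_circuit c)"
  by (auto simp: is_circuit_def const_circuit_def acyclic_def)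

lemma circuit_poly_const [simp]: "circuit_poly (const_circuit c) = nc_const c"
  unfolding circuit_out_def
  by (subst circuit_val_eq) (auto simp: const_circuit_def out_node_in_nodes is_circuit_def acyclic_def)

primrec formula_poly :: "'a::field formula \<Rightarrow> 'a ncpoly" where
  "formula_poly (Formula g) = gate_poly (map_gate formula_poly g)"

text \<open>Composing \<open>formula_poly\<close> with the unwinding valuation solves the gate
  equations for \<open>gate_poly\<close>, so the polynomial depends on the unwound formula
  only.\<close>

lemma circuit_poly_unwinding:
  assumes "is_circuit F"
  shows "circuit_poly F = formula_poly (circuit_out Formula F)"
proof -
  have "is_valuation gate_poly F (formula_poly \<circ> circuit_val Formula F)"
    unfolding is_valuation_def
    by (simp add: circuit_val_eq[OF assms] gate.map_comp)
  from valuation_unique[OF assms is_valuation_circuit_val[OF assms] this out_node_in_nodes[OF assms]]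
  show ?thesis
    by (simp add: circuit_out_def)
qed

lemma same_unwinding_poly: "same_unwinding F G \<Longrightarrow> circuit_poly F = circuit_poly G"
  by (auto simp: same_unwinding_def evaluates_to_iff circuit_poly_unwinding)

lemma nc_subst_gate_poly:
  assumes "\<not> is_Var_gate g"
  shows "nc_subst h (gate_poly g) = gate_poly (map_gate (nc_subst h) g)"
proof (cases g)
  case (Sum_gate M)
  have "(\<lambda>x. nc_subst h (case x of (a, p) \<Rightarrow> nc_const a * p))
      = (\<lambda>x. case map_prod id (nc_subst h) x of (a, p) \<Rightarrow> nc_const a * p)"
    by (auto simp: fun_eq_iff nc_subst_mult)
  then show ?thesis
    using Sum_gate by (simp add: nc_subst_sum_mset image_mset.compositionality comp_def)
next
  case (Prod_gate es)
  have "(\<lambda>x. nc_subst h (case x of (a, p) \<Rightarrow> nc_const a * p))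
      = (\<lambda>x. case map_prod id (nc_subst h) x of (a, p) \<Rightarrow> nc_const a * p)"
    by (auto simp: fun_eq_iff nc_subst_mult)
  then show ?thesis
    using Prod_gate by (simp add: nc_subst_prod_list comp_def)
qed (use assms in auto)

text \<open>Induction along the edges of \<open>H\<close>: variable leaves carry the polynomials of
  the \<open>Fs i\<close>, and \<open>nc_subst\<close> is a ring homomorphism, so it passes through
  all other gates.\<close>

lemma subst_form_poly:
  assumes "subst_form C H Fs"
  shows "circuit_poly C = nc_subst (\<lambda>i. circuit_poly (Fs i)) (circuit_poly H)"
proof -
  define h where "h = (\<lambda>i. circuit_poly (Fs i))"
  have C: "is_circuit C" "is_circuit H" "\<And>i. is_circuit (Fs i)"
    using assms by (auto simp: subst_form_def)
  obtain \<phi> where \<phi>: "\<phi> ` nodes H \<subseteq> nodes C" "\<phi> (out_node H) = out_node C"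
    and gates: "\<And>v. v \<in> nodes H \<Longrightarrow> case gate_at H v of
             Var_gate i \<Rightarrow> occurs_at (Fs i) C (\<phi> v)
           | g \<Rightarrow> gate_at C (\<phi> v) = map_gate \<phi> g"
    using assms by (auto simp: subst_form_def)
  have "circuit_val gate_poly C (\<phi> v) = nc_subst h (circuit_val gate_poly H v)" if "v \<in> nodes H" for v
    using wf_circuit_rel[OF C(2)] that
  proof (induction v rule: wf_induct_rule)
    case (less v)
    show ?case
    proof (cases "is_Var_gate (gate_at H v)")
      case True
      then obtain i where i: "gate_at H v = Var_gate i"
        by (auto simp: is_Var_gate_def)
      then have "circuit_val gate_poly C (\<phi> v) = h i"
        using gates[OF less.prems] C by (simp add: h_def occurs_at_val(2))
      then show ?thesis
        using i by (simp add: circuit_val_eq[OF C(2) less.prems])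
    next
      case False
      then have g: "gate_at C (\<phi> v) = map_gate \<phi> (gate_at H v)"
        using gates[OF less.prems] by (auto split: gate.splits)
      have "map_gate (circuit_val gate_poly C \<circ> \<phi>) (gate_at H v)
          = map_gate (nc_subst h \<circ> circuit_val gate_poly H) (gate_at H v)"
      proof (rule gate.map_cong)
        fix u assume "u \<in> children (gate_at H v)"
        then show "(circuit_val gate_poly C \<circ> \<phi>) u = (nc_subst h \<circ> circuit_val gate_poly H) u"
          using less C(2) by (auto simp: circuit_rel_def is_circuit_def)
      qed simp
      moreover have "\<phi> v \<in> nodes C"
        using \<phi> less.prems by auto
      ultimately show ?thesis
        using False
        by (simp add: circuit_val_eq[OF C(1)] circuit_val_eq[OF C(2) less.prems] g gate.map_comp
            nc_subst_gate_poly)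
    qed
  qed
  from this[OF out_node_in_nodes[OF C(2)]] show ?thesis
    by (simp add: circuit_out_def \<phi> h_def)
qed

section \<open>Congruence modulo a two-sided ideal along a derivation\<close>

lemma two_sided_ideal_uminus: "p \<in> two_sided_ideal S \<Longrightarrow> - p \<in> two_sided_ideal S"
  using two_sided_ideal.mult_left[of p S "-1"] by simp

lemma two_sided_ideal_diff_swap: "p - q \<in> two_sided_ideal S \<Longrightarrow> q - p \<in> two_sided_ideal S"
  using two_sided_ideal_uminus by fastforce

lemma two_sided_ideal_diff_trans:
  "p - q \<in> two_sided_ideal S \<Longrightarrow> q - r \<in> two_sided_ideal S \<Longrightarrow> p - r \<in> two_sided_ideal S"
  using two_sided_ideal.add by fastforce

lemma two_sided_ideal_diff_add:
  assumes "p - q \<in> two_sided_ideal S" "p' - q' \<in> two_sided_ideal S"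
  shows "(p + p') - (q + q') \<in> two_sided_ideal S"
  using two_sided_ideal.add[OF assms] by (simp add: algebra_simps)

lemma two_sided_ideal_diff_mult:
  assumes "p - q \<in> two_sided_ideal S" "p' - q' \<in> two_sided_ideal S"
  shows "p * p' - q * q' \<in> two_sided_ideal S"
proof -
  have "p * p' - q * q' = (p - q) * p' + q * (p' - q')"
    by (simp add: algebra_simps)
  then show ?thesis
    using assms by (auto intro: two_sided_ideal.intros)
qed

definition basis_axiom :: "'a::field ncpoly set \<Rightarrow> ('a ncpoly \<Rightarrow> 'a circuit) \<Rightarrow> 'a equation \<Rightarrow> bool"
  where "basis_axiom B K e \<longleftrightarrow>
    snd e = const_circuit 0 \<and> (\<exists>h\<in>B. \<exists>Fs. subst_form (fst e) (K h) Fs)"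

text \<open>Every axiom scheme outside the basis is an identity of the free algebra, so only basis
  instances can relate different polynomials.\<close>

lemma proof_axioms_sound:
  assumes "(C, D) \<in> proof_axioms B K"
  shows "basis_axiom B K (C, D) \<or> circuit_poly C = circuit_poly D"
  using assms
proof cases
  case (basis h Fs)
  then show ?thesis by (auto simp: basis_axiom_def)
qed (auto simp: sum_form_poly prod_form_poly same_unwinding_poly algebra_simps nc_const_add nc_const_mult)

lemma basis_axiom_poly:
  assumes "basis_axiom B K e" "\<And>h. h \<in> B \<Longrightarrow> computes (K h) h"
  shows "circuit_poly (fst e) \<in> subst_instances B"
  using assms by (fastforce simp: basis_axiom_def subst_instances_def computes_iff subst_form_poly)

text \<open>The four rules preserve congruence modulo an ideal. A line that is a basis axiom
  supplies one generator and the other lines supply none, which is why the number of lines bounds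
  the number of generators.\<close>

lemma is_proof_sound:
  assumes "is_proof B K \<pi>" "e \<in> set \<pi>"
  shows "circuit_poly (fst e) - circuit_poly (snd e)
    \<in> two_sided_ideal ((\<lambda>e. circuit_poly (fst e)) ` {e \<in> set \<pi>. basis_axiom B K e})"
    (is "?ok e")
proof -
  have "?ok (\<pi> ! i)" if "i < length \<pi>" for i
    using that
  proof (induction i rule: less_induct)
    case (less i)
    have prev: "?ok e" if "e \<in> set (take i \<pi>)" for e
      using that less by (auto simp: in_set_conv_nth)
    obtain C D where CD: "\<pi> ! i = (C, D)"
      by force
    from assms(1) less.prems have "\<pi> ! i \<in> proof_axioms B K \<or> \<pi> ! i \<in> one_step (set (take i \<pi>))"
      by (auto simp: is_proof_def)
    then show ?case
    proof
      assume "\<pi> ! i \<in> proof_axioms B K"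
      then consider "basis_axiom B K (C, D)" | "circuit_poly C = circuit_poly D"
        using proof_axioms_sound CD by metis
      then show ?thesis
      proof cases
        case 1
        then have "circuit_poly D = 0"
          by (simp add: basis_axiom_def)
        moreover have "(C, D) \<in> set \<pi>"
          using CD less.prems by (metis nth_mem)
        ultimately show ?thesis
          using 1 unfolding CD by (force intro: two_sided_ideal.gen)
      qed (simp add: CD two_sided_ideal.zero)
    next
      assume "\<pi> ! i \<in> one_step (set (take i \<pi>))"
      then have "(C, D) \<in> one_step (set (take i \<pi>))"
        by (simp only: CD)
      then have "?ok (C, D)"
      proof cases
        case sym
        then show ?thesis using prev two_sided_ideal_diff_swap by fastforce
      next
        case (trans G)
        then show ?thesis using prev two_sided_ideal_diff_trans by fastforce
      next
        case (add F1 G1 F2 G2)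
        then show ?thesis
          using prev[OF add(1)] prev[OF add(2)] two_sided_ideal_diff_add
          by (simp add: sum_form_poly)
      next
        case (mult F1 G1 F2 G2)
        then show ?thesis
          using prev[OF mult(1)] prev[OF mult(2)] two_sided_ideal_diff_mult
          by (simp add: prod_form_poly)
      qed
      then show ?thesis by (simp only: CD)
    qed
  qed
  then show ?thesis
    using assms(2) by (auto simp: in_set_conv_nth)
qed

theorem proof_of_sound:
  assumes "proof_of B K (F, const_circuit 0) \<pi>" "computes F f"
    and "\<And>h. h \<in> B \<Longrightarrow> computes (K h) h"
  obtains T where "finite T" "card T \<le> length \<pi>" "T \<subseteq> subst_instances B" "f \<in> two_sided_ideal T"
proof
  let ?T = "(\<lambda>e. circuit_poly (fst e)) ` {e \<in> set \<pi>. basis_axiom B K e}"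
  show "finite ?T" by simp
  have "card ?T \<le> card {e \<in> set \<pi>. basis_axiom B K e}"
    by (rule card_image_le) simp
  also have "\<dots> \<le> card (set \<pi>)"
    by (rule card_mono) auto
  also have "\<dots> \<le> length \<pi>"
    by (rule card_length)
  finally show "card ?T \<le> length \<pi>" .
  show "?T \<subseteq> subst_instances B"
    using basis_axiom_poly[OF _ assms(3)] by blast
  show "f \<in> two_sided_ideal ?T"
    using is_proof_sound[of B K \<pi> "(F, const_circuit 0)"] assms(1,2)
    by (simp add: proof_of_def computes_iff)
qed

section \<open>Polynomial maps into a space of larger dimension are not surjective\<close>

interpretation fun_space: vector_space "\<lambda>(c::'a::field) (f::'b \<Rightarrow> 'a) x. c * f x"
  by unfold_locales (simp_all add: fun_eq_iff algebra_simps)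

text \<open>The exponent of each variable is bounded separately, so the space is spanned by
  \<open>(k + 1) ^ card X\<close> monomials and the bounds add up under products.\<close>

definition poly_funs :: "'x set \<Rightarrow> nat \<Rightarrow> (('x \<Rightarrow> 'a::field) \<Rightarrow> 'a) set" where
  "poly_funs X k = fun_space.span ((\<lambda>e x. \<Prod>i\<in>X. x i ^ e i) ` (X \<rightarrow>\<^sub>E {..k}))"

lemma poly_funs_monomial:
  "e \<in> X \<rightarrow>\<^sub>E {..k} \<Longrightarrow> (\<lambda>x. \<Prod>i\<in>X. x i ^ e i) \<in> poly_funs X k"
  unfolding poly_funs_def by (rule fun_space.span_base) (rule imageI)

lemma poly_funs_scale:
  assumes "f \<in> poly_funs X k"
  shows "(\<lambda>x. c * f x) \<in> poly_funs X k"
  using fun_space.span_scale[of f _ c] assms by (simp add: poly_funs_def)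

lemma poly_funs_const: "(\<lambda>_. c) \<in> poly_funs X k"
  using poly_funs_scale[OF poly_funs_monomial[of "\<lambda>i\<in>X. 0" X k], of c]
  by (simp cong: prod.cong)

lemma poly_funs_var:
  assumes "i \<in> X" "finite X"
  shows "(\<lambda>x. x i) \<in> poly_funs X 1"
proof -
  have "(\<Prod>j\<in>X. x j ^ (\<lambda>j\<in>X. if j = i then 1 else 0) j) = x i" for x :: "'a \<Rightarrow> 'b"
  proof -
    have "(\<Prod>j\<in>X. x j ^ (\<lambda>j\<in>X. if j = i then 1 else 0) j) = (\<Prod>j\<in>X. if j = i then x i else 1)"
      by (rule prod.cong) auto
    then show ?thesis
      using assms by simp
  qed
  note eq = this
  have "(\<lambda>x :: 'a \<Rightarrow> 'b. \<Prod>j\<in>X. x j ^ (\<lambda>j\<in>X. if j = i then 1 else 0) j) \<in> poly_funs X 1"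
    by (rule poly_funs_monomial) auto
  also have "(\<lambda>x :: 'a \<Rightarrow> 'b. \<Prod>j\<in>X. x j ^ (\<lambda>j\<in>X. if j = i then 1 else 0) j) = (\<lambda>x. x i)"
    by (rule ext) (rule eq)
  finally show ?thesis .
qed

lemma poly_funs_add:
  assumes "f \<in> poly_funs X k" "g \<in> poly_funs X k"
  shows "(\<lambda>x. f x + g x) \<in> poly_funs X k"
  using fun_space.span_add[of f _ g] assms by (simp add: poly_funs_def plus_fun_def)

lemma poly_funs_sum:
  assumes "\<And>i. i \<in> I \<Longrightarrow> f i \<in> poly_funs X k"
  shows "(\<lambda>x. \<Sum>i\<in>I. f i x) \<in> poly_funs X k"
  using assms
proof (induction I rule: infinite_finite_induct)
  case (insert i I)
  then show ?case using poly_funs_add[of "f i"] by simp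
qed (use poly_funs_const[of 0] in simp_all)

lemma poly_funs_mult_mono:
  assumes "finite X" "g \<in> poly_funs X l" "e \<in> X \<rightarrow>\<^sub>E {..k}"
  shows "(\<lambda>x. (\<Prod>i\<in>X. x i ^ e i) * g x) \<in> poly_funs X (k + l)"
  using assms(2) unfolding poly_funs_def[of X l]
proof (induction rule: fun_space.span_induct_alt)
  case base
  show ?case using poly_funs_const[of 0] by (simp add: zero_fun_def)
next
  case (step c f g)
  then obtain e' where e': "e' \<in> X \<rightarrow>\<^sub>E {..l}" "f = (\<lambda>x. \<Prod>i\<in>X. x i ^ e' i)"
    by auto
  have "(\<lambda>x. \<Prod>i\<in>X. x i ^ (\<lambda>i\<in>X. e i + e' i) i) \<in> poly_funs X (k + l)"
    by (rule poly_funs_monomial) (use assms(3) e' in \<open>fastforce intro: add_mono\<close>)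
  also have "(\<lambda>x. \<Prod>i\<in>X. x i ^ (\<lambda>i\<in>X. e i + e' i) i) = (\<lambda>x. (\<Prod>i\<in>X. x i ^ e i) * f x)"
    by (simp add: e' power_add prod.distrib cong: prod.cong)
  finally have "(\<lambda>x. c * ((\<Prod>i\<in>X. x i ^ e i) * f x) + (\<Prod>i\<in>X. x i ^ e i) * g x) \<in> poly_funs X (k + l)"
    by (intro poly_funs_add poly_funs_scale step)
  then show ?case
    by (simp add: plus_fun_def algebra_simps)
qed

lemma poly_funs_mult:
  assumes "finite X" "f \<in> poly_funs X k" "g \<in> poly_funs X l"
  shows "(\<lambda>x. f x * g x) \<in> poly_funs X (k + l)"
  using assms(2) unfolding poly_funs_def[of X k]
proof (induction rule: fun_space.span_induct_alt)
  case base
  show ?case using poly_funs_const[of 0] by (simp add: zero_fun_def)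
next
  case (step c f f')
  then obtain e where e: "e \<in> X \<rightarrow>\<^sub>E {..k}" "f = (\<lambda>x. \<Prod>i\<in>X. x i ^ e i)"
    by auto
  have "(\<lambda>x. c * (f x * g x) + f' x * g x) \<in> poly_funs X (k + l)"
    using poly_funs_mult_mono[OF assms(1,3) e(1)]
    by (intro poly_funs_add poly_funs_scale step) (simp add: e)
  then show ?case
    by (simp add: plus_fun_def algebra_simps)
qed

lemma poly_funs_prod:
  assumes "finite X" "finite I" "\<And>i. i \<in> I \<Longrightarrow> f i \<in> poly_funs X k"
  shows "(\<lambda>x. \<Prod>i\<in>I. f i x) \<in> poly_funs X (card I * k)"
  using assms(2,3)
proof (induction I)
  case empty
  then show ?case using poly_funs_const[of 1] by simp
next
  case (insert i I)
  then show ?case using poly_funs_mult[OF assms(1), of "f i" k "\<lambda>x. \<Prod>i\<in>I. f i x"] by simp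
qed

lemma sum_fun_apply: "(\<Sum>i\<in>A. f i) x = (\<Sum>i\<in>A. f i x)"
  by (induction A rule: infinite_finite_induct) simp_all

text \<open>The values \<open>Q c (pt c')\<close> form a diagonal matrix without zeros on the
  diagonal, so the \<open>Q c\<close> are linearly independent, and their number is at most that of
  the spanning monomials.\<close>

lemma card_independent_poly_funs_le:
  fixes Q :: "'c \<Rightarrow> ('x \<Rightarrow> 'a::field) \<Rightarrow> 'a"
  assumes "finite X" "finite S" "\<And>c. c \<in> S \<Longrightarrow> Q c \<in> poly_funs X k"
    and diag: "\<And>c. c \<in> S \<Longrightarrow> Q c (pt c) \<noteq> 0"
    and off: "\<And>c c'. c \<in> S \<Longrightarrow> c' \<in> S \<Longrightarrow> c \<noteq> c' \<Longrightarrow> Q c (pt c') = 0"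
  shows "card S \<le> (k + 1) ^ card X"
proof -
  let ?T = "(\<lambda>e (x :: 'x \<Rightarrow> 'a). \<Prod>i\<in>X. x i ^ e i) ` (X \<rightarrow>\<^sub>E {..k})"
  have inj: "inj_on Q S"
    by (rule inj_onI) (metis diag off)
  have sub: "Q ` S \<subseteq> fun_space.span ?T"
    by (rule image_subsetI) (rule assms(3)[unfolded poly_funs_def])
  have fin: "finite ?T"
    using assms(1) by (intro finite_imageI finite_PiE) auto
  have ind: "fun_space.independent (Q ` S)"
  proof
    assume "fun_space.dependent (Q ` S)"
    then obtain t u where t: "finite t" "t \<subseteq> Q ` S" "(\<Sum>v\<in>t. (\<lambda>x. u v * v x)) = 0"
      and nz: "\<exists>v\<in>t. u v \<noteq> 0"
      unfolding fun_space.dependent_explicit by (elim exE conjE)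
    from nz obtain v where v: "v \<in> t" "u v \<noteq> 0" ..
    obtain c where c: "c \<in> S" "v = Q c"
      using t v(1) by auto
    have others: "u w * w (pt c) = 0" if w: "w \<in> t" "w \<noteq> v" for w
    proof -
      obtain c' where c': "c' \<in> S" "w = Q c'"
        using w t(2) by auto
      then have "c' \<noteq> c"
        using w c by auto
      then have "Q c' (pt c) = 0"
        by (rule off[OF c'(1) c(1)])
      then show ?thesis
        using c' by simp
    qed
    have "u v * v (pt c) = (\<Sum>w\<in>t. if w = v then u v * v (pt c) else 0)"
      using t(1) v(1) by simp
    also have "\<dots> = (\<Sum>w\<in>t. u w * w (pt c))"
      by (rule sum.cong) (simp_all add: others)
    also have "\<dots> = (\<Sum>v\<in>t. (\<lambda>x. u v * v x)) (pt c)"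
      by (rule sum_fun_apply[symmetric])
    also have "\<dots> = 0"
      by (simp only: t(3) zero_fun_apply)
    finally have "u v * v (pt c) = 0" .
    then show False
      using diag[OF c(1)] c(2) v(2) by simp
  qed
  have "card (Q ` S) \<le> card ?T"
    by (rule conjunct2[OF fun_space.independent_span_bound[where T = ?T and S = "Q ` S", OF fin ind sub]])
  also have "\<dots> \<le> card (X \<rightarrow>\<^sub>E {..k})"
    by (rule card_image_le) (use assms(1) in \<open>intro finite_PiE, auto\<close>)
  also have "\<dots> = (k + 1) ^ card X"
    using assms(1) by (simp add: card_PiE)
  finally show ?thesis
    using inj by (simp add: card_image)
qed

lemma power_growth_contradiction:
  fixes K M N :: nat
  assumes "N < M" "\<And>s. (s + 1) ^ M \<le> (K * s + 1) ^ N"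
  shows False
proof -
  \<comment> \<open>For this \<open>s\<close>, \<open>((K + 1) * (s + 1)) ^ N\<close> equals
    \<open>s * (s + 1) ^ N\<close>, which is just below \<open>(s + 1) ^ Suc N\<close>.\<close>
  define s where "s = (K + 1) ^ N"
  have "(s + 1) * (s + 1) ^ N \<le> (s + 1) ^ M"
    using power_increasing[of "Suc N" M "s + 1"] assms(1) by simp
  also have "\<dots> \<le> (K * s + 1) ^ N"
    by (rule assms)
  also have "\<dots> \<le> ((K + 1) * (s + 1)) ^ N"
    by (intro power_mono) auto
  also have "\<dots> = s * (s + 1) ^ N"
    unfolding s_def power_mult_distrib ..
  finally show False
    by simp
qed

text \<open>A surjective map would reach all points with coordinates in \<open>{..s}\<close>.
  Pulling back the interpolation polynomials of this grid gives \<open>(s + 1) ^ card I\<close>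
  independent functions in a space whose dimension grows only like
  \<open>s ^ card X\<close>.\<close>

theorem exists_point_outside_image:
  fixes P :: "'i \<Rightarrow> ('x \<Rightarrow> 'a::field_char_0) \<Rightarrow> 'a"
  assumes "finite X" "finite I" "card X < card I"
    and P: "\<And>i. i \<in> I \<Longrightarrow> P i \<in> poly_funs X D"
  obtains c where "\<And>x. \<exists>i\<in>I. P i x \<noteq> c i"
proof -
  have False if hit: "\<And>c. \<exists>x. \<forall>i\<in>I. P i x = c i"
  proof (rule power_growth_contradiction[OF assms(3)])
    fix s :: nat
    define S where "S = (I \<rightarrow>\<^sub>E {..s})"
    define pt where "pt c = (SOME x. \<forall>i\<in>I. P i x = of_nat (c i))" for c :: "'i \<Rightarrow> nat"
    have pt: "P i (pt c) = of_nat (c i)" if "i \<in> I" for i c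
      unfolding pt_def using someI_ex[OF hit[of "\<lambda>i. of_nat (c i)"]] that by blast
    \<comment> \<open>The Lagrange polynomial of the grid point \<open>c\<close>, left unnormalised,
      composed with \<open>P\<close>; it vanishes at the chosen preimages of all other grid
      points.\<close>
    define Q where "Q c x = (\<Prod>i\<in>I. \<Prod>a\<in>{..s} - {c i}. P i x - of_nat a)" for c x
    have "card S \<le> (card I * (s * D) + 1) ^ card X"
    proof (rule card_independent_poly_funs_le[of X S Q _ pt])
      fix c assume c: "c \<in> S"
      have "(\<lambda>x. \<Prod>a\<in>{..s} - {c i}. P i x - of_nat a) \<in> poly_funs X (s * D)" if "i \<in> I" for i
      proof -
        have "(\<lambda>x. P i x + - of_nat a) \<in> poly_funs X D" for a
          using P[OF that] by (intro poly_funs_add poly_funs_const)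
        then have "(\<lambda>x. \<Prod>a\<in>{..s} - {c i}. P i x + - of_nat a) \<in> poly_funs X (card ({..s} - {c i}) * D)"
          by (intro poly_funs_prod assms) auto
        moreover have "card ({..s} - {c i}) = s"
          using c that by (auto simp: S_def card_Diff_singleton_if)
        ultimately show ?thesis by simp
      qed
      then show "Q c \<in> poly_funs X (card I * (s * D))"
        unfolding Q_def by (intro poly_funs_prod assms)
    next
      fix c assume "c \<in> S"
      show "Q c (pt c) \<noteq> 0"
        using assms(2) by (auto simp: Q_def pt)
    next
      fix c c' assume "c \<in> S" "c' \<in> S" "c \<noteq> c'"
      then obtain i where i: "i \<in> I" "c i \<noteq> c' i"
        unfolding S_def by (metis PiE_ext)
      moreover have "c' i \<le> s"
        using \<open>c' \<in> S\<close> i by (auto simp: S_def)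
      ultimately show "Q c (pt c') = 0"
        using assms(2) by (auto simp: Q_def pt intro!: bexI[of _ i] bexI[of _ "c' i"])
    qed (use assms in \<open>auto simp: S_def intro: finite_PiE\<close>)
    then show "(s + 1) ^ card I \<le> (card I * D * s + 1) ^ card X"
      using assms(2) by (simp add: S_def card_PiE mult_ac)
  qed
  then show ?thesis
    using that by blast
qed

section \<open>The Amitsur-Levitzki theorem\<close>

text \<open>The exponents add up to the number of inversions, so for distinct letters this is the
  sign of the permutation that sorts the word.\<close>

primrec word_sign :: "nat list \<Rightarrow> 'a::comm_ring_1" where
  "word_sign [] = 1"
| "word_sign (a # w) = (-1) ^ length (filter (\<lambda>b. b < a) w) * word_sign w"

lemma word_sign_square: "word_sign w * word_sign w = (1::'a::comm_ring_1)"
proof (induction w)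
  case (Cons a w)
  have "word_sign (a # w) * word_sign (a # w)
      = ((-1) ^ length (filter (\<lambda>b. b < a) w) * (-1) ^ length (filter (\<lambda>b. b < a) w))
        * (word_sign w * word_sign w :: 'a)"
    by (simp add: mult_ac)
  then show ?case
    by (simp add: Cons power_add [symmetric])
qed simp

lemma word_sign_swap:
  assumes "a \<noteq> b"
  shows "word_sign (u @ a # b # w) = (- word_sign (u @ b # a # w) :: 'a::comm_ring_1)"
  using assms by (induction u) (auto simp: mult_ac)

lemma word_sign_move:
  assumes "a \<notin> set v"
  shows "word_sign (u @ a # v @ w) = ((-1) ^ length v * word_sign (u @ v @ a # w) :: 'a::comm_ring_1)"
  using assms
proof (induction v arbitrary: u)
  case (Cons b v)
  then show ?case
    using word_sign_swap[of a b u "v @ w", where 'a='a] Cons.IH[of "u @ [b]"] by simp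
qed simp

lemma word_sign_block_swap:
  assumes "set v \<inter> set w = {}"
  shows "word_sign (u @ v @ w @ z)
    = ((-1) ^ (length v * length w) * word_sign (u @ w @ v @ z) :: 'a::comm_ring_1)"
  using assms
proof (induction v arbitrary: u)
  case (Cons a v)
  have "word_sign (u @ (a # v) @ w @ z) = (word_sign ((u @ [a]) @ v @ w @ z) :: 'a)"
    by simp
  also have "\<dots> = (-1) ^ (length v * length w) * word_sign (u @ a # w @ v @ z)"
    using Cons.IH[of "u @ [a]"] Cons.prems by simp
  also have "word_sign (u @ a # w @ v @ z) = (-1) ^ length w * (word_sign (u @ w @ a # v @ z) :: 'a)"
    using Cons.prems word_sign_move[of a w u "v @ z"] by simp
  finally show ?case
    by (simp add: power_add mult_ac)
qed simp

definition alt_sum :: "nat set \<Rightarrow> (nat list \<Rightarrow> 'a) \<Rightarrow> 'a::comm_ring_1" where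
  "alt_sum I G = (\<Sum>p\<in>permutations_of_set I. word_sign p * G p)"

lemma alt_sum_cong:
  assumes "\<And>p. distinct p \<Longrightarrow> set p = I \<Longrightarrow> G p = H p"
  shows "alt_sum I G = alt_sum I H"
  unfolding alt_sum_def
  by (rule sum.cong) (auto simp: permutations_of_set_def assms)

text \<open>Exchanging two neighbouring blocks at fixed positions permutes the orderings of
  \<open>I\<close> and multiplies every sign by the same factor. It is used both to rotate a block
  and to move an even block without a sign.\<close>

lemma alt_sum_block_swap:
  assumes len: "a + b + c \<le> card I"
    and GH: "\<And>u v w z. length u = a \<Longrightarrow> length v = b \<Longrightarrow> length w = c
      \<Longrightarrow> length (u @ v @ w @ z) = card I \<Longrightarrow> G (u @ v @ w @ z) = H (u @ w @ v @ z)"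
  shows "alt_sum I G = (-1) ^ (b * c) * alt_sum I H"
proof -
  \<comment> \<open>The exchange of the two blocks behind the first \<open>a\<close> letters; with
    the two lengths swapped it becomes its own inverse.\<close>
  define r where "r b c p = take a p @ take c (drop (a + b) p) @ take b (drop a p) @ drop (a + b + c) p"
    for b c and p :: "nat list"
  have split: "\<exists>u v w z. p = u @ v @ w @ z \<and> length u = a \<and> length v = b \<and> length w = c"
    if "a + b + c \<le> length p" for b c and p :: "nat list"
  proof (intro exI conjI)
    show "p = take a p @ take b (drop a p) @ take c (drop (a + b) p) @ drop (a + b + c) p"
      by (metis append_take_drop_id drop_drop add.commute)
  qed (use that in auto)
  have r: "r b c (u @ v @ w @ z) = u @ w @ v @ z" if "length u = a" "length v = b" "length w = c"
    for b c u v w z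
    using that by (simp add: r_def)
  have len': "length p = card I" if "p \<in> permutations_of_set I" for p
    using that by (rule length_finite_permutations_of_set)
  have rr: "r c b (r b c p) = p" "r b c p \<in> permutations_of_set I"
    if p: "p \<in> permutations_of_set I" and abc: "a + b + c \<le> card I" for b c p
  proof -
    obtain u v w z where uvwz: "p = u @ v @ w @ z" "length u = a" "length v = b" "length w = c"
      using split[of b c p] len'[OF p] abc by auto
    then show "r c b (r b c p) = p"
      by (simp add: r)
    show "r b c p \<in> permutations_of_set I"
      using p uvwz by (auto simp: r permutations_of_set_def)
  qed
  have "alt_sum I G = (\<Sum>p\<in>permutations_of_set I. (-1) ^ (b * c) * (word_sign p * H p))"
    unfolding alt_sum_def
  proof (rule sum.reindex_bij_witness[where j = "r b c" and i = "r c b"])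
    fix p assume p: "p \<in> permutations_of_set I"
    obtain u v w z where uvwz: "p = u @ v @ w @ z" "length u = a" "length v = b" "length w = c"
      using split[of b c p] len'[OF p] len by auto
    have "set v \<inter> set w = {}"
      using p uvwz by (auto simp: permutations_of_set_def)
    then show "(-1) ^ (b * c) * (word_sign (r b c p) * H (r b c p)) = word_sign p * G p"
      using uvwz GH[of u v w z] len'[OF p] word_sign_block_swap[of v w u z, where 'a='a]
      by (simp add: r mult_ac)
  qed (use rr len in \<open>auto simp: add_ac\<close>)
  then show ?thesis
    by (simp add: alt_sum_def sum_distrib_left)
qed

section \<open>Matrices as index functions, and the fundamental trace identity\<close>

text \<open>Bare functions of two indices avoid carrier conditions. Only indices below
  \<open>d\<close> are meaningful, so laws that involve the identity matrix are restricted to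
  them.\<close>

definition mmul :: "nat \<Rightarrow> (nat \<Rightarrow> nat \<Rightarrow> 'a) \<Rightarrow> (nat \<Rightarrow> nat \<Rightarrow> 'a) \<Rightarrow> nat \<Rightarrow> nat \<Rightarrow> 'a::comm_ring_1" where
  "mmul d A B i j = (\<Sum>k<d. A i k * B k j)"

definition mtrace :: "nat \<Rightarrow> (nat \<Rightarrow> nat \<Rightarrow> 'a) \<Rightarrow> 'a::comm_ring_1" where
  "mtrace d A = (\<Sum>k<d. A k k)"

primrec mword :: "nat \<Rightarrow> (nat \<Rightarrow> nat \<Rightarrow> nat \<Rightarrow> 'a) \<Rightarrow> nat list \<Rightarrow> nat \<Rightarrow> nat \<Rightarrow> 'a::comm_ring_1" where
  "mword d a [] = (\<lambda>i j. if i = j then 1 else 0)"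
| "mword d a (l # w) = mmul d (a l) (mword d a w)"

lemma mmul_cong:
  assumes "\<And>k. k < d \<Longrightarrow> A i k = A' i k" "\<And>k. k < d \<Longrightarrow> B k j = B' k j"
  shows "mmul d A B i j = mmul d A' B' i j"
  using assms by (simp add: mmul_def)

lemma mmul_assoc: "mmul d (mmul d A B) C = mmul d A (mmul d B C)"
proof (intro ext)
  fix i j
  have "mmul d (mmul d A B) C i j = (\<Sum>k<d. \<Sum>l<d. A i l * B l k * C k j)"
    by (simp add: mmul_def sum_distrib_right)
  also have "\<dots> = (\<Sum>l<d. \<Sum>k<d. A i l * B l k * C k j)"
    by (rule sum.swap)
  also have "\<dots> = mmul d A (mmul d B C) i j"
    by (simp add: mmul_def sum_distrib_left mult.assoc)
  finally show "mmul d (mmul d A B) C i j = mmul d A (mmul d B C) i j" .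
qed

lemma mmul_one_left: "i < d \<Longrightarrow> mmul d (\<lambda>i j. if i = j then 1 else 0) B i j = B i j"
  by (simp add: mmul_def if_distrib[of "\<lambda>x. x * _"] cong: if_cong)

lemma mword_append: "i < d \<Longrightarrow> mmul d (mword d a u) (mword d a v) i j = mword d a (u @ v) i j"
proof (induction u arbitrary: i)
  case (Cons l u)
  have "mmul d (mword d a (l # u)) (mword d a v) i j = mmul d (a l) (mmul d (mword d a u) (mword d a v)) i j"
    by (simp add: mmul_assoc)
  also have "\<dots> = mmul d (a l) (mword d a (u @ v)) i j"
    by (rule mmul_cong) (simp_all add: Cons.IH)
  finally show ?case by simp
qed (simp add: mmul_one_left)

lemma mtrace_mmul_commute: "mtrace d (mmul d A B) = mtrace d (mmul d B A)"
  unfolding mtrace_def mmul_def by (subst sum.swap) (simp add: mult.commute)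

text \<open>For fixed \<open>q\<close> the inner sum factors over the cycles of \<open>q\<close>
  into traces of products, so this is the fundamental trace expression with all traces written out
  in entries. With \<open>m = length Xs\<close> it is also \<open>m!\<close> times the trace of the
  tensor product of the \<open>Xs\<close> composed with the projection onto antisymmetric
  tensors.\<close>

definition antisym_trace :: "nat \<Rightarrow> (nat \<Rightarrow> nat \<Rightarrow> 'a) list \<Rightarrow> 'a::comm_ring_1" where
  "antisym_trace d Xs =
     (\<Sum>q | q permutes {..<length Xs}. of_int (sign q) *
        (\<Sum>i\<in>{..<length Xs} \<rightarrow>\<^sub>E {..<d}. \<Prod>k<length Xs. (Xs ! k) (i k) (i (q k))))"

lemma antisym_trace_cong:
  assumes "length Xs = length Ys"
    and "\<And>k i j. k < length Ys \<Longrightarrow> i < d \<Longrightarrow> j < d \<Longrightarrow> (Xs ! k) i j = (Ys ! k) i j"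
  shows "antisym_trace d Xs = antisym_trace d Ys"
  unfolding antisym_trace_def assms(1)
proof (intro sum.cong HOL.refl arg_cong2[where f = "(*)"] prod.cong)
  fix q i k assume "q \<in> {q. q permutes {..<length Ys}}" "i \<in> {..<length Ys} \<rightarrow>\<^sub>E {..<d}" "k \<in> {..<length Ys}"
  moreover from this have "q k \<in> {..<length Ys}"
    by (simp only: mem_Collect_eq permutes_in_image)
  ultimately show "(Xs ! k) (i k) (i (q k)) = (Ys ! k) (i k) (i (q k))"
    by (intro assms(2)) auto
qed

text \<open>For fixed indices the sum over permutations is a determinant with two equal columns.\<close>

lemma antisym_trace_eq_0:
  assumes "d < length Xs"
  shows "antisym_trace d (Xs :: (nat \<Rightarrow> nat \<Rightarrow> 'a::field_char_0) list) = 0"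
proof -
  let ?m = "length Xs"
  have "(\<Sum>q | q permutes {..<?m}. of_int (sign q) * (\<Prod>k<?m. (Xs ! k) (i k) (i (q k)))) = 0"
    (is "?S = 0") if i: "i \<in> {..<?m} \<rightarrow>\<^sub>E {..<d}" for i
  proof -
    have "card (i ` {..<?m}) \<le> card {..<d}"
      by (rule card_mono) (use i in auto)
    then have "\<not> inj_on i {..<?m}"
      using assms by (intro pigeonhole) simp
    then obtain a b where ab: "a < ?m" "b < ?m" "a \<noteq> b" "i a = i b"
      by (auto simp: inj_on_def)
    \<comment> \<open>Since \<open>i a = i b\<close>, composing \<open>q\<close> with this
      transposition keeps every product and flips the sign, so \<open>?S\<close> equals its own
      negative.\<close>
    let ?t = "Transposition.transpose a b"
    have it: "i (?t x) = i x" for x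
      using ab by (auto simp: Transposition.transpose_def)
    have "?S = (\<Sum>q | q permutes {..<?m}. of_int (sign (?t \<circ> q)) * (\<Prod>k<?m. (Xs ! k) (i k) (i ((?t \<circ> q) k))))"
      using ab by (intro setum_permutations_compose_left) (simp add: permutes_swap_id)
    also have "\<dots> = (\<Sum>q | q permutes {..<?m}. - (of_int (sign q) * (\<Prod>k<?m. (Xs ! k) (i k) (i (q k)))))"
    proof (rule sum.cong)
      fix q assume "q \<in> {q. q permutes {..<?m}}"
      then have "sign (?t \<circ> q) = - sign q"
        using ab by (simp add: sign_compose permutation_swap_id permutation_permutes sign_swap_id)
           (metis finite_lessThan permutation_permutes sign_compose permutation_swap_id sign_swap_id mult_minus_left mult_1)
      then show "of_int (sign (?t \<circ> q)) * (\<Prod>k<?m. (Xs ! k) (i k) (i ((?t \<circ> q) k)))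
        = - (of_int (sign q) * (\<Prod>k<?m. (Xs ! k) (i k) (i (q k))))"
        by (simp add: it)
    qed simp
    also have "\<dots> = - ?S"
      by (rule sum_negf)
    finally have "2 * ?S = 0"
      by simp
    then show ?thesis
      by (simp only: mult_eq_0_iff) simp
  qed
  then show ?thesis
    unfolding antisym_trace_def sum_distrib_left
    by (subst sum.swap) simp
qed

lemma sum_PiE_insert:
  assumes "m \<notin> A"
  shows "(\<Sum>i\<in>insert m A \<rightarrow>\<^sub>E B. g i) = (\<Sum>i\<in>A \<rightarrow>\<^sub>E B. \<Sum>x\<in>B. g (i(m := x)))"
proof -
  have "(\<Sum>i\<in>insert m A \<rightarrow>\<^sub>E B. g i) = (\<Sum>(x, i)\<in>B \<times> (A \<rightarrow>\<^sub>E B). g (i(m := x)))"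
    unfolding PiE_insert_eq
    by (subst sum.reindex[OF inj_combinator[OF assms]]) (simp add: comp_def case_prod_beta)
  also have "\<dots> = (\<Sum>x\<in>B. \<Sum>i\<in>A \<rightarrow>\<^sub>E B. g (i(m := x)))"
    by (rule sum.cartesian_product [symmetric])
  finally show ?thesis
    by (subst (asm) sum.swap)
qed

text \<open>A permutation of one more point either fixes the new point, which splits off the trace
  of \<open>Z\<close>, or has it inserted after some \<open>j\<close> in a cycle of a permutation of
  the old points. The insertion multiplies \<open>Xs ! j\<close> by \<open>Z\<close> on the right
  and flips the sign.\<close>

lemma antisym_trace_snoc:
  "antisym_trace d (Xs @ [Z])
    = mtrace d Z * antisym_trace d Xs
      - (\<Sum>k<length Xs. antisym_trace d (Xs[k := mmul d (Xs ! k) Z]))"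
proof -
  define m where "m = length Xs"
  let ?tr = "Transposition.transpose m" and ?Q = "{q. q permutes {..<m}}" and ?I = "{..<m} \<rightarrow>\<^sub>E {..<d}"
  define F where "F \<sigma> = of_int (sign \<sigma>) * (\<Sum>i\<in>?I. \<Sum>x<d.
      \<Prod>k<Suc m. ((Xs @ [Z]) ! k) ((i(m := x)) k) ((i(m := x)) (\<sigma> k)))" for \<sigma>
  have F_fix: "F q = of_int (sign q) * (\<Sum>i\<in>?I. \<Prod>k<m. (Xs ! k) (i k) (i (q k))) * mtrace d Z"
    if q: "q permutes {..<m}" for q
  proof -
    have "(\<Prod>k<Suc m. ((Xs @ [Z]) ! k) ((i(m := x)) k) ((i(m := x)) (q k)))
        = (\<Prod>k<m. (Xs ! k) (i k) (i (q k))) * Z x x" for i x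
    proof -
      have "q m = m" "k < m \<Longrightarrow> q k \<noteq> m" for k
        using permutes_not_in[OF q, of m] permutes_in_image[OF q, of k] by auto
      then have "(\<Prod>k<m. ((Xs @ [Z]) ! k) ((i(m := x)) k) ((i(m := x)) (q k)))
          = (\<Prod>k<m. (Xs ! k) (i k) (i (q k)))"
        by (intro prod.cong) (auto simp: nth_append m_def)
      then show ?thesis
        using \<open>q m = m\<close> by (simp add: nth_append m_def)
    qed
    then show ?thesis
      by (simp only: F_def mtrace_def mult.assoc sum_product)
  qed
  have F_move: "F (?tr (q j) \<circ> q) = - of_int (sign q) *
      (\<Sum>i\<in>?I. \<Prod>k<m. (Xs[j := mmul d (Xs ! j) Z] ! k) (i k) (i (q k)))"
    if q: "q permutes {..<m}" and j: "j < m" for q j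
  proof -
    have qm: "q m = m" and q_less: "k < m \<Longrightarrow> q k < m" for k
      using permutes_not_in[OF q, of m] permutes_in_image[OF q, of k] by auto
    have q_neq: "k < m \<Longrightarrow> q k \<noteq> m" for k
      using q_less[of k] by auto
    have sgn: "sign (?tr (q j) \<circ> q) = - sign q"
      using q_less[OF j] permutation_permutes[of q] q
      by (subst sign_compose) (auto simp: permutation_swap_id sign_swap_id)
    have "(\<Sum>x<d. \<Prod>k<Suc m. ((Xs @ [Z]) ! k) ((i(m := x)) k) ((i(m := x)) ((?tr (q j) \<circ> q) k)))
        = (\<Prod>k<m. (Xs[j := mmul d (Xs ! j) Z] ! k) (i k) (i (q k)))" for i
    proof -
      let ?R = "\<Prod>k\<in>{..<m} - {j}. (Xs ! k) (i k) (i (q k))"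
      have "(\<Prod>k<Suc m. ((Xs @ [Z]) ! k) ((i(m := x)) k) ((i(m := x)) ((?tr (q j) \<circ> q) k)))
          = ?R * ((Xs ! j) (i j) x * Z x (i (q j)))" for x
      proof -
        have "?tr (q j) (q k) = q k" if "k < m" "k \<noteq> j" for k
          using that q_less permutes_inj[OF q] by (auto simp: Transposition.transpose_def inj_eq)
        then have "(\<Prod>k\<in>{..<m} - {j}. ((Xs @ [Z]) ! k) ((i(m := x)) k) ((i(m := x)) ((?tr (q j) \<circ> q) k))) = ?R"
          using q_neq by (intro prod.cong) (auto simp: nth_append m_def)
        then have "(\<Prod>k<m. ((Xs @ [Z]) ! k) ((i(m := x)) k) ((i(m := x)) ((?tr (q j) \<circ> q) k)))
            = (Xs ! j) (i j) x * ?R"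
          using j q_less[OF j] by (subst prod.remove[of _ j]) (auto simp: nth_append m_def)
        then show ?thesis
          using q_less[OF j] qm by (simp add: nth_append m_def mult_ac)
      qed
      then have "(\<Sum>x<d. \<Prod>k<Suc m. ((Xs @ [Z]) ! k) ((i(m := x)) k) ((i(m := x)) ((?tr (q j) \<circ> q) k)))
          = ?R * mmul d (Xs ! j) Z (i j) (i (q j))"
        by (simp only: mmul_def sum_distrib_left)
      moreover have "(\<Prod>k\<in>{..<m} - {j}. (Xs[j := mmul d (Xs ! j) Z] ! k) (i k) (i (q k))) = ?R"
        by (intro prod.cong) auto
      ultimately show ?thesis
        using j by (subst prod.remove[of _ j]) (auto simp: m_def mult_ac)
    qed
    then show ?thesis
      by (simp only: F_def sgn) simp
  qed
  have "antisym_trace d (Xs @ [Z]) = (\<Sum>\<sigma> | \<sigma> permutes insert m {..<m}. F \<sigma>)"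
    unfolding antisym_trace_def F_def
    by (simp add: m_def lessThan_Suc sum_PiE_insert)
  also have "\<dots> = (\<Sum>b\<in>insert m {..<m}. \<Sum>q\<in>?Q. F (?tr b \<circ> q))"
    by (rule sum_over_permutations_insert) auto
  also have "\<dots> = (\<Sum>q\<in>?Q. F q) + (\<Sum>q\<in>?Q. \<Sum>b<m. F (?tr b \<circ> q))"
    by (simp add: sum.swap[of _ "{..<m}"])
  also have "(\<Sum>q\<in>?Q. F q) = mtrace d Z * antisym_trace d Xs"
    by (simp add: F_fix antisym_trace_def m_def sum_distrib_left mult_ac)
  \<comment> \<open>The transposition of \<open>m\<close> and \<open>b\<close> inserts
    \<open>m\<close> in front of \<open>b\<close>, that is, behind the \<open>j\<close> with
    \<open>b = q j\<close>; the sum is reindexed by this \<open>j\<close>.\<close>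
  also have "(\<Sum>q\<in>?Q. \<Sum>b<m. F (?tr b \<circ> q)) = (\<Sum>q\<in>?Q. \<Sum>j<m. F (?tr (q j) \<circ> q))"
    by (intro sum.cong HOL.refl sum.reindex_bij_betw [symmetric] permutes_imp_bij) auto
  also have "\<dots> = (\<Sum>j<m. \<Sum>q\<in>?Q. F (?tr (q j) \<circ> q))"
    by (rule sum.swap)
  also have "\<dots> = (\<Sum>j<m. - antisym_trace d (Xs[j := mmul d (Xs ! j) Z]))"
    by (intro sum.cong HOL.refl) (simp add: F_move antisym_trace_def sum_negf flip: m_def)
  finally show ?thesis
    by (simp add: m_def sum_negf)
qed

section \<open>Trace expressions in words that are cut into blocks\<close>

primrec chop :: "nat list \<Rightarrow> 'b list \<Rightarrow> 'b list list" where
  "chop [] p = []"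
| "chop (n # ns) p = take n p # chop ns (drop n p)"

lemma chop_append:
  "length p = sum_list ms \<Longrightarrow> chop (ms @ ns) (p @ q) = chop ms p @ chop ns q"
  by (induction ms arbitrary: p) auto

lemma length_chop [simp]: "length (chop ns p) = length ns"
  by (induction ns arbitrary: p) auto

text \<open>\<open>Y\<close> marks the first block: it stays in front of it while the other blocks
  are split off or appended, and a matrix unit in its place finally reads off a single
  entry.\<close>

definition word_trace ::
    "nat \<Rightarrow> (nat \<Rightarrow> nat \<Rightarrow> nat \<Rightarrow> 'a) \<Rightarrow> (nat \<Rightarrow> nat \<Rightarrow> 'a) \<Rightarrow> nat list list \<Rightarrow> 'a::comm_ring_1" where
  "word_trace d a Y ws = antisym_trace d (mmul d Y (mword d a (hd ws)) # map (mword d a) (tl ws))"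

lemma word_trace_snoc:
  assumes "ws \<noteq> []"
  shows "word_trace d a Y (ws @ [w]) = mtrace d (mword d a w) * word_trace d a Y ws
    - (\<Sum>k<length ws. word_trace d a Y (ws[k := ws ! k @ w]))"
proof -
  obtain v vs where ws: "ws = v # vs"
    using assms by (cases ws) auto
  define Xs where "Xs = mmul d Y (mword d a v) # map (mword d a) vs"
  have "word_trace d a Y (ws @ [w]) = antisym_trace d (Xs @ [mword d a w])"
    by (simp add: word_trace_def Xs_def ws)
  also have "\<dots> = mtrace d (mword d a w) * antisym_trace d Xs
      - (\<Sum>k<length Xs. antisym_trace d (Xs[k := mmul d (Xs ! k) (mword d a w)]))"
    by (rule antisym_trace_snoc)
  also have "(\<Sum>k<length Xs. antisym_trace d (Xs[k := mmul d (Xs ! k) (mword d a w)]))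
      = (\<Sum>k<length ws. word_trace d a Y (ws[k := ws ! k @ w]))"
  proof (rule sum.cong)
    fix k assume "k \<in> {..<length ws}"
    then have k: "k < length ws" by simp
    have cat: "mmul d Y (mword d a (u @ w)) i j = mmul d (mmul d Y (mword d a u)) (mword d a w) i j" for u i j
      unfolding mmul_assoc by (rule mmul_cong) (simp_all add: mword_append)
    show "antisym_trace d (Xs[k := mmul d (Xs ! k) (mword d a w)]) = word_trace d a Y (ws[k := ws ! k @ w])"
      unfolding word_trace_def
    proof (rule antisym_trace_cong)
      fix l i j
      assume "i < d" "l < length (mmul d Y (mword d a (hd (ws[k := ws ! k @ w])))
        # map (mword d a) (tl (ws[k := ws ! k @ w])))"
      then show "(Xs[k := mmul d (Xs ! k) (mword d a w)] ! l) i j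
        = ((mmul d Y (mword d a (hd (ws[k := ws ! k @ w]))) # map (mword d a) (tl (ws[k := ws ! k @ w]))) ! l) i j"
        using k by (cases k; cases l) (auto simp: ws Xs_def cat mword_append nth_list_update)
    qed (use k in \<open>auto simp: ws Xs_def split: nat.splits\<close>)
  qed (simp add: ws Xs_def)
  finally show ?thesis
    by (simp add: word_trace_def ws Xs_def)
qed

lemma alt_sum_diff: "alt_sum I (\<lambda>p. G p - H p) = alt_sum I G - alt_sum I H"
  by (simp add: alt_sum_def algebra_simps sum_subtractf)

lemma alt_sum_sum: "alt_sum I (\<lambda>p. \<Sum>k\<in>A. G k p) = (\<Sum>k\<in>A. alt_sum I (G k))"
  unfolding alt_sum_def sum_distrib_left by (rule sum.swap)

text \<open>
  Cyclic rotation of an even block is an odd permutation that does not change the trace, so the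
  term in which that block is split off vanishes; the other terms merge it into another block.
\<close>

lemma alt_sum_word_trace:
  fixes a :: "nat \<Rightarrow> nat \<Rightarrow> nat \<Rightarrow> 'a::field_char_0"
  assumes "ns \<noteq> []" "sum_list ns = card I" "\<And>n. n \<in> set (tl ns) \<Longrightarrow> even n \<and> 0 < n"
  shows "alt_sum I (\<lambda>p. word_trace d a Y (chop ns p))
    = (-1) ^ (length ns - 1) * fact (length ns - 1) * alt_sum I (\<lambda>p. mtrace d (mmul d Y (mword d a p)))"
  using assms
proof (induction "length ns" arbitrary: ns rule: less_induct)
  case less
  show ?case
  proof (cases "length ns = 1")
    case True
    then obtain n where n: "ns = [n]"
      by (auto simp: length_Suc_conv)
    have "word_trace d a Y (chop ns p) = mtrace d (mmul d Y (mword d a p))"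
      if "distinct p" "set p = I" for p
    proof -
      have "length p = n"
        using that less.prems n by (metis distinct_card sum_list_simps(1) sum_list.Cons add_0_right sum_list.Nil)
      then show ?thesis
        using antisym_trace_snoc[of d "[]" "mmul d Y (mword d a p)"]
        by (simp add: n word_trace_def antisym_trace_def)
    qed
    then show ?thesis
      using True by (simp cong: alt_sum_cong)
  next
    case False
    obtain ms n where ns: "ns = ms @ [n]"
      using less.prems(1) by (metis rev_exhaust)
    with False have ms: "ms \<noteq> []" by auto
    then have tl: "tl ns = tl ms @ [n]"
      by (simp add: ns)
    have n: "even n" "0 < n" and ev: "\<And>n. n \<in> set (tl ms) \<Longrightarrow> even n \<and> 0 < n"
      using less.prems(3) by (auto simp: tl)
    define s where "s = sum_list ms"
    have sn: "s + n = card I"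
      using less.prems(2) by (simp add: ns s_def)
    let ?T = "alt_sum I (\<lambda>p. mtrace d (mmul d Y (mword d a p)))"
    let ?tr = "\<lambda>p. mtrace d (mword d a (drop s p)) * word_trace d a Y (chop ms (take s p))"
    let ?mv = "\<lambda>k p. word_trace d a Y ((chop ms (take s p))[k := chop ms (take s p) ! k @ drop s p])"
    have split: "word_trace d a Y (chop ns p) = ?tr p - (\<Sum>k<length ms. ?mv k p)"
      if "distinct p" "set p = I" for p
    proof -
      have "length p = s + n"
        using that sn distinct_card by fastforce
      then have "chop ns p = chop ms (take s p) @ [drop s p]"
        using chop_append[of "take s p" ms "[n]" "drop s p"] by (simp add: ns s_def)
      moreover have "chop ms (take s p) \<noteq> []"
        using ms by (metis length_chop length_0_conv)
      ultimately show ?thesis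
        by (simp add: word_trace_snoc)
    qed
    \<comment> \<open>The rotation as an exchange of blocks: the first letter of the last block
      against its remaining \<open>n - 1\<close> letters.\<close>
    have "alt_sum I ?tr = (-1) ^ (1 * (n - 1)) * alt_sum I ?tr"
    proof (rule alt_sum_block_swap)
      fix u v w z :: "nat list"
      assume len: "length u = s" "length v = 1" "length w = n - 1" "length (u @ v @ w @ z) = card I"
      then have "length z = 0"
        using sn n by (simp only: length_append)
      then have "z = []" by simp
      have "mtrace d (mword d a (v @ w)) = mtrace d (mmul d (mword d a v) (mword d a w))"
        by (simp add: mtrace_def mword_append)
      also have "\<dots> = mtrace d (mword d a (w @ v))"
        by (subst mtrace_mmul_commute) (simp add: mtrace_def mword_append)
      finally show "?tr (u @ v @ w @ z) = ?tr (u @ w @ v @ z)"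
        using len by (simp add: \<open>z = []\<close>)
    qed (use sn n in simp)
    moreover have "odd (n - 1)"
      using n by simp
    ultimately have tr0: "alt_sum I ?tr = 0"
      by simp
    have mv: "alt_sum I (?mv k) = (-1) ^ (length ms - 1) * fact (length ms - 1) * ?T" if k: "k < length ms" for k
    proof -
      define m1 m2 where "m1 = take k ms" and "m2 = drop (Suc k) ms"
      have ms_eq: "ms = m1 @ ms ! k # m2" and lk: "length m1 = k"
        using k by (simp_all add: m1_def m2_def id_take_nth_drop)
      define a1 where "a1 = sum_list m1 + ms ! k"
      have s_eq: "s = a1 + sum_list m2"
        unfolding s_def by (subst ms_eq) (simp add: a1_def)
      define ns' where "ns' = ms[k := ms ! k + n]"
      have ns': "ns' = m1 @ (ms ! k + n) # m2"
        unfolding ns'_def by (metis lk list_update_length ms_eq)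
      \<comment> \<open>The last block moves over the \<open>sum_list m2\<close> letters that
        separate it from the block it is merged with; as its length \<open>n\<close> is even, this
        costs no sign.\<close>
      have "alt_sum I (?mv k) = (-1) ^ (sum_list m2 * n) * alt_sum I (\<lambda>p. word_trace d a Y (chop ns' p))"
      proof (rule alt_sum_block_swap)
        fix u v w z :: "nat list"
        assume len: "length u = a1" "length v = sum_list m2" "length w = n" "length (u @ v @ w @ z) = card I"
        then have "length z = 0"
          using sn s_eq by (simp only: length_append)
        then have "z = []" by simp
        obtain u1 u2 where u: "u = u1 @ u2" "length u1 = sum_list m1" "length u2 = ms ! k"
          using len(1) by (metis a1_def append_take_drop_id length_take length_drop add_diff_cancel_left' le_add1 min.absorb2)
        have "chop ms (u @ v) = chop (m1 @ ms ! k # m2) (u1 @ (u2 @ v))"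
          by (subst ms_eq) (simp add: u)
        also have "\<dots> = chop m1 u1 @ u2 # chop m2 v"
          by (subst chop_append) (simp_all add: u)
        finally have 1: "chop ms (u @ v) = chop m1 u1 @ u2 # chop m2 v" .
        have "chop ns' (u @ w @ v) = chop (m1 @ (ms ! k + n) # m2) (u1 @ (u2 @ w @ v))"
          by (simp add: u ns')
        also have "\<dots> = chop m1 u1 @ (u2 @ w) # chop m2 v"
          by (subst chop_append) (simp_all add: u len)
        finally have 2: "chop ns' (u @ w @ v) = chop m1 u1 @ (u2 @ w) # chop m2 v" .
        have "take s (u @ v @ w @ z) = u @ v" "drop s (u @ v @ w @ z) = w"
          using len s_eq by (simp_all add: \<open>z = []\<close>)
        then show "?mv k (u @ v @ w @ z) = word_trace d a Y (chop ns' (u @ w @ v @ z))"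
          using 1 2 lk by (simp add: \<open>z = []\<close> nth_append list_update_append)
      qed (use sn s_eq in simp)
      also have "\<dots> = alt_sum I (\<lambda>p. word_trace d a Y (chop ns' p))"
        using n by simp
      also have "\<dots> = (-1) ^ (length ns' - 1) * fact (length ns' - 1) * ?T"
      proof (rule less.hyps)
        show "length ns' < length ns"
          by (simp add: ns'_def ns)
        show "ns' \<noteq> []"
          by (simp add: ns')
        show "sum_list ns' = card I"
          using s_eq sn by (simp add: ns' a1_def)
        fix x assume "x \<in> set (tl ns')"
        moreover have "x \<in> set (tl ms) \<or> (k \<noteq> 0 \<and> x = ms ! k + n)" if "x \<in> set (tl ns')" for x
        proof (cases m1)
          case Nil
          then show ?thesis using that by (subst ms_eq) (simp add: ns')
        next
          case (Cons y ys)
          then show ?thesis using that lk by (subst ms_eq) (auto simp: ns')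
        qed
        moreover have "k \<noteq> 0 \<Longrightarrow> ms ! k \<in> set (tl ms)"
          using lk by (subst (2) ms_eq) (cases m1; auto)
        ultimately show "even x \<and> 0 < x"
          using ev n by fastforce
      qed
      finally show ?thesis
        by (simp add: ns'_def)
    qed
    have "alt_sum I (\<lambda>p. word_trace d a Y (chop ns p)) = alt_sum I (\<lambda>p. ?tr p - (\<Sum>k<length ms. ?mv k p))"
      by (rule alt_sum_cong) (rule split)
    \<comment> \<open>Each of the \<open>length ms\<close> merges gives the same value with a minus
      sign, which raises the factorial and the power of -1 by one.\<close>
    also have "\<dots> = - (of_nat (length ms) * ((-1) ^ (length ms - 1) * fact (length ms - 1) * ?T))"
      by (simp add: alt_sum_diff alt_sum_sum tr0 mv)
    also have "\<dots> = (-1) ^ (length ns - 1) * fact (length ns - 1) * ?T"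
      using ms by (cases ms) (simp_all add: ns)
    finally show ?thesis .
  qed
qed

text \<open>With \<open>d + 1\<close> blocks the antisymmetrised trace vanishes, while merging them
  all leaves \<open>d!\<close>, up to sign, times the alternating sum of traces. Each of the
  \<open>d\<close> blocks that are merged away needs a positive even length, hence the bound
  \<open>2 * d\<close>.\<close>

theorem amitsur_levitzki:
  fixes a :: "nat \<Rightarrow> nat \<Rightarrow> nat \<Rightarrow> 'a::field_char_0"
  assumes "2 * d \<le> card I" "i < d" "j < d"
  shows "alt_sum I (\<lambda>p. mword d a p i j) = 0"
proof -
  \<comment> \<open>The matrix unit for which the trace of \<open>Y\<close> times \<open>A\<close>
    is the entry \<open>A i j\<close>.\<close>
  define Y :: "nat \<Rightarrow> nat \<Rightarrow> 'a" where "Y k l = (if k = j \<and> l = i then 1 else 0)" for k l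
  \<comment> \<open>The first block takes the surplus letters; it may have odd length or be
    empty.\<close>
  define ns where "ns = (card I - 2 * d) # replicate d 2"
  have "mtrace d (mmul d Y (mword d a p)) = mword d a p i j" for p
  proof -
    have "mmul d Y (mword d a p) k k = (if k = j then mword d a p i j else 0)" for k
      using assms by (auto simp: mmul_def Y_def if_distrib[of "\<lambda>x. x * _"] cong: if_cong)
    then show ?thesis
      using assms by (simp add: mtrace_def)
  qed
  moreover have "alt_sum I (\<lambda>p. word_trace d a Y (chop ns p))
      = (-1) ^ (length ns - 1) * fact (length ns - 1) * alt_sum I (\<lambda>p. mtrace d (mmul d Y (mword d a p)))"
    by (rule alt_sum_word_trace) (use assms in \<open>auto simp: ns_def sum_list_replicate\<close>)
  moreover have "word_trace d a Y (chop ns p) = 0" for p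
    unfolding word_trace_def by (rule antisym_trace_eq_0) (simp add: ns_def)
  ultimately show ?thesis
    by (simp add: alt_sum_def)
qed

section \<open>Low-degree coefficients of matrix identities\<close>

definition word_sum :: "(nat list \<Rightarrow> 'a) \<Rightarrow> 'a::field ncpoly \<Rightarrow> 'a" where
  "word_sum F f = (\<Sum>w\<in>Poly_Mapping.keys f. Poly_Mapping.lookup f w * F (letters w))"

lemma word_sum_superset:
  assumes "finite W" "Poly_Mapping.keys f \<subseteq> W"
  shows "word_sum F f = (\<Sum>w\<in>W. Poly_Mapping.lookup f w * F (letters w))"
  unfolding word_sum_def
  by (rule sum.mono_neutral_left) (use assms in \<open>auto simp: not_in_keys_iff_lookup_eq_zero\<close>)

lemma word_sum_0 [simp]: "word_sum F 0 = 0"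
  by (simp add: word_sum_def)

lemma word_sum_single [simp]: "word_sum F (Poly_Mapping.single (Word u) c) = c * F u"
  by (subst word_sum_superset[of "{Word u}"]) auto

lemma word_sum_add: "word_sum F (p + q) = word_sum F p + word_sum F q"
proof -
  let ?W = "Poly_Mapping.keys p \<union> Poly_Mapping.keys q"
  have "finite ?W" by simp
  note * = word_sum_superset[OF this, where F=F]
  have "word_sum F (p + q) = (\<Sum>w\<in>?W. Poly_Mapping.lookup (p + q) w * F (letters w))"
    by (rule *) (rule Poly_Mapping.keys_add)
  then show ?thesis
    by (simp add: *[of p] *[of q] lookup_add ring_distribs sum.distrib)
qed

lemma word_sum_sum: "word_sum F (\<Sum>i\<in>A. p i) = (\<Sum>i\<in>A. word_sum F (p i))"
  by (induction A rule: infinite_finite_induct) (simp_all add: word_sum_add)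

lemma mword_cong:
  assumes "\<And>l i j. i < d \<Longrightarrow> j < d \<Longrightarrow> a l i j = b l i j" "i < d" "j < d"
  shows "mword d a w i j = mword d b w i j"
  using assms(2) by (induction w arbitrary: i) (auto simp: assms intro!: mmul_cong)

lemma mat_word_entry:
  assumes A: "\<And>l. A l \<in> carrier_mat d d" and "i < d" "j < d"
  shows "mat_word d A (Word w) \<in> carrier_mat d d"
    and "mat_word d A (Word w) $$ (i, j) = mword d (\<lambda>l i j. A l $$ (i, j)) w i j"
proof -
  have *: "mat_word d A (Word w) \<in> carrier_mat d d \<and>
    (\<forall>i<d. mat_word d A (Word w) $$ (i, j) = mword d (\<lambda>l i j. A l $$ (i, j)) w i j)"
  proof (induction w)
    case Nil
    then show ?case using \<open>j < d\<close> by (simp add: mat_word_def)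
  next
    case (Cons l w)
    have eq: "mat_word d A (Word (l # w)) = A l * mat_word d A (Word w)"
      by (simp add: mat_word_def)
    then have "mat_word d A (Word (l # w)) \<in> carrier_mat d d"
      using Cons A by (metis mult_carrier_mat)
    moreover have "(A l * mat_word d A (Word w)) $$ (i, j) = mmul d (\<lambda>i j. A l $$ (i, j)) (mword d (\<lambda>l i j. A l $$ (i, j)) w) i j"
      if "i < d" for i
    proof -
      have "(A l * mat_word d A (Word w)) $$ (i, j) = (\<Sum>k<d. A l $$ (i, k) * mat_word d A (Word w) $$ (k, j))"
        using that \<open>j < d\<close> carrier_matD[OF A[of l]] carrier_matD[of "mat_word d A (Word w)" d d] Cons
        by (simp only: index_mult_mat) (simp add: scalar_prod_def atLeast0LessThan)
      then show ?thesis
        using Cons by (simp add: mmul_def)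
    qed
    ultimately show ?case
      by (simp add: eq)
  qed
  then show "mat_word d A (Word w) \<in> carrier_mat d d" by simp
  from * show "mat_word d A (Word w) $$ (i, j) = mword d (\<lambda>l i j. A l $$ (i, j)) w i j"
    using \<open>i < d\<close> by simp
qed

lemma mat_identity_iff:
  "mat_identity d f \<longleftrightarrow> (\<forall>a. \<forall>i<d. \<forall>j<d. word_sum (\<lambda>w. mword d a w i j) f = 0)"
proof
  assume id: "mat_identity d f"
  show "\<forall>a. \<forall>i<d. \<forall>j<d. word_sum (\<lambda>w. mword d a w i j) f = 0"
  proof (intro allI impI)
    fix a :: "nat \<Rightarrow> nat \<Rightarrow> nat \<Rightarrow> 'a" and i j
    assume ij: "i < d" "j < d"
    define A where "A l = mat d d (\<lambda>(i, j). a l i j)" for l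
    have A: "A l \<in> carrier_mat d d" for l
      by (simp add: A_def)
    have "mat_word d A w $$ (i, j) = mword d a (letters w) i j" for w
      using mat_word_entry(2)[of A, OF A ij, where w = "letters w"] ij
        mword_cong[where a = "\<lambda>l i j. A l $$ (i, j)" and b = a and w = "letters w", OF _ ij]
      by (simp add: A_def)
    moreover have "mat_eval d A f $$ (i, j) = 0"
      using id A ij by (simp add: mat_identity_def)
    ultimately show "word_sum (\<lambda>w. mword d a w i j) f = 0"
      using ij by (simp add: mat_eval_def word_sum_def)
  qed
next
  assume *: "\<forall>a. \<forall>i<d. \<forall>j<d. word_sum (\<lambda>w. mword d a w i j) f = 0"
  show "mat_identity d f"
    unfolding mat_identity_def
  proof (intro allI impI)
    fix A :: "nat \<Rightarrow> 'a mat"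
    assume A: "\<forall>i. A i \<in> carrier_mat d d"
    show "mat_eval d A f = 0\<^sub>m d d"
    proof (rule eq_matI)
      fix i j assume "i < dim_row (0\<^sub>m d d)" "j < dim_col (0\<^sub>m d d)"
      then have ij: "i < d" "j < d" by simp_all
      have "mat_word d A w $$ (i, j) = mword d (\<lambda>l i j. A l $$ (i, j)) (letters w) i j" for w
        using mat_word_entry(2)[of A, OF _ ij, where w = "letters w"] A by simp
      then show "mat_eval d A f $$ (i, j) = 0\<^sub>m d d $$ (i, j)"
        using * ij by (simp add: mat_eval_def word_sum_def)
    qed (simp_all add: mat_eval_def)
  qed
qed

text \<open>
  Substituting \<open>y i = p i ^ s\<close> for distinct primes \<open>p i\<close> makes different monomials take the
  \<open>s\<close>-th powers of different integers, so a Vandermonde argument separates them.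
\<close>

lemma vandermonde_vanish:
  fixes x :: "'k \<Rightarrow> 'a::comm_ring_1"
  assumes "\<And>s. (\<Sum>k\<in>K. c k * x k ^ s) = 0" "finite T"
  shows "(\<Sum>k\<in>K. c k * x k ^ s * (\<Prod>t\<in>T. x k - t)) = 0"
  using assms(2)
proof (induction T arbitrary: s)
  case (insert t T)
  have "(\<Sum>k\<in>K. c k * x k ^ s * (\<Prod>t\<in>insert t T. x k - t))
    = (\<Sum>k\<in>K. c k * x k ^ Suc s * (\<Prod>t\<in>T. x k - t)) - t * (\<Sum>k\<in>K. c k * x k ^ s * (\<Prod>t\<in>T. x k - t))"
    unfolding sum_distrib_left sum_subtractf [symmetric]
    by (rule sum.cong) (simp_all add: insert(1,2) algebra_simps)
  then show ?case
    by (simp only: insert.IH) simp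
qed (use assms in simp)

text \<open>Several \<open>k\<close> may carry the same monomial, so it is the total coefficient of
  each monomial that is forced to vanish.\<close>

lemma monomial_coeff_eq_0:
  fixes c :: "'k \<Rightarrow> 'a::field_char_0" and mon :: "'k \<Rightarrow> nat multiset"
  assumes "finite K" "\<And>y. (\<Sum>k\<in>K. c k * (\<Prod>i\<in>#mon k. y i)) = 0"
  shows "(\<Sum>k | k \<in> K \<and> mon k = M. c k) = 0"
proof -
  obtain p :: "nat \<Rightarrow> nat" where "inj p" "range p \<subseteq> {p. prime p}"
    using infinite_countable_subset[OF primes_infinite] by blast
  then have p: "inj p" "\<And>i. prime (p i)"
    by auto
  define q where "q M = prod_mset (image_mset p M)" for M
  have q_inj: "M = N" if "q M = q N" for M N
  proof -
    have "prime_factorization (q M) = image_mset p M" for M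
      unfolding q_def by (rule prime_factorization_prod_mset_primes) (use p in auto)
    then have "image_mset p M = image_mset p N"
      using that by metis
    then show ?thesis
      using multiset.inj_map[OF p(1)] by (simp add: inj_eq)
  qed
  define x where "x k = (of_nat (q (mon k)) :: 'a)" for k
  have x: "(\<Sum>k\<in>K. c k * x k ^ s) = 0" for s
  proof -
    have "(\<Prod>i\<in>#N. (of_nat (p i) :: 'a) ^ s) = of_nat (q N) ^ s" for N
      by (induction N) (simp_all add: q_def power_mult_distrib)
    then show ?thesis
      using assms(2)[of "\<lambda>i. of_nat (p i) ^ s"] by (simp add: x_def)
  qed
  \<comment> \<open>The values of all other monomials: the product of the \<open>x k - t\<close>
    over \<open>T\<close> removes every term with \<open>mon k \<noteq> M\<close> and is non-zero on
    the rest.\<close>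
  define T where "T = (\<lambda>N. of_nat (q N) :: 'a) ` (mon ` K - {M})"
  have "finite T"
    using assms(1) by (simp add: T_def)
  from vandermonde_vanish[OF x this, of 0]
  have "0 = (\<Sum>k\<in>K. c k * (\<Prod>t\<in>T. x k - t))"
    by simp
  also have "\<dots> = (\<Sum>k\<in>K. if mon k = M then c k * (\<Prod>t\<in>T. of_nat (q M) - t) else 0)"
  proof (rule sum.cong)
    fix k assume k: "k \<in> K"
    show "c k * (\<Prod>t\<in>T. x k - t) = (if mon k = M then c k * (\<Prod>t\<in>T. of_nat (q M) - t) else 0)"
    proof (cases "mon k = M")
      case False
      then have "x k \<in> T"
        using k by (auto simp: T_def x_def)
      then show ?thesis
        using False \<open>finite T\<close> by auto
    qed (simp add: x_def)
  qed simp
  also have "\<dots> = (\<Sum>k | k \<in> K \<and> mon k = M. c k) * (\<Prod>t\<in>T. of_nat (q M) - t)"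
    using assms(1) by (auto simp: sum.inter_filter sum_distrib_right intro!: sum.cong)
  finally have "(\<Sum>k | k \<in> K \<and> mon k = M. c k) * (\<Prod>t\<in>T. of_nat (q M) - t) = 0"
    by simp
  moreover have "(\<Prod>t\<in>T. of_nat (q M) - t) \<noteq> 0"
    using \<open>finite T\<close> q_inj by (auto simp: T_def)
  ultimately show ?thesis
    by simp
qed

section \<open>Expansion of identities around scalar matrices\<close>

text \<open>A marking records which summand is taken at each letter when a product of sums is
  expanded: the central one where the mark is \<open>True\<close>, the other one elsewhere.\<close>

definition markings :: "nat list \<Rightarrow> (bool \<times> nat) list set" where
  "markings w = {bs. map snd bs = w}"

definition marked :: "(bool \<times> nat) list \<Rightarrow> nat list" where
  "marked bs = map snd (filter fst bs)"

definition unmarked :: "(bool \<times> nat) list \<Rightarrow> nat list" where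
  "unmarked bs = map snd (filter (\<lambda>b. \<not> fst b) bs)"

lemma marked_simps [simp]:
  "marked [] = []" "unmarked [] = []"
  "marked ((True, l) # bs) = l # marked bs" "marked ((False, l) # bs) = marked bs"
  "unmarked ((False, l) # bs) = l # unmarked bs" "unmarked ((True, l) # bs) = unmarked bs"
  by (simp_all add: marked_def unmarked_def)

lemma markings_Nil [simp]: "markings [] = {[]}"
  by (auto simp: markings_def)

lemma markings_Cons: "markings (l # w) = Cons (True, l) ` markings w \<union> Cons (False, l) ` markings w"
  by (auto simp: markings_def Cons_eq_map_conv image_iff)

lemma finite_markings [simp]: "finite (markings w)"
  by (induction w) (simp_all add: markings_Cons)

lemma sum_markings_Cons:
  "(\<Sum>bs\<in>markings (l # w). f bs)
    = (\<Sum>bs\<in>markings w. f ((True, l) # bs)) + (\<Sum>bs\<in>markings w. f ((False, l) # bs))"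
  unfolding markings_Cons
  by (subst sum.union_disjoint) (auto simp: sum.reindex)

definition all_markings :: "'a::field ncpoly \<Rightarrow> (bool \<times> nat) list set" where
  "all_markings h = {bs. Word (map snd bs) \<in> Poly_Mapping.keys h}"

lemma all_markings_eq: "all_markings h = (\<Union>w\<in>Poly_Mapping.keys h. markings (letters w))"
  by (force simp: all_markings_def markings_def)

lemma finite_all_markings [simp]: "finite (all_markings h)"
  by (simp add: all_markings_eq)

lemma sum_all_markings:
  "(\<Sum>bs\<in>all_markings h. f bs) = (\<Sum>w\<in>Poly_Mapping.keys h. \<Sum>bs\<in>markings (letters w). f bs)"
proof -
  have "(\<Sum>bs\<in>all_markings h. f bs)
      = (\<Sum>w\<in>Poly_Mapping.keys h. sum f {bs \<in> all_markings h. Word (map snd bs) = w})"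
    by (rule sum.group [OF finite_all_markings finite_keys, symmetric]) (auto simp: all_markings_def)
  also have "\<dots> = (\<Sum>w\<in>Poly_Mapping.keys h. \<Sum>bs\<in>markings (letters w). f bs)"
    by (intro sum.cong HOL.refl) (auto simp: all_markings_def markings_def)
  finally show ?thesis .
qed

lemma mword_markings:
  assumes "i < d"
  shows "mword d (\<lambda>l i j. (if i = j then t l else 0) + X l i j) w i j
    = (\<Sum>bs\<in>markings w. (\<Prod>l\<in>#mset (marked bs). t l) * mword d X (unmarked bs) i j)"
  using assms
proof (induction w arbitrary: i)
  case (Cons l w)
  let ?A = "\<lambda>l i j. (if i = j then t l else 0) + X l i j"
  let ?g = "\<lambda>i bs. (\<Prod>l\<in>#mset (marked bs). t l) * mword d X (unmarked bs) i j"
  have "mword d ?A (l # w) i j = (\<Sum>k<d. ?A l i k * (\<Sum>bs\<in>markings w. ?g k bs))"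
    using Cons by (simp add: mmul_def)
  also have "\<dots> = (\<Sum>k<d. (if i = k then t l else 0) * (\<Sum>bs\<in>markings w. ?g k bs))
      + (\<Sum>k<d. X l i k * (\<Sum>bs\<in>markings w. ?g k bs))"
    by (simp only: ring_distribs sum.distrib)
  also have "(\<Sum>k<d. (if i = k then t l else 0) * (\<Sum>bs\<in>markings w. ?g k bs))
      = (\<Sum>k<d. if i = k then t l * (\<Sum>bs\<in>markings w. ?g k bs) else 0)"
    by (rule sum.cong) auto
  also have "\<dots> = (\<Sum>bs\<in>markings w. ?g i ((True, l) # bs))"
    using Cons.prems by (simp add: sum_distrib_left mult.assoc)
  also have "(\<Sum>k<d. X l i k * (\<Sum>bs\<in>markings w. ?g k bs))
      = (\<Sum>bs\<in>markings w. ?g i ((False, l) # bs))"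
    unfolding sum_distrib_left
    by (subst sum.swap) (simp add: mmul_def sum_distrib_left mult_ac)
  finally show ?case
    by (simp only: sum_markings_Cons)
qed simp

text \<open>Substituting \<open>t l\<close> times the identity matrix plus \<open>X l\<close> into
  \<open>h\<close> gives a polynomial in the scalars \<open>t\<close> that vanishes everywhere, so
  its coefficient at each monomial \<open>M\<close> is zero.\<close>

lemma identity_marked_part:
  fixes h :: "'a::field_char_0 ncpoly"
  assumes "mat_identity d h" "i < d" "j < d"
  shows "(\<Sum>bs | bs \<in> all_markings h \<and> mset (marked bs) = M.
    Poly_Mapping.lookup h (Word (map snd bs)) * mword d X (unmarked bs) i j) = 0"
proof (rule monomial_coeff_eq_0)
  fix t :: "nat \<Rightarrow> 'a"
  have "0 = word_sum (\<lambda>w. mword d (\<lambda>l i j. (if i = j then t l else 0) + X l i j) w i j) h"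
    using assms by (simp add: mat_identity_iff)
  also have "\<dots> = (\<Sum>w\<in>Poly_Mapping.keys h. \<Sum>bs\<in>markings (letters w).
      Poly_Mapping.lookup h w * ((\<Prod>l\<in>#mset (marked bs). t l) * mword d X (unmarked bs) i j))"
    by (simp add: word_sum_def mword_markings[OF assms(2)] sum_distrib_left)
  also have "\<dots> = (\<Sum>w\<in>Poly_Mapping.keys h. \<Sum>bs\<in>markings (letters w).
      Poly_Mapping.lookup h (Word (map snd bs)) * mword d X (unmarked bs) i j * (\<Prod>l\<in>#mset (marked bs). t l))"
    by (intro sum.cong HOL.refl) (simp add: markings_def mult_ac)
  also have "\<dots> = (\<Sum>bs\<in>all_markings h.
      Poly_Mapping.lookup h (Word (map snd bs)) * mword d X (unmarked bs) i j * (\<Prod>l\<in>#mset (marked bs). t l))"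
    by (rule sum_all_markings [symmetric])
  finally show "(\<Sum>bs\<in>all_markings h.
      Poly_Mapping.lookup h (Word (map snd bs)) * mword d X (unmarked bs) i j * (\<Prod>l\<in>#mset (marked bs). t l)) = 0"
    by simp
qed simp

section \<open>The staircase of matrix units\<close>

text \<open>The matrix units E00, E01, E11, E12, ..., of which exactly \<open>2 * d - 1\<close> fit
  into \<open>d\<close> by \<open>d\<close> matrices. This is the classical witness that no identity
  has degree below \<open>2 * d\<close>.\<close>

definition stair :: "nat \<Rightarrow> nat \<Rightarrow> nat \<Rightarrow> 'a::comm_ring_1" where
  "stair k i j = (if i = k div 2 \<and> j = Suc k div 2 then 1 else 0)"

lemma mword_stair_Cons:
  "mword d stair (k # ks) i j
    = (if i = k div 2 \<and> Suc k div 2 < d then mword d stair ks (Suc k div 2) j else 0)"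
proof -
  have "mword d stair (k # ks) i j
      = (\<Sum>x<d. if x = Suc k div 2 then (if i = k div 2 then mword d stair ks x j else 0) else 0)"
    unfolding mword.simps mmul_def by (rule sum.cong) (auto simp: stair_def)
  then show ?thesis by (auto simp del: mword.simps)
qed

text \<open>The column of each factor must be the row of the next. Hence rows never decrease, and
  the off-diagonal unit of a row leaves that row, so the diagonal one cannot follow it.\<close>

lemma sorted_if_mword_stair_neq_0:
  assumes "mword d stair ks i j \<noteq> (0::'a::comm_ring_1)"
  shows "sorted ks \<and> (\<forall>k\<in>set ks. 2 * i \<le> k)"
  using assms
proof (induction ks arbitrary: i)
  case (Cons k ks)
  then have *: "i = k div 2" "mword d stair ks (Suc k div 2) j \<noteq> (0::'a)"
    unfolding mword_stair_Cons by (auto split: if_splits)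
  from Cons.IH[OF *(2)] have "sorted ks" "\<And>x. x \<in> set ks \<Longrightarrow> k \<le> x"
    by fastforce+
  moreover have "2 * (k div 2) \<le> x" if "k \<le> x" for x
    using that by presburger
  ultimately show ?case
    using * by auto
qed simp

lemma mword_stair_upt:
  assumes "k \<le> m" "m div 2 < d"
  shows "mword d stair [k..<m] (k div 2) (m div 2) = (1::'a::comm_ring_1)"
  using assms(1)
proof (induction k rule: inc_induct)
  case (step k)
  have "Suc k div 2 \<le> m div 2"
    using step by (intro div_le_mono) simp
  then have "Suc k div 2 < d"
    using assms(2) by simp
  then show ?case
    using step by (simp only: upt_rec[of k m] mword_stair_Cons if_True simp_thms)
qed simp

lemma mword_stair_permutation:
  assumes "m div 2 < d" "mset ks = mset [0..<m]"
  shows "mword d stair ks 0 (m div 2) = (if ks = [0..<m] then 1 else (0::'a::comm_ring_1))"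
proof (cases "mword d stair ks 0 (m div 2) = (0::'a)")
  case False
  then have "sorted ks"
    using sorted_if_mword_stair_neq_0 by blast
  then have "ks = [0..<m]"
    using assms(2) by (metis properties_for_sort sort_upt)
  then show ?thesis
    using mword_stair_upt[of 0 m d] assms(1) by simp
next
  case True
  then show ?thesis
    using mword_stair_upt[of 0 m d, where 'a='a] assms(1) by auto
qed

text \<open>These index the terms that arise when each letter is replaced by a sum over the
  positions of \<open>v\<close> that hold it, a polarisation that makes repeated letters of
  \<open>v\<close> distinguishable.\<close>

definition labellings :: "nat list \<Rightarrow> nat list \<Rightarrow> nat list set" where
  "labellings v w = {ks. set ks \<subseteq> {..<length v} \<and> map ((!) v) ks = w}"

lemma labellings_Nil [simp]: "labellings v [] = {[]}"
  by (auto simp: labellings_def)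

lemma labellings_Cons:
  "labellings v (l # w) = (\<lambda>(k, ks). k # ks) ` ({k. k < length v \<and> v ! k = l} \<times> labellings v w)"
  by (force simp: labellings_def image_iff Cons_eq_map_conv)

lemma finite_labellings [simp]: "finite (labellings v w)"
  by (induction w) (simp_all add: labellings_Cons)

lemma mword_labellings:
  "mword d (\<lambda>l i j. \<Sum>k | k < length v \<and> v ! k = l. z k * g k i j) w i j
    = (\<Sum>ks\<in>labellings v w. (\<Prod>k\<in>#mset ks. z k) * mword d g ks i j)"
proof (induction w arbitrary: i)
  case (Cons l w)
  let ?S = "{k. k < length v \<and> v ! k = l}"
  let ?h = "\<lambda>i ks. (\<Prod>k\<in>#mset ks. z k) * mword d g ks i j"
  have "mword d (\<lambda>l i j. \<Sum>k | k < length v \<and> v ! k = l. z k * g k i j) (l # w) i j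
      = (\<Sum>x<d. (\<Sum>k\<in>?S. z k * g k i x) * (\<Sum>ks\<in>labellings v w. ?h x ks))"
    by (simp add: mmul_def Cons)
  also have "\<dots> = (\<Sum>x<d. \<Sum>k\<in>?S. \<Sum>ks\<in>labellings v w. z k * g k i x * ?h x ks)"
    by (simp only: sum_product)
  also have "\<dots> = (\<Sum>k\<in>?S. \<Sum>x<d. \<Sum>ks\<in>labellings v w. z k * g k i x * ?h x ks)"
    by (rule sum.swap)
  also have "\<dots> = (\<Sum>k\<in>?S. \<Sum>ks\<in>labellings v w. \<Sum>x<d. z k * g k i x * ?h x ks)"
    by (intro sum.cong HOL.refl sum.swap)
  also have "\<dots> = (\<Sum>k\<in>?S. \<Sum>ks\<in>labellings v w. ?h i (k # ks))"
    by (simp add: mmul_def sum_distrib_left mult_ac)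
  also have "\<dots> = (\<Sum>ks\<in>labellings v (l # w). ?h i ks)"
    unfolding labellings_Cons
    by (subst sum.reindex) (auto simp: sum.cartesian_product inj_on_def intro!: sum.cong)
  finally show ?case .
qed simp

text \<open>
  The coefficient of \<open>v\<close> in the part of \<open>h (t + x)\<close> of multidegree \<open>M\<close> in commuting
  variables \<open>t\<close>, which is again an identity.
\<close>

theorem identity_low_coeff_eq_0:
  fixes h :: "'a::field_char_0 ncpoly"
  assumes "mat_identity d h" "length v < 2 * d"
  shows "(\<Sum>bs | bs \<in> all_markings h \<and> mset (marked bs) = M \<and> unmarked bs = v.
    Poly_Mapping.lookup h (Word (map snd bs))) = 0"
proof -
  define m where "m = length v"
  have m: "m div 2 < d"
    using assms(2) by (simp add: m_def)
  define N where "N = mset [0..<m]"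
  have path: "mword d stair ks 0 (m div 2) = (if ks = [0..<m] then 1 else (0::'a))" if "mset ks = N" for ks
    by (rule mword_stair_permutation[OF m]) (use that in \<open>simp only: N_def\<close>)
  have upt: "mset_set {0..<m} = N" "mword d stair [0..<m] 0 (m div 2) = (1::'a)"
    using path[of "[0..<m]"] by (simp_all add: N_def)
  let ?c = "\<lambda>bs. Poly_Mapping.lookup h (Word (map snd bs))"
  let ?B = "{bs \<in> all_markings h. mset (marked bs) = M}"
  let ?K = "SIGMA bs:?B. labellings v (unmarked bs)"
  \<comment> \<open>Taking the coefficient at \<open>N\<close> keeps the terms that use every
    position of \<open>v\<close> exactly once. Of these the staircase leaves only the increasing
    order of positions, which spells \<open>v\<close> itself.\<close>
  have "(\<Sum>k | k \<in> ?K \<and> mset (snd k) = N.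
      ?c (fst k) * mword d stair (snd k) 0 (m div 2)) = 0"
  proof (rule monomial_coeff_eq_0)
    fix z :: "nat \<Rightarrow> 'a"
    let ?X = "\<lambda>l i j. \<Sum>k | k < length v \<and> v ! k = l. z k * stair k i j"
    have "0 = (\<Sum>bs\<in>?B. ?c bs * mword d ?X (unmarked bs) 0 (m div 2))"
      using identity_marked_part[OF assms(1), of 0 "m div 2"] m by simp
    also have "\<dots> = (\<Sum>bs\<in>?B. \<Sum>ks\<in>labellings v (unmarked bs).
        ?c bs * mword d stair ks 0 (m div 2) * (\<Prod>k\<in>#mset ks. z k))"
      by (simp add: mword_labellings sum_distrib_left mult_ac)
    also have "\<dots> = (\<Sum>k\<in>?K. ?c (fst k) * mword d stair (snd k) 0 (m div 2) * (\<Prod>k\<in>#mset (snd k). z k))"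
      by (subst sum.Sigma) (auto simp: case_prod_beta)
    finally show "(\<Sum>k\<in>?K. ?c (fst k) * mword d stair (snd k) 0 (m div 2) * (\<Prod>k\<in>#mset (snd k). z k)) = 0"
      by simp
  qed auto
  also have "(\<Sum>k | k \<in> ?K \<and> mset (snd k) = N. ?c (fst k) * mword d stair (snd k) 0 (m div 2))
      = (\<Sum>k | k \<in> ?K \<and> snd k = [0..<m]. ?c (fst k))"
    by (rule sum.mono_neutral_cong_right) (auto simp: path upt)
  also have "\<dots> = (\<Sum>bs | bs \<in> all_markings h \<and> mset (marked bs) = M \<and> unmarked bs = v. ?c bs)"
  proof -
    define A S where "A = {k \<in> ?K. snd k = [0..<m]}"
      and "S = {bs. bs \<in> all_markings h \<and> mset (marked bs) = M \<and> unmarked bs = v}"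
    have "[0..<m] \<in> labellings v w \<longleftrightarrow> w = v" for w
      by (auto simp: labellings_def m_def map_nth)
    then have "(bs, ks) \<in> A \<longleftrightarrow> bs \<in> S \<and> ks = [0..<m]" for bs ks
      unfolding A_def S_def by (simp only: mem_Sigma_iff mem_Collect_eq snd_conv) metis
    then have "A = (\<lambda>bs. (bs, [0..<m])) ` S"
      by auto
    then have "(\<Sum>k\<in>A. ?c (fst k)) = (\<Sum>bs\<in>S. ?c bs)"
      by (intro sum.reindex_cong[where l = "\<lambda>bs. (bs, [0..<m])"]) (auto simp: inj_on_def)
    then show ?thesis
      by (simp only: A_def S_def)
  qed
  finally show ?thesis .
qed

section \<open>Ideals of identities modulo the exterior relations\<close>

text \<open>The coordinate, at the basis vector of \<open>I\<close>, of the image of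
  \<open>p\<close> in the exterior algebra: an ordering of \<open>I\<close> maps to its sign times
  that vector.\<close>

definition alt_coeff :: "nat set \<Rightarrow> 'a::field ncpoly \<Rightarrow> 'a" where
  "alt_coeff I p = alt_sum I (\<lambda>w. Poly_Mapping.lookup p (Word w))"

lemma alt_coeff_0 [simp]: "alt_coeff I 0 = 0"
  by (simp add: alt_coeff_def alt_sum_def)

lemma alt_coeff_add: "alt_coeff I (p + q) = alt_coeff I p + alt_coeff I q"
  by (simp add: alt_coeff_def alt_sum_def lookup_add ring_distribs sum.distrib)

lemma alt_coeff_diff: "alt_coeff I (p - q) = alt_coeff I p - alt_coeff I q"
  by (simp add: alt_coeff_def alt_sum_def lookup_minus ring_distribs sum_subtractf)

lemma alt_coeff_sum: "alt_coeff I (\<Sum>i\<in>A. p i) = (\<Sum>i\<in>A. alt_coeff I (p i))"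
  by (induction A rule: infinite_finite_induct) (simp_all add: alt_coeff_add)

lemma alt_coeff_single:
  "alt_coeff I (Poly_Mapping.single (Word u) c)
    = (if u \<in> permutations_of_set I then word_sign u * c else 0)"
proof -
  have "alt_coeff I (Poly_Mapping.single (Word u) c)
      = (\<Sum>p\<in>permutations_of_set I. if p = u then word_sign u * c else 0)"
    unfolding alt_coeff_def alt_sum_def by (rule sum.cong) (auto simp: lookup_single when_def)
  then show ?thesis by simp
qed

text \<open>
  The largest ideal in the common kernel of the functionals \<^term>\<open>alt_coeff I\<close> with
  \<open>card I = m\<close>. The quotient by it is the exterior algebra, truncated above degree \<open>m\<close>.
\<close>

definition alt_null :: "nat \<Rightarrow> 'a::field ncpoly set" where
  "alt_null m = {p. \<forall>a b I. card I = m \<longrightarrow> alt_coeff I (a * p * b) = 0}"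

lemma alt_nullD: "p \<in> alt_null m \<Longrightarrow> card I = m \<Longrightarrow> alt_coeff I p = 0"
  unfolding alt_null_def by (metis (mono_tags, lifting) mem_Collect_eq mult_1_left mult_1_right)

lemma alt_null_0 [simp]: "0 \<in> alt_null m"
  by (simp add: alt_null_def)

lemma alt_null_add: "p \<in> alt_null m \<Longrightarrow> q \<in> alt_null m \<Longrightarrow> p + q \<in> alt_null m"
  by (simp add: alt_null_def ring_distribs alt_coeff_add)

lemma alt_null_mult_left: "p \<in> alt_null m \<Longrightarrow> r * p \<in> alt_null m"
  unfolding alt_null_def by (auto simp flip: mult.assoc)

lemma alt_null_mult_right: "p \<in> alt_null m \<Longrightarrow> p * r \<in> alt_null m"
  unfolding alt_null_def by (auto simp: mult.assoc)

lemma two_sided_ideal_alt_null: "two_sided_ideal (alt_null m) = alt_null m"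
proof
  show "two_sided_ideal (alt_null m) \<subseteq> alt_null m"
  proof
    fix p assume "p \<in> two_sided_ideal (alt_null m)"
    then show "p \<in> alt_null m"
      by induction (simp_all add: alt_null_add alt_null_mult_left alt_null_mult_right)
  qed
qed (auto intro: two_sided_ideal.gen)

definition alt_cong :: "nat \<Rightarrow> 'a::field ncpoly \<Rightarrow> 'a ncpoly \<Rightarrow> bool" where
  "alt_cong m p q \<longleftrightarrow> p - q \<in> alt_null m"

lemma alt_cong_refl [simp]: "alt_cong m p p"
  by (simp add: alt_cong_def)

lemma alt_cong_swap: "alt_cong m p q \<Longrightarrow> alt_cong m q p"
  using two_sided_ideal_diff_swap[of p q "alt_null m"]
  by (simp add: alt_cong_def two_sided_ideal_alt_null)

lemma alt_cong_trans [trans]: "alt_cong m p q \<Longrightarrow> alt_cong m q r \<Longrightarrow> alt_cong m p r"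
  using two_sided_ideal_diff_trans[of p q "alt_null m" r]
  by (simp add: alt_cong_def two_sided_ideal_alt_null)

lemma alt_cong_add: "alt_cong m p q \<Longrightarrow> alt_cong m p' q' \<Longrightarrow> alt_cong m (p + p') (q + q')"
  using two_sided_ideal_diff_add[of p q "alt_null m" p' q']
  by (simp add: alt_cong_def two_sided_ideal_alt_null)

lemma alt_cong_mult: "alt_cong m p q \<Longrightarrow> alt_cong m p' q' \<Longrightarrow> alt_cong m (p * p') (q * q')"
  using two_sided_ideal_diff_mult[of p q "alt_null m" p' q']
  by (simp add: alt_cong_def two_sided_ideal_alt_null)

lemma alt_cong_sum: "(\<And>i. i \<in> A \<Longrightarrow> alt_cong m (p i) (q i)) \<Longrightarrow> alt_cong m (\<Sum>i\<in>A. p i) (\<Sum>i\<in>A. q i)"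
  by (induction A rule: infinite_finite_induct) (simp_all add: alt_cong_add)

lemma alt_cong_coeff: "alt_cong m p q \<Longrightarrow> card I = m \<Longrightarrow> alt_coeff I p = alt_coeff I q"
  using alt_nullD[of "p - q" m I] by (simp add: alt_cong_def alt_coeff_diff)

lemma alt_nullI:
  assumes "\<And>x y c e I. card I = m \<Longrightarrow>
    alt_coeff I (Poly_Mapping.single (Word x) c * p * Poly_Mapping.single (Word y) e) = 0"
  shows "p \<in> alt_null m"
  unfolding alt_null_def mem_Collect_eq
proof (intro allI impI)
  fix a b :: "'a ncpoly" and I :: "nat set"
  assume I: "card I = m"
  show "alt_coeff I (a * p * b) = 0"
  proof (induction a rule: ncpoly_induct)
    case (single x c)
    show ?case
      by (induction b rule: ncpoly_induct)
         (simp_all add: ring_distribs alt_coeff_add assms[OF I])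
  qed (simp_all add: ring_distribs alt_coeff_add)
qed

section \<open>Lowest degree, parity and commutation modulo the exterior relations\<close>

definition min_length :: "nat \<Rightarrow> 'a::field ncpoly \<Rightarrow> bool" where
  "min_length k p \<longleftrightarrow> (\<forall>w. Poly_Mapping.lookup p (Word w) \<noteq> 0 \<longrightarrow> k \<le> length w)"

lemma min_length_0 [simp]: "min_length 0 p" "min_length k 0"
  by (simp_all add: min_length_def)

lemma min_length_mono: "min_length k p \<Longrightarrow> l \<le> k \<Longrightarrow> min_length l p"
  by (meson le_trans min_length_def)

lemma min_length_add: "min_length k p \<Longrightarrow> min_length k q \<Longrightarrow> min_length k (p + q)"
  unfolding min_length_def lookup_add by (metis add.left_neutral)

lemma min_length_mult:
  assumes "min_length k p" "min_length l q"
  shows "min_length (k + l) (p * q)"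
  unfolding min_length_def
proof (intro allI impI)
  fix w assume "Poly_Mapping.lookup (p * q) (Word w) \<noteq> 0"
  then obtain i where i: "i \<le> length w"
    "Poly_Mapping.lookup p (Word (take i w)) * Poly_Mapping.lookup q (Word (drop i w)) \<noteq> 0"
    unfolding lookup_mult_Word by (meson atMost_iff sum.not_neutral_contains_not_neutral)
  then have "k \<le> length (take i w)" "l \<le> length (drop i w)"
    using assms by (auto simp: min_length_def simp del: length_take length_drop)
  then show "k + l \<le> length w"
    using i(1) by simp
qed

lemma min_length_alt_null:
  assumes "min_length k p" "m < k"
  shows "p \<in> alt_null m"
  unfolding alt_null_def mem_Collect_eq
proof (intro allI impI)
  fix a b :: "'a ncpoly" and I :: "nat set"
  assume I: "card I = m"
  have "min_length (0 + k + 0) (a * p * b)"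
    by (intro min_length_mult assms) simp_all
  then have "Poly_Mapping.lookup (a * p * b) (Word w) = 0" if "w \<in> permutations_of_set I" for w
    using that I assms(2) length_finite_permutations_of_set[OF that] by (force simp: min_length_def)
  then show "alt_coeff I (a * p * b) = 0"
    by (simp add: alt_coeff_def alt_sum_def)
qed

definition even_poly :: "'a::field ncpoly \<Rightarrow> bool" where
  "even_poly p \<longleftrightarrow> (\<forall>w. Poly_Mapping.lookup p (Word w) \<noteq> 0 \<longrightarrow> even (length w))"

lemma even_poly_mult:
  assumes "even_poly p" "even_poly q"
  shows "even_poly (p * q)"
  unfolding even_poly_def
proof (intro allI impI)
  fix w assume "Poly_Mapping.lookup (p * q) (Word w) \<noteq> 0"
  then obtain i where i: "i \<le> length w"
    "Poly_Mapping.lookup p (Word (take i w)) * Poly_Mapping.lookup q (Word (drop i w)) \<noteq> 0"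
    unfolding lookup_mult_Word by (meson atMost_iff sum.not_neutral_contains_not_neutral)
  then have "even (length (take i w))" "even (length (drop i w))"
    using assms by (auto simp: even_poly_def simp del: length_take length_drop)
  moreover have "length w = length (take i w) + length (drop i w)"
    using i by simp
  ultimately show "even (length w)"
    by presburger
qed

lemma even_poly_1 [simp]: "even_poly 1"
  by (auto simp: even_poly_def lookup_one when_def zero_Word)

lemma even_poly_prod_list: "(\<And>l. even_poly (E l)) \<Longrightarrow> even_poly (prod_list (map E s))"
  by (induction s) (simp_all add: even_poly_mult)

text \<open>Moving \<open>u\<close> past \<open>v\<close> inside an ordering costs the sign
  \<open>(-1) ^ (length u * length v)\<close>, which is 1.\<close>

lemma even_word_commute:
  fixes c e :: "'a::field"
  assumes "even (length u)"
  shows "alt_cong m (Poly_Mapping.single (Word u) c * Poly_Mapping.single (Word v) e)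
    (Poly_Mapping.single (Word v) e * Poly_Mapping.single (Word u) c)"
  unfolding alt_cong_def
proof (rule alt_nullI)
  fix x y and a b :: 'a and I :: "nat set"
  have "word_sign (x @ u @ v @ y) = (word_sign (x @ v @ u @ y) :: 'a)"
    if "x @ u @ v @ y \<in> permutations_of_set I"
    using that assms word_sign_block_swap[of u v x y, where 'a='a]
    by (auto simp: permutations_of_set_def)
  moreover have "x @ u @ v @ y \<in> permutations_of_set I \<longleftrightarrow> x @ v @ u @ y \<in> permutations_of_set I"
    by (auto simp: permutations_of_set_def)
  ultimately show "alt_coeff I (Poly_Mapping.single (Word x) a *
      (Poly_Mapping.single (Word u) c * Poly_Mapping.single (Word v) e -
       Poly_Mapping.single (Word v) e * Poly_Mapping.single (Word u) c) *
      Poly_Mapping.single (Word y) b) = 0"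
    by (simp add: ring_distribs mult_single alt_coeff_diff alt_coeff_single mult_ac)
qed

lemma even_poly_commute:
  assumes "even_poly p"
  shows "alt_cong m (p * q) (q * p)"
proof (induction q rule: ncpoly_induct)
  case (single v e)
  let ?q = "Poly_Mapping.single (Word v) e"
  let ?s = "\<lambda>w. Poly_Mapping.single w (Poly_Mapping.lookup p w)"
  have "alt_cong m (?s w * ?q) (?q * ?s w)" if "w \<in> Poly_Mapping.keys p" for w
  proof -
    obtain u where "w = Word u"
      by (cases w)
    then show ?thesis
      using assms that even_word_commute[of u] by (auto simp: even_poly_def in_keys_iff)
  qed
  then have "alt_cong m (\<Sum>w\<in>Poly_Mapping.keys p. ?s w * ?q) (\<Sum>w\<in>Poly_Mapping.keys p. ?q * ?s w)"
    by (rule alt_cong_sum)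
  then show ?case
    by (simp flip: sum_distrib_left sum_distrib_right ncpoly_sum_single)
qed (simp_all add: ring_distribs alt_cong_add)

definition nc_part :: "(nat \<Rightarrow> bool) \<Rightarrow> 'a::field ncpoly \<Rightarrow> 'a ncpoly" where
  "nc_part P p = (\<Sum>w\<in>Poly_Mapping.keys p.
     if P (length (letters w)) then Poly_Mapping.single w (Poly_Mapping.lookup p w) else 0)"

lemma lookup_nc_part:
  "Poly_Mapping.lookup (nc_part P p) (Word u) = (if P (length u) then Poly_Mapping.lookup p (Word u) else 0)"
proof -
  have "Poly_Mapping.lookup (nc_part P p) (Word u)
      = (\<Sum>w\<in>Poly_Mapping.keys p. if w = Word u then (if P (length u) then Poly_Mapping.lookup p (Word u) else 0) else 0)"
    unfolding nc_part_def lookup_sum by (rule sum.cong) (auto simp: lookup_single when_def)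
  then show ?thesis
    by (simp add: in_keys_iff)
qed

lemma ncpoly_eqI:
  "(\<And>u. Poly_Mapping.lookup p (Word u) = Poly_Mapping.lookup q (Word u)) \<Longrightarrow> p = (q :: 'a::field ncpoly)"
  by (rule poly_mapping_eqI) (metis word.exhaust)

lemma nc_part_even_odd: "nc_part even p + nc_part odd p = p"
  by (rule ncpoly_eqI) (simp add: lookup_add lookup_nc_part)

lemma lookup_nc_const: "Poly_Mapping.lookup (nc_const c) (Word u) = (if u = [] then c else 0)"
  by (auto simp: nc_const_def lookup_single when_def zero_Word)

text \<open>The analogue of \<open>mword_markings\<close> modulo \<open>alt_null m\<close>: the even
  summands are central there and take the place of the scalars.\<close>

lemma prod_list_markings:
  assumes "\<And>l. even_poly (E l)"
  shows "alt_cong m (prod_list (map (\<lambda>l. E l + O' l) w))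
    (\<Sum>bs\<in>markings w. prod_list (map E (marked bs)) * prod_list (map O' (unmarked bs)))"
proof (induction w)
  case (Cons l w)
  let ?t = "\<lambda>bs. prod_list (map E (marked bs)) * prod_list (map O' (unmarked bs))"
  have "alt_cong m (prod_list (map (\<lambda>l. E l + O' l) (l # w))) ((E l + O' l) * (\<Sum>bs\<in>markings w. ?t bs))"
    by (simp add: alt_cong_mult Cons)
  also have "(E l + O' l) * (\<Sum>bs\<in>markings w. ?t bs)
      = (\<Sum>bs\<in>markings w. E l * ?t bs) + (\<Sum>bs\<in>markings w. O' l * ?t bs)"
    by (simp add: ring_distribs sum_distrib_left sum.distrib)
  also have "alt_cong m \<dots> ((\<Sum>bs\<in>markings w. E l * ?t bs)
      + (\<Sum>bs\<in>markings w. prod_list (map E (marked bs)) * (O' l * prod_list (map O' (unmarked bs)))))"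
  proof (intro alt_cong_add alt_cong_sum alt_cong_refl)
    fix bs
    let ?P = "prod_list (map E (marked bs))" and ?Q = "prod_list (map O' (unmarked bs))"
    have "alt_cong m (O' l * ?P) (?P * O' l)"
      by (intro alt_cong_swap[OF even_poly_commute] even_poly_prod_list assms)
    then have "alt_cong m (O' l * ?P * ?Q) (?P * O' l * ?Q)"
      by (rule alt_cong_mult) simp
    then show "alt_cong m (O' l * ?t bs) (?P * (O' l * ?Q))"
      by (simp only: mult.assoc)
  qed
  also have "\<dots> = (\<Sum>bs\<in>markings (l # w). ?t bs)"
    by (simp add: sum_markings_Cons mult.assoc)
  finally show ?case .
qed simp

lemma prod_list_even_permute:
  assumes "\<And>l. even_poly (E l)" "mset s = mset s'"
  shows "alt_cong m (prod_list (map E s)) (prod_list (map E s'))"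
  using assms(2)
proof (induction s arbitrary: s')
  case (Cons l s)
  then obtain u v where s': "s' = u @ l # v"
    by (metis list.set_intros(1) mset_eq_setD split_list)
  then have "mset s = mset (u @ v)"
    using Cons.prems by simp
  note IH = Cons.IH[OF this]
  have "alt_cong m (prod_list (map E (l # s))) (E l * prod_list (map E (u @ v)))"
    unfolding list.map prod_list.Cons by (rule alt_cong_mult[OF alt_cong_refl IH])
  also have "E l * prod_list (map E (u @ v)) = E l * prod_list (map E u) * prod_list (map E v)"
    by (simp add: mult.assoc)
  also have "alt_cong m \<dots> (prod_list (map E u) * E l * prod_list (map E v))"
    by (intro alt_cong_mult alt_cong_refl even_poly_commute assms)
  also have "\<dots> = prod_list (map E s')"
    by (simp add: s' mult.assoc)
  finally show ?case .
qed simp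

lemma min_length_prod_list:
  "(\<And>l. min_length 1 (O' l)) \<Longrightarrow> min_length (length v) (prod_list (map O' v))"
proof (induction v)
  case (Cons l v)
  then show ?case using min_length_mult[of 1 "O' l" "length v" "prod_list (map O' v)"] by simp
qed simp

lemma min_length_prod_list_diff_const:
  assumes "\<And>l. min_length 2 (E l - nc_const (c l))"
  shows "min_length 2 (prod_list (map E s) - nc_const (prod_list (map c s)))"
proof (induction s)
  case (Cons l s)
  have "prod_list (map E (l # s)) - nc_const (prod_list (map c (l # s)))
      = (E l - nc_const (c l)) * prod_list (map E s)
        + nc_const (c l) * (prod_list (map E s) - nc_const (prod_list (map c s)))"
    by (simp add: nc_const_mult algebra_simps)
  moreover have "min_length 2 ((E l - nc_const (c l)) * prod_list (map E s))"
    by (rule min_length_mono[OF min_length_mult[OF assms min_length_0(1)]]) simp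
  moreover have "min_length 2 (nc_const (c l) * (prod_list (map E s) - nc_const (prod_list (map c s))))"
    by (rule min_length_mono[OF min_length_mult[OF min_length_0(1) Cons]]) simp
  ultimately show ?case
    by (simp only: min_length_add)
qed simp

text \<open>Factors are exchanged one at a time; each exchange puts a difference of degree at least
  3 where a factor of degree at least 1 stood, a gain of 2.\<close>

lemma min_length_prod_list_diff:
  assumes "\<And>l. min_length 1 (O' l)" "\<And>l. min_length 1 (L l)" "\<And>l. min_length 3 (O' l - L l)"
  shows "min_length (length v + 2) (prod_list (map O' v) - prod_list (map L v))"
proof (induction v)
  case (Cons l v)
  have "prod_list (map O' (l # v)) - prod_list (map L (l # v))
      = (O' l - L l) * prod_list (map O' v) + L l * (prod_list (map O' v) - prod_list (map L v))"
    by (simp add: algebra_simps)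
  moreover have "min_length (length (l # v) + 2) ((O' l - L l) * prod_list (map O' v))"
    by (rule min_length_mono[OF min_length_mult[OF assms(3) min_length_prod_list[OF assms(1)]]]) simp
  moreover have "min_length (length (l # v) + 2) (L l * (prod_list (map O' v) - prod_list (map L v)))"
    by (rule min_length_mono[OF min_length_mult[OF assms(2) Cons]]) simp
  ultimately show ?case
    by (simp only: min_length_add)
qed simp

section \<open>Reduction of substitution instances to their linear parts\<close>

text \<open>For \<open>m = 2 * d + 1\<close> the two lengths are those that survive. The letters are
  variables of \<open>h\<close>, so the number of these words depends neither on \<open>n\<close>
  nor on the proof; it supplies the constant of the bound.\<close>

definition low_words :: "nat \<Rightarrow> 'a::field ncpoly \<Rightarrow> nat list set" where
  "low_words m h = {v. set v \<subseteq> nc_vars h \<and> (length v = m \<or> Suc (length v) = m)}"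

lemma finite_low_words [simp]: "finite (low_words m h)"
proof -
  have "finite (nc_vars h)"
    by (simp add: nc_vars_def)
  then have "finite {v. set v \<subseteq> nc_vars h \<and> length v \<le> m}"
    by (rule finite_lists_length_le)
  then show ?thesis
    by (rule rev_finite_subset) (auto simp: low_words_def)
qed

abbreviation lin_part :: "'a::field ncpoly \<Rightarrow> 'a ncpoly" where
  "lin_part \<equiv> nc_part (\<lambda>n. n = 1)"

lemma unmarked_in_nc_vars:
  assumes "bs \<in> all_markings h"
  shows "set (unmarked bs) \<subseteq> nc_vars h"
proof -
  have "set (map snd bs) \<subseteq> nc_vars h"
    using assms unfolding all_markings_def nc_vars_def by force
  then show ?thesis
    by (auto simp: unmarked_def)
qed

text \<open>
  Modulo the ideal the even parts of the substituted polynomials are central, so that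
  \<open>h\<close> is expanded around them; the coefficients of the words of length below \<open>2 * d\<close> cancel
  and the even and odd parts of higher degree do not contribute to degree \<open>2 * d + 1\<close>.
\<close>

lemma subst_identity_cong:
  fixes h :: "'a::field_char_0 ncpoly"
  assumes "mat_identity d h" "m = 2 * d + 1"
  obtains \<kappa> where "alt_cong m (nc_subst ps h)
    (\<Sum>v\<in>low_words m h. nc_const (\<kappa> v) * prod_list (map (\<lambda>l. lin_part (ps l)) v))"
proof -
  define E where "E l = nc_part even (ps l)" for l
  define O' where "O' l = nc_part odd (ps l)" for l
  define L where "L l = lin_part (ps l)" for l
  define c where "c l = Poly_Mapping.lookup (ps l) (Word [])" for l
  have E: "even_poly (E l)" for l
    by (auto simp: E_def even_poly_def lookup_nc_part split: if_splits)
  have len_E: "min_length 2 (E l - nc_const (c l))" for l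
    unfolding min_length_def
  proof (intro allI impI)
    fix w assume "Poly_Mapping.lookup (E l - nc_const (c l)) (Word w) \<noteq> 0"
    then have "even (length w)" "w \<noteq> []"
      by (auto simp: E_def c_def lookup_minus lookup_nc_part lookup_nc_const split: if_splits)
    then show "2 \<le> length w"
      by (cases w; cases "tl w") auto
  qed
  have len_O: "min_length 1 (O' l)" for l
    unfolding min_length_def
  proof (intro allI impI)
    fix w assume "Poly_Mapping.lookup (O' l) (Word w) \<noteq> 0"
    then have "odd (length w)"
      by (auto simp: O'_def lookup_nc_part split: if_splits)
    then show "1 \<le> length w"
      by (cases w) auto
  qed
  have len_L: "min_length 1 (L l)" for l
    by (auto simp: min_length_def L_def lookup_nc_part split: if_splits)
  have len_OL: "min_length 3 (O' l - L l)" for l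
    unfolding min_length_def
  proof (intro allI impI)
    fix w assume "Poly_Mapping.lookup (O' l - L l) (Word w) \<noteq> 0"
    then have "odd (length w)" "length w \<noteq> 1"
      by (auto simp: O'_def L_def lookup_minus lookup_nc_part split: if_splits)
    then show "3 \<le> length w"
      by presburger
  qed
  let ?A = "all_markings h"
  let ?h = "\<lambda>bs. Poly_Mapping.lookup h (Word (map snd bs))"
  define t where "t bs = nc_const (?h bs) * (prod_list (map E (marked bs)) * prod_list (map O' (unmarked bs)))" for bs
  define k where "k bs = ?h bs * prod_list (map c (marked bs))" for bs
  have "nc_subst ps h = (\<Sum>w\<in>Poly_Mapping.keys h. nc_const (Poly_Mapping.lookup h w)
      * prod_list (map (\<lambda>l. E l + O' l) (letters w)))"
    by (simp add: nc_subst_def E_def O'_def nc_part_even_odd)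
  also have "alt_cong m \<dots> (\<Sum>w\<in>Poly_Mapping.keys h. nc_const (Poly_Mapping.lookup h w) *
      (\<Sum>bs\<in>markings (letters w). prod_list (map E (marked bs)) * prod_list (map O' (unmarked bs))))"
    by (intro alt_cong_sum alt_cong_mult alt_cong_refl prod_list_markings E)
  also have "\<dots> = (\<Sum>w\<in>Poly_Mapping.keys h. \<Sum>bs\<in>markings (letters w). t bs)"
    unfolding sum_distrib_left t_def
    by (intro sum.cong HOL.refl) (auto simp: markings_def)
  also have "\<dots> = (\<Sum>bs\<in>?A. t bs)"
    by (rule sum_all_markings [symmetric])
  also have "\<dots> = (\<Sum>bs | bs \<in> ?A \<and> length (unmarked bs) < 2 * d. t bs)
      + (\<Sum>bs | bs \<in> ?A \<and> \<not> length (unmarked bs) < 2 * d. t bs)"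
  proof -
    have "(\<Sum>bs\<in>?A. t bs) = (\<Sum>bs\<in>?A. if length (unmarked bs) < 2 * d then t bs else t bs)"
      by simp
    also have "\<dots> = sum t (?A \<inter> {bs. length (unmarked bs) < 2 * d}) + sum t (?A \<inter> - {bs. length (unmarked bs) < 2 * d})"
      by (rule sum.If_cases) simp
    finally show ?thesis
      by (simp add: Collect_conj_eq Collect_neg_eq)
  qed
  also have "alt_cong m \<dots> (0 + (\<Sum>bs | bs \<in> ?A \<and> \<not> length (unmarked bs) < 2 * d.
      if length (unmarked bs) \<le> m then nc_const (k bs) * prod_list (map L (unmarked bs)) else 0))"
  proof (intro alt_cong_add alt_cong_sum)
    let ?B = "{bs \<in> ?A. length (unmarked bs) < 2 * d}"
    \<comment> \<open>Within one class of this key the even products agree up to order, hence modulo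
      the ideal. The class is therefore a multiple of its coefficient sum, which is zero for words
      shorter than \<open>2 * d\<close>.\<close>
    let ?key = "\<lambda>bs. (mset (marked bs), unmarked bs)"
    have "(\<Sum>bs\<in>?B. t bs) = (\<Sum>y\<in>?key ` ?B. \<Sum>bs | bs \<in> ?B \<and> ?key bs = y. t bs)"
      by (rule sum.image_gen) simp
    also have "alt_cong m \<dots> (\<Sum>y\<in>?key ` ?B. 0)"
    proof (rule alt_cong_sum)
      fix y assume "y \<in> ?key ` ?B"
      then obtain b where b: "b \<in> ?B" "y = ?key b"
        by auto
      define R where "R = prod_list (map E (marked b)) * prod_list (map O' (unmarked b))"
      have "alt_cong m (\<Sum>bs | bs \<in> ?B \<and> ?key bs = y. t bs) (\<Sum>bs | bs \<in> ?B \<and> ?key bs = y. nc_const (?h bs) * R)"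
      proof (rule alt_cong_sum)
        fix bs assume bs: "bs \<in> {bs. bs \<in> ?B \<and> ?key bs = y}"
        then have "mset (marked bs) = mset (marked b)" "unmarked bs = unmarked b"
          using b by auto
        then show "alt_cong m (t bs) (nc_const (?h bs) * R)"
          unfolding t_def R_def
          by (intro alt_cong_mult) (simp_all add: prod_list_even_permute[OF E])
      qed
      also have "(\<Sum>bs | bs \<in> ?B \<and> ?key bs = y. nc_const (?h bs) * R)
          = nc_const (\<Sum>bs | bs \<in> ?B \<and> ?key bs = y. ?h bs) * R"
        unfolding sum_distrib_right [symmetric] nc_const_sum ..
      also have "(\<Sum>bs | bs \<in> ?B \<and> ?key bs = y. ?h bs) = 0"
      proof -
        have "{bs. bs \<in> ?B \<and> ?key bs = y}
            = {bs. bs \<in> ?A \<and> mset (marked bs) = mset (marked b) \<and> unmarked bs = unmarked b}"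
          using b by auto
        then show ?thesis
          using identity_low_coeff_eq_0[OF assms(1), of "unmarked b"] b by simp
      qed
      finally show "alt_cong m (\<Sum>bs | bs \<in> ?B \<and> ?key bs = y. t bs) 0"
        by simp
    qed
    finally show "alt_cong m (\<Sum>bs\<in>?B. t bs) 0"
      by simp
  next
    fix bs assume bs: "bs \<in> {bs. bs \<in> ?A \<and> \<not> length (unmarked bs) < 2 * d}"
    let ?P = "prod_list (map E (marked bs))" and ?Q = "prod_list (map O' (unmarked bs))"
      and ?c = "prod_list (map c (marked bs))" and ?M = "prod_list (map L (unmarked bs))"
    note Q = min_length_prod_list[of O' "unmarked bs", OF len_O]
    show "alt_cong m (t bs) (if length (unmarked bs) \<le> m then nc_const (k bs) * ?M else 0)"
    proof (cases "length (unmarked bs) \<le> m")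
      case True
      \<comment> \<open>Both summands have degree at least \<open>2 * d + 2\<close>, beyond
        \<open>m\<close>: \<open>2 * d\<close> from the number of odd factors and 2 more from the
        exchange of even or odd parts.\<close>
      have "?P * ?Q - nc_const ?c * ?M = (?P - nc_const ?c) * ?Q + nc_const ?c * (?Q - ?M)"
        by (simp add: algebra_simps)
      moreover have "min_length (2 * d + 2) ((?P - nc_const ?c) * ?Q)"
        by (rule min_length_mono[OF min_length_mult[OF min_length_prod_list_diff_const[OF len_E] Q]])
           (use bs in simp)
      moreover have "min_length (2 * d + 2) (nc_const ?c * (?Q - ?M))"
        by (rule min_length_mono[OF min_length_mult[OF min_length_0(1)
              min_length_prod_list_diff[OF len_O len_L len_OL]]]) (use bs in simp)
      ultimately have "min_length (2 * d + 2) (?P * ?Q - nc_const ?c * ?M)"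
        by (simp only: min_length_add)
      then have "alt_cong m (?P * ?Q) (nc_const ?c * ?M)"
        unfolding alt_cong_def by (rule min_length_alt_null) (simp add: assms(2))
      then have "alt_cong m (nc_const (?h bs) * (?P * ?Q)) (nc_const (?h bs) * (nc_const ?c * ?M))"
        by (rule alt_cong_mult[OF alt_cong_refl])
      then show ?thesis
        using True by (simp add: t_def k_def nc_const_mult mult.assoc)
    next
      case False
      have "?Q \<in> alt_null m"
        using Q by (rule min_length_alt_null) (use False in simp)
      then have "t bs \<in> alt_null m"
        unfolding t_def by (intro alt_null_mult_left)
      then show ?thesis
        using False by (simp add: alt_cong_def)
    qed
  qed
  also have "0 + (\<Sum>bs | bs \<in> ?A \<and> \<not> length (unmarked bs) < 2 * d.
      if length (unmarked bs) \<le> m then nc_const (k bs) * prod_list (map L (unmarked bs)) else 0)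
    = (\<Sum>bs | bs \<in> ?A \<and> unmarked bs \<in> low_words m h. nc_const (k bs) * prod_list (map L (unmarked bs)))"
    unfolding add_0_left
    by (rule sum.mono_neutral_cong_right)
       (use unmarked_in_nc_vars in \<open>auto simp: low_words_def assms(2)\<close>)
  also have "\<dots> = (\<Sum>v\<in>low_words m h. \<Sum>bs | bs \<in> {bs \<in> ?A. unmarked bs \<in> low_words m h} \<and> unmarked bs = v.
      nc_const (k bs) * prod_list (map L (unmarked bs)))"
    by (rule sum.group [symmetric]) auto
  also have "\<dots> = (\<Sum>v\<in>low_words m h.
      nc_const (\<Sum>bs | bs \<in> {bs \<in> ?A. unmarked bs \<in> low_words m h} \<and> unmarked bs = v. k bs) * prod_list (map L v))"
    unfolding nc_const_sum sum_distrib_right by (intro sum.cong HOL.refl) simp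
  also have "L = (\<lambda>l. lin_part (ps l))"
    by (simp add: L_def fun_eq_iff)
  finally show ?thesis
    by (rule that)
qed

lemma lookup_prod_list_homogeneous:
  assumes "\<And>l w. Poly_Mapping.lookup (L l) (Word w) \<noteq> (0::'a::field) \<Longrightarrow> length w = 1"
    and "Poly_Mapping.lookup (prod_list (map L v)) (Word w) \<noteq> 0"
  shows "length w = length v"
  using assms(2)
proof (induction v arbitrary: w)
  case Nil
  then show ?case by (auto simp: lookup_one when_def zero_Word split: if_splits)
next
  case (Cons l v)
  then obtain i where "i \<le> length w"
    "Poly_Mapping.lookup (L l) (Word (take i w)) * Poly_Mapping.lookup (prod_list (map L v)) (Word (drop i w)) \<noteq> 0"
    unfolding list.map prod_list.Cons lookup_mult_Word by (meson atMost_iff sum.not_neutral_contains_not_neutral)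
  then show ?case
    using Cons.IH[of "drop i w"] assms(1)[of l "take i w"] by auto
qed

text \<open>A word of length \<open>2 * d\<close> gives an even product, which is central. A word of
  length \<open>m\<close> is already in top degree, so only the constant term of \<open>r\<close>
  acts on it, and constants commute.\<close>

lemma low_word_sum_commute:
  fixes \<kappa> :: "nat list \<Rightarrow> 'a::field"
  assumes "m = 2 * d + 1" "\<And>l. min_length 1 (L l)" "\<And>l w. Poly_Mapping.lookup (L l) (Word w) \<noteq> 0 \<Longrightarrow> length w = 1"
    and "\<And>v. v \<in> V \<Longrightarrow> length v = m \<or> Suc (length v) = m"
  shows "alt_cong m ((\<Sum>v\<in>V. nc_const (\<kappa> v) * prod_list (map L v)) * r)
    (r * (\<Sum>v\<in>V. nc_const (\<kappa> v) * prod_list (map L v)))"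
  unfolding sum_distrib_left sum_distrib_right
proof (rule alt_cong_sum)
  fix v assume v: "v \<in> V"
  let ?P = "prod_list (map L v)"
  have hom: "length w = length v" if "Poly_Mapping.lookup ?P (Word w) \<noteq> 0" for w
    using assms(3) that by (rule lookup_prod_list_homogeneous)
  have "alt_cong m (?P * r) (r * ?P)"
  proof (cases "length v = m")
    case False
    then have "even (length v)"
      using assms(4)[OF v] assms(1) False by (elim disjE) simp_all
    then have "even_poly ?P"
      using hom by (auto simp: even_poly_def)
    then show ?thesis
      by (rule even_poly_commute)
  next
    case True
    define c where "c = Poly_Mapping.lookup r (Word [])"
    have r: "min_length 1 (r - nc_const c)"
      by (auto simp: min_length_def lookup_minus lookup_nc_const c_def Suc_le_eq)
    have P: "min_length m ?P"
      using min_length_prod_list[of L v] assms(2) True by simp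
    have "?P * r - r * ?P = ?P * (r - nc_const c) - (r - nc_const c) * ?P"
      by (simp add: algebra_simps nc_const_mult_commute)
    moreover have "?P * (r - nc_const c) \<in> alt_null m"
      by (rule min_length_alt_null[OF min_length_mult[OF P r]]) simp
    moreover have "- 1 * ((r - nc_const c) * ?P) \<in> alt_null m"
      by (rule alt_null_mult_left) (rule min_length_alt_null[OF min_length_mult[OF r P]], simp)
    ultimately show ?thesis
      unfolding alt_cong_def using alt_null_add[of "?P * (r - nc_const c)" m "- 1 * ((r - nc_const c) * ?P)"]
      by simp
  qed
  then have "alt_cong m (nc_const (\<kappa> v) * (?P * r)) (nc_const (\<kappa> v) * (r * ?P))"
    by (rule alt_cong_mult[OF alt_cong_refl])
  moreover have "nc_const (\<kappa> v) * (r * ?P) = r * (nc_const (\<kappa> v) * ?P)"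
    by (metis mult.assoc nc_const_mult_commute)
  ultimately show "alt_cong m (nc_const (\<kappa> v) * ?P * r) (r * (nc_const (\<kappa> v) * ?P))"
    by (simp add: mult.assoc)
qed

text \<open>By centrality all two-sided multiples of one generator collapse into a single left
  multiple, so the number of generators counts and the size of an expression for \<open>f\<close>
  does not.\<close>

lemma two_sided_ideal_central_cong:
  assumes "f \<in> two_sided_ideal T" "finite T"
    and G: "\<And>g. g \<in> T \<Longrightarrow> alt_cong m g (G g)"
    and comm: "\<And>g r. g \<in> T \<Longrightarrow> alt_cong m (G g * r) (r * G g)"
  shows "\<exists>q. alt_cong m f (\<Sum>g\<in>T. q g * G g)"
  using assms(1)
proof induction
  case zero
  show ?case by (rule exI[of _ "\<lambda>_. 0"]) simp
next
  case (gen g)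
  have "(\<Sum>x\<in>T. (if x = g then 1 else 0) * G x) = (\<Sum>x\<in>T. if x = g then G g else 0)"
    by (rule sum.cong) auto
  then show ?case
    using gen assms(2) G by (intro exI[of _ "\<lambda>x. if x = g then 1 else 0"]) simp
next
  case (add p q)
  then obtain a b where "alt_cong m p (\<Sum>g\<in>T. a g * G g)" "alt_cong m q (\<Sum>g\<in>T. b g * G g)"
    by auto
  from alt_cong_add[OF this] show ?case
    by (intro exI[of _ "\<lambda>g. a g + b g"]) (simp add: ring_distribs sum.distrib)
next
  case (mult_left p r)
  then obtain a where "alt_cong m p (\<Sum>g\<in>T. a g * G g)"
    by auto
  from alt_cong_mult[OF alt_cong_refl this, of r] show ?case
    by (intro exI[of _ "\<lambda>g. r * a g"]) (simp add: sum_distrib_left mult.assoc)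
next
  case (mult_right p r)
  then obtain a where "alt_cong m p (\<Sum>g\<in>T. a g * G g)"
    by auto
  from alt_cong_mult[OF this alt_cong_refl, of r]
  have "alt_cong m (p * r) (\<Sum>g\<in>T. a g * (G g * r))"
    by (simp add: sum_distrib_right mult.assoc)
  also have "alt_cong m \<dots> (\<Sum>g\<in>T. a g * (r * G g))"
    by (intro alt_cong_sum alt_cong_mult alt_cong_refl comm)
  finally show ?case
    by (intro exI[of _ "\<lambda>g. a g * r"]) (simp add: mult.assoc)
qed

section \<open>Products of linear forms in the exterior power\<close>

text \<open>If \<open>lf b j\<close> is the coefficient of variable \<open>j\<close> in the
  \<open>b\<close>-th linear form and \<open>card I = m\<close>, this is the coordinate at
  \<open>I\<close> of the exterior product of the forms: a maximal minor of the coefficient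
  matrix.\<close>

definition linear_alt :: "nat \<Rightarrow> nat set \<Rightarrow> (nat \<Rightarrow> nat \<Rightarrow> 'a) \<Rightarrow> 'a::field" where
  "linear_alt m I lf = alt_sum I (\<lambda>w. \<Prod>b<m. lf b (w ! b))"

lemma lookup_prod_list_linear:
  assumes "\<And>l w. Poly_Mapping.lookup (L l) (Word w) \<noteq> (0::'a::field) \<Longrightarrow> length w = 1" "length w = length v"
  shows "Poly_Mapping.lookup (prod_list (map L v)) (Word w)
    = (\<Prod>b<length v. Poly_Mapping.lookup (L (v ! b)) (Word [w ! b]))"
  using assms(2)
proof (induction v arbitrary: w)
  case Nil
  then show ?case by (simp add: lookup_one zero_Word)
next
  case (Cons l v)
  then obtain j w' where w: "w = j # w'"
    by (cases w) auto
  have "Poly_Mapping.lookup (prod_list (map L (l # v))) (Word w)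
      = (\<Sum>i\<le>length w. if i = 1 then Poly_Mapping.lookup (L l) (Word [j])
          * Poly_Mapping.lookup (prod_list (map L v)) (Word w') else 0)"
    unfolding list.map prod_list.Cons lookup_mult_Word
  proof (rule sum.cong)
    fix i assume "i \<in> {..length w}"
    then have "Poly_Mapping.lookup (L l) (Word (take i w)) = 0" if "i \<noteq> 1"
      using assms(1)[of l "take i w"] that by auto
    then show "Poly_Mapping.lookup (L l) (Word (take i w)) * Poly_Mapping.lookup (prod_list (map L v)) (Word (drop i w))
      = (if i = 1 then Poly_Mapping.lookup (L l) (Word [j]) * Poly_Mapping.lookup (prod_list (map L v)) (Word w') else 0)"
      by (auto simp: w)
  qed simp
  also have "\<dots> = Poly_Mapping.lookup (L l) (Word [j]) * Poly_Mapping.lookup (prod_list (map L v)) (Word w')"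
    by (subst sum.delta) (simp_all add: w)
  also have "\<dots> = Poly_Mapping.lookup (L l) (Word [j]) * (\<Prod>b<length v. Poly_Mapping.lookup (L (v ! b)) (Word [w' ! b]))"
    using Cons w by simp
  also have "\<dots> = (\<Prod>b<length (l # v). Poly_Mapping.lookup (L ((l # v) ! b)) (Word [w ! b]))"
    unfolding list.size add_Suc_right add_0_right prod.lessThan_Suc_shift by (simp add: w)
  finally show ?case .
qed

text \<open>In degree \<open>m\<close> only the constant term of \<open>q\<close> fits next to a
  word of length \<open>m\<close>; it is absorbed into the first form. Next to a word of length
  \<open>m - 1\<close> only the linear part of \<open>q\<close> fits, and it becomes the first
  form.\<close>

lemma alt_coeff_low_word:
  assumes "\<And>l w. Poly_Mapping.lookup (L l) (Word w) \<noteq> (0::'a::field) \<Longrightarrow> length w = 1"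
    and "length v = m \<or> Suc (length v) = m" "0 < m"
  shows "\<exists>lf. \<forall>I. card I = m \<longrightarrow>
    alt_coeff I (q * (nc_const c * prod_list (map L v))) = linear_alt m I lf"
proof -
  let ?P = "prod_list (map L v)"
  let ?x = "\<lambda>b j. Poly_Mapping.lookup (L (v ! b)) (Word [j])"
  have min: "min_length (length v) ?P"
    by (rule min_length_prod_list) (auto simp: min_length_def dest: assms(1))
  have look: "Poly_Mapping.lookup (q * (nc_const c * ?P)) (Word w)
      = (\<Sum>i\<le>length w. Poly_Mapping.lookup q (Word (take i w)) * (c * Poly_Mapping.lookup ?P (Word (drop i w))))" for w
    by (simp only: lookup_mult_Word[of q] lookup_nc_const_mult)
  have zero: "Poly_Mapping.lookup ?P (Word (drop i w)) = 0" if "i \<le> length w" "length w < i + length v" for i w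
    using min that by (force simp: min_length_def)
  consider (full) "length v = m" | (short) "Suc (length v) = m"
    using assms(2) by blast
  then show ?thesis
  proof cases
    case full
    define lf where "lf b j = (if b = 0 then Poly_Mapping.lookup q (Word []) * c else 1) * ?x b j" for b j
    have "Poly_Mapping.lookup (q * (nc_const c * ?P)) (Word w) = (\<Prod>b<m. lf b (w ! b))" if w: "length w = m" for w
    proof -
      have "Poly_Mapping.lookup (q * (nc_const c * ?P)) (Word w)
          = (\<Sum>i\<le>length w. if i = 0 then Poly_Mapping.lookup q (Word []) * (c * Poly_Mapping.lookup ?P (Word w)) else 0)"
        unfolding look by (rule sum.cong) (use zero w full in auto)
      also have "\<dots> = Poly_Mapping.lookup q (Word []) * c * (\<Prod>b<m. ?x b (w ! b))"
        using lookup_prod_list_linear[where L = L and w = w and v = v, OF assms(1)] w full by simp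
      also have "\<dots> = (\<Prod>b<m. if b = 0 then Poly_Mapping.lookup q (Word []) * c else 1) * (\<Prod>b<m. ?x b (w ! b))"
        using assms(3) by simp
      finally show ?thesis
        by (simp only: lf_def prod.distrib)
    qed
    then show ?thesis
      unfolding linear_alt_def alt_coeff_def
      by (intro exI[of _ lf] allI impI alt_sum_cong) (metis distinct_card)
  next
    case short
    define lf where "lf b j = (if b = 0 then Poly_Mapping.lookup q (Word [j]) * c else ?x (b - 1) j)" for b j
    have "Poly_Mapping.lookup (q * (nc_const c * ?P)) (Word w) = (\<Prod>b<m. lf b (w ! b))" if w: "length w = m" for w
    proof -
      obtain j w' where jw: "w = j # w'"
        using w assms(3) by (cases w) auto
      have "Poly_Mapping.lookup (q * (nc_const c * ?P)) (Word w)
          = (\<Sum>i\<in>{0, 1}. Poly_Mapping.lookup q (Word (take i w)) * (c * Poly_Mapping.lookup ?P (Word (drop i w))))"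
        unfolding look
      proof (rule sum.mono_neutral_right)
        show "\<forall>i\<in>{..length w} - {0, 1}. Poly_Mapping.lookup q (Word (take i w)) * (c * Poly_Mapping.lookup ?P (Word (drop i w))) = 0"
          using zero[of _ w] w short by auto
      qed (use jw in auto)
      also have "Poly_Mapping.lookup ?P (Word w) = 0"
      proof (rule ccontr)
        assume "Poly_Mapping.lookup ?P (Word w) \<noteq> 0"
        with assms(1) have "length w = length v"
          by (rule lookup_prod_list_homogeneous)
        then show False using w short by auto
      qed
      then have "(\<Sum>i\<in>{0, 1}. Poly_Mapping.lookup q (Word (take i w)) * (c * Poly_Mapping.lookup ?P (Word (drop i w))))
          = Poly_Mapping.lookup q (Word [j]) * c * (\<Prod>b<length v. ?x b (w' ! b))"
        using lookup_prod_list_linear[where L = L and w = w' and v = v, OF assms(1)] w jw short by simp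
      also have "\<dots> = (\<Prod>b<m. lf b (w ! b))"
        unfolding short [symmetric] prod.lessThan_Suc_shift by (simp add: lf_def jw)
      finally show ?thesis .
    qed
    then show ?thesis
      unfolding linear_alt_def alt_coeff_def
      by (intro exI[of _ lf] allI impI alt_sum_cong) (metis distinct_card)
  qed
qed

lemma linear_alt_0: "0 < m \<Longrightarrow> linear_alt m I (\<lambda>_ _. 0) = 0"
  by (simp add: linear_alt_def alt_sum_def zero_power)

theorem alt_coeff_ideal_rank:
  fixes B :: "'a::field_char_0 ncpoly set"
  assumes "finite B" "\<And>h. h \<in> B \<Longrightarrow> mat_identity d h" "m = 2 * d + 1"
    and T: "finite T" "card T \<le> t" "T \<subseteq> subst_instances B" "f \<in> two_sided_ideal T"
  obtains lf where
    "\<And>I. card I = m \<Longrightarrow> alt_coeff I f = (\<Sum>r<(\<Sum>h\<in>B. card (low_words m h)) * t. linear_alt m I (lf r))"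
proof -
  define C where "C = (\<Sum>h\<in>B. card (low_words m h))"
  have "\<exists>h ps. h \<in> B \<and> g = nc_subst ps h" if "g \<in> T" for g
    using T(3) that unfolding subst_instances_def by blast
  then obtain h ps where h: "\<And>g. g \<in> T \<Longrightarrow> h g \<in> B" "\<And>g. g \<in> T \<Longrightarrow> g = nc_subst (ps g) (h g)"
    by metis
  define L where "L g l = lin_part (ps g l)" for g l
  have L: "Poly_Mapping.lookup (L g l) (Word w) \<noteq> 0 \<Longrightarrow> length w = 1" for g l w
    by (auto simp: L_def lookup_nc_part split: if_splits)
  have "\<exists>\<kappa>. alt_cong m g (\<Sum>v\<in>low_words m (h g). nc_const (\<kappa> v) * prod_list (map (L g) v))" if "g \<in> T" for g
    using subst_identity_cong[OF assms(2)[OF h(1)[OF that]] assms(3), of "ps g"] h(2)[OF that]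
    unfolding L_def by metis
  then obtain \<kappa> where \<kappa>: "\<And>g. g \<in> T \<Longrightarrow>
      alt_cong m g (\<Sum>v\<in>low_words m (h g). nc_const (\<kappa> g v) * prod_list (map (L g) v))"
    by metis
  have "\<exists>q. alt_cong m f (\<Sum>g\<in>T. q g * (\<Sum>v\<in>low_words m (h g). nc_const (\<kappa> g v) * prod_list (map (L g) v)))"
  proof (rule two_sided_ideal_central_cong[OF T(4,1) \<kappa>])
    fix g r assume "g \<in> T"
    show "alt_cong m ((\<Sum>v\<in>low_words m (h g). nc_const (\<kappa> g v) * prod_list (map (L g) v)) * r)
      (r * (\<Sum>v\<in>low_words m (h g). nc_const (\<kappa> g v) * prod_list (map (L g) v)))"
      by (rule low_word_sum_commute[OF assms(3)])
         (use L in \<open>auto simp: min_length_def low_words_def dest: L\<close>)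
  qed
  then obtain q where
    q: "alt_cong m f (\<Sum>g\<in>T. q g * (\<Sum>v\<in>low_words m (h g). nc_const (\<kappa> g v) * prod_list (map (L g) v)))"
    by blast
  define S where "S = (SIGMA g:T. low_words m (h g))"
  have "\<exists>lf. \<forall>I. card I = m \<longrightarrow>
      alt_coeff I (q g * (nc_const (\<kappa> g v) * prod_list (map (L g) v))) = linear_alt m I lf"
    if "(g, v) \<in> S" for g v
    by (rule alt_coeff_low_word[OF L]) (use that assms(3) in \<open>auto simp: S_def low_words_def\<close>)
  then obtain lf where lf: "\<And>g v I. (g, v) \<in> S \<Longrightarrow> card I = m \<Longrightarrow>
      alt_coeff I (q g * (nc_const (\<kappa> g v) * prod_list (map (L g) v))) = linear_alt m I (lf g v)"
    by metis
  have "finite S"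
    using T(1) by (simp add: S_def)
  then obtain \<beta> where \<beta>: "bij_betw \<beta> {0..<card S} S"
    using ex_bij_betw_nat_finite by blast
  have "card S = (\<Sum>g\<in>T. card (low_words m (h g)))"
    using T(1) by (simp add: S_def)
  also have "\<dots> \<le> (\<Sum>g\<in>T. C)"
    unfolding C_def by (intro sum_mono member_le_sum) (use h assms(1) in auto)
  also have "\<dots> \<le> C * t"
    using T(2) by simp
  finally have card: "card S \<le> C * t" .
  \<comment> \<open>Padding with zero forms brings the number of products to exactly
    \<open>C * t\<close>, a number that does not depend on \<open>T\<close>.\<close>
  define lf' where "lf' r = (if r < card S then lf (fst (\<beta> r)) (snd (\<beta> r)) else (\<lambda>_ _. 0))" for r
  have "alt_coeff I f = (\<Sum>r<C * t. linear_alt m I (lf' r))" if I: "card I = m" for I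
  proof -
    have "alt_coeff I f = (\<Sum>g\<in>T. \<Sum>v\<in>low_words m (h g).
        alt_coeff I (q g * (nc_const (\<kappa> g v) * prod_list (map (L g) v))))"
      unfolding alt_cong_coeff[OF q I] sum_distrib_left alt_coeff_sum ..
    also have "\<dots> = (\<Sum>(g, v)\<in>S. alt_coeff I (q g * (nc_const (\<kappa> g v) * prod_list (map (L g) v))))"
      unfolding S_def using T(1) by (intro sum.Sigma) auto
    also have "\<dots> = (\<Sum>x\<in>S. linear_alt m I (lf (fst x) (snd x)))"
      by (rule sum.cong) (auto simp: lf I)
    also have "\<dots> = (\<Sum>r\<in>{0..<card S}. linear_alt m I (lf' r))"
      by (subst sum.reindex_bij_betw[OF \<beta>, symmetric]) (simp add: lf'_def)
    also have "\<dots> = (\<Sum>r<C * t. linear_alt m I (lf' r))"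
      by (rule sum.mono_neutral_left) (use card assms(3) in \<open>auto simp: lf'_def linear_alt_0\<close>)
    finally show ?thesis .
  qed
  then show ?thesis
    using that unfolding C_def by blast
qed

section \<open>The lower bound\<close>

lemma nc_degree_homogeneous:
  assumes "f \<noteq> 0" "\<And>w. Poly_Mapping.lookup f (Word w) \<noteq> 0 \<Longrightarrow> length w = m"
  shows "nc_degree f = m"
proof -
  have keys: "length (letters w) = m" if "w \<in> Poly_Mapping.keys f" for w
    using assms(2)[of "letters w"] that by (simp add: in_keys_iff)
  obtain w where "w \<in> Poly_Mapping.keys f"
    using assms(1) by fastforce
  then have "(\<lambda>w. length (letters w)) ` Poly_Mapping.keys f = {m}"
    using keys by auto
  then show ?thesis
    by (simp add: nc_degree_def)
qed

lemma nc_vars_subset: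
  assumes "\<And>w. Poly_Mapping.lookup f (Word w) \<noteq> 0 \<Longrightarrow> set w \<subseteq> A"
  shows "nc_vars f \<subseteq> A"
  unfolding nc_vars_def
proof (rule UN_least)
  fix w assume "w \<in> Poly_Mapping.keys f"
  then show "set (letters w) \<subseteq> A"
    using assms[of "letters w"] by (simp add: in_keys_iff)
qed

section \<open>Identities built from standard polynomials\<close>

definition standard_sum :: "nat set set \<Rightarrow> (nat set \<Rightarrow> 'a) \<Rightarrow> 'a::field ncpoly" where
  "standard_sum \<I> c = (\<Sum>I\<in>\<I>. \<Sum>w\<in>permutations_of_set I. Poly_Mapping.single (Word w) (c I * word_sign w))"

lemma lookup_standard_sum:
  assumes "finite \<I>"
  shows "Poly_Mapping.lookup (standard_sum \<I> c) (Word w)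
    = (if distinct w \<and> set w \<in> \<I> then c (set w) * word_sign w else 0)"
proof -
  have "Poly_Mapping.lookup (standard_sum \<I> c) (Word w)
      = (\<Sum>I\<in>\<I>. \<Sum>v\<in>permutations_of_set I. if v = w then c I * word_sign w else 0)"
    unfolding standard_sum_def lookup_sum
    by (intro sum.cong HOL.refl) (auto simp: lookup_single when_def)
  also have "\<dots> = (\<Sum>I\<in>\<I>. if I = set w then (if distinct w then c (set w) * word_sign w else 0) else 0)"
  proof (rule sum.cong)
    fix I
    have "(\<Sum>v\<in>permutations_of_set I. if v = w then c I * word_sign w else 0)
        = (if w \<in> permutations_of_set I then c I * word_sign w else 0)"
      by simp
    then show "(\<Sum>v\<in>permutations_of_set I. if v = w then c I * word_sign w else 0)
        = (if I = set w then (if distinct w then c (set w) * word_sign w else 0) else 0)"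
      by (auto simp: permutations_of_set_def)
  qed simp
  finally show ?thesis
    using assms by simp
qed

text \<open>Every ordering of \<open>I\<close> contributes its sign squared. Since the factorial is
  invertible in characteristic 0, coordinates can be prescribed at will.\<close>

lemma alt_coeff_standard_sum:
  assumes "finite \<I>" "I \<in> \<I>" "finite I"
  shows "alt_coeff I (standard_sum \<I> c) = fact (card I) * c I"
proof -
  have "alt_coeff I (standard_sum \<I> c) = (\<Sum>w\<in>permutations_of_set I. word_sign w * (c I * word_sign w))"
    unfolding alt_coeff_def alt_sum_def
    by (rule sum.cong) (auto simp: lookup_standard_sum[OF assms(1)] permutations_of_set_def assms(2))
  also have "\<dots> = (\<Sum>w\<in>permutations_of_set I. c I * (word_sign w * word_sign w))"
    by (simp add: mult_ac)
  finally show ?thesis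
    using assms(3) by (simp add: word_sign_square)
qed

lemma mat_identity_standard_sum:
  fixes c :: "nat set \<Rightarrow> 'a::field_char_0"
  assumes "\<And>I. I \<in> \<I> \<Longrightarrow> 2 * d \<le> card I"
  shows "mat_identity d (standard_sum \<I> c)"
  unfolding mat_identity_iff
proof (intro allI impI)
  fix a :: "nat \<Rightarrow> nat \<Rightarrow> nat \<Rightarrow> 'a" and i j
  assume ij: "i < d" "j < d"
  have "word_sum (\<lambda>w. mword d a w i j) (standard_sum \<I> c)
      = (\<Sum>I\<in>\<I>. c I * alt_sum I (\<lambda>w. mword d a w i j))"
    by (simp add: standard_sum_def word_sum_sum alt_sum_def sum_distrib_left mult.assoc)
  also have "\<dots> = 0"
    by (intro sum.neutral ballI) (simp add: amitsur_levitzki[OF assms ij])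
  finally show "word_sum (\<lambda>w. mword d a w i j) (standard_sum \<I> c) = 0" .
qed

lemma mword_concat:
  "i < d \<Longrightarrow> mword d a (concat (map \<theta> w)) i j = mword d (\<lambda>l. mword d a (\<theta> l)) w i j"
proof (induction w arbitrary: i)
  case (Cons l w)
  have "mword d a (concat (map \<theta> (l # w))) i j = mmul d (mword d a (\<theta> l)) (mword d a (concat (map \<theta> w))) i j"
    using Cons.prems by (simp add: mword_append)
  also have "\<dots> = mmul d (mword d a (\<theta> l)) (mword d (\<lambda>l. mword d a (\<theta> l)) w) i j"
    by (rule mmul_cong) (simp_all add: Cons.IH)
  finally show ?case by simp
qed simp

text \<open>
  With fewer than \<open>2 * d + 1\<close> variables no standard polynomial of degree \<open>2 * d + 1\<close> is available;
  the standard polynomial of degree \<open>2 * d\<close> with \<open>x 0 * x 0\<close> as last argument is used instead.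
\<close>

lemma identity_in_few_variables:
  assumes "2 < d"
  obtains f :: "'a::field_char_0 ncpoly"
  where "nc_vars f \<subseteq> {..<2 * d - 1}" "nc_degree f = 2 * d + 1" "mat_identity d f"
proof -
  define \<theta> where "\<theta> l = (if l = 2 * d - 1 then [0, 0] else [l])" for l :: nat
  define J where "J = {..<2 * d}"
  define f :: "'a ncpoly" where
    "f = (\<Sum>w\<in>permutations_of_set J. Poly_Mapping.single (Word (concat (map \<theta> w))) (word_sign w))"
  have look: "Poly_Mapping.lookup f (Word u)
      = (\<Sum>w\<in>permutations_of_set J. if concat (map \<theta> w) = u then word_sign w else 0)" for u
    unfolding f_def lookup_sum by (rule sum.cong) (auto simp: lookup_single when_def)
  have ex: "\<exists>w\<in>permutations_of_set J. concat (map \<theta> w) = u" if "Poly_Mapping.lookup f (Word u) \<noteq> 0" for u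
  proof (rule ccontr)
    assume "\<not> (\<exists>w\<in>permutations_of_set J. concat (map \<theta> w) = u)"
    then have "Poly_Mapping.lookup f (Word u) = 0"
      unfolding look by (intro sum.neutral) auto
    with that show False
      by simp
  qed
  have triv: "concat (map \<theta> w) = w" if "2 * d - 1 \<notin> set w" for w
    using that by (induction w) (auto simp: \<theta>_def)
  have vars: "set u \<subseteq> {..<2 * d - 1}" and len: "length u = 2 * d + 1"
    if nz: "Poly_Mapping.lookup f (Word u) \<noteq> 0" for u
  proof -
    obtain w where w: "w \<in> permutations_of_set J" "concat (map \<theta> w) = u"
      using ex[OF nz] by blast
    then have "2 * d - 1 \<in> set w" "distinct w" and set_w: "set w = J"
      using assms by (auto simp: permutations_of_set_def J_def)
    from split_list[OF this(1)] obtain w1 w2 where s: "w = w1 @ (2 * d - 1) # w2"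
      by blast
    have notin: "2 * d - 1 \<notin> set w1" "2 * d - 1 \<notin> set w2"
      using \<open>distinct w\<close> by (simp_all add: s)
    then have u: "u = w1 @ [0, 0] @ w2"
      using w(2) triv[of w1] triv[of w2] by (simp add: s \<theta>_def)
    have "length w = 2 * d"
      using length_finite_permutations_of_set[OF w(1)] by (simp add: J_def)
    then show "length u = 2 * d + 1"
      by (simp add: u s)
    show "set u \<subseteq> {..<2 * d - 1}"
    proof
      fix x assume "x \<in> set u"
      then have "x = 0 \<or> x \<in> set w \<and> x \<noteq> 2 * d - 1"
        using notin by (auto simp: u s)
      then have "x = 0 \<or> x < 2 * d \<and> x \<noteq> 2 * d - 1"
        unfolding set_w J_def lessThan_iff .
      then show "x \<in> {..<2 * d - 1}"
        unfolding lessThan_iff using assms by arith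
    qed
  qed
  \<comment> \<open>The witness for \<open>f \<noteq> 0\<close>: the monomial with letters 0, 0, 1,
    0, 2, 3, ... comes from \<open>p0\<close> alone. An ordering starting with the letter 0 would
    have to continue with the doubled letter and so yield a third 0 where the 1 stands.\<close>
  define w0 where "w0 = [1, 0] @ [2..<2 * d - 1]"
  define p0 where "p0 = (2 * d - 1) # w0"
  have w0: "2 * d - 1 \<notin> set w0"
    using assms by (auto simp: w0_def)
  have p0: "p0 \<in> permutations_of_set J"
    using assms w0 by (auto simp: permutations_of_set_def p0_def w0_def J_def)
  have unique: "p = p0" if p: "p \<in> permutations_of_set J" "concat (map \<theta> p) = concat (map \<theta> p0)" for p
  proof -
    have rhs: "concat (map \<theta> p0) = 0 # 0 # w0"
    proof -
      have "\<theta> (2 * d - 1) = [0, 0]"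
        by (simp add: \<theta>_def)
      then show ?thesis
        by (simp only: p0_def list.map concat.simps triv[OF w0] append.simps)
    qed
    have "p \<noteq> []"
      using p(2) rhs by (intro notI) simp
    then obtain a p' where a: "p = a # p'"
      by (cases p) simp_all
    have dist: "distinct p"
      using p(1) by (simp add: permutations_of_set_def)
    show ?thesis
    proof (cases "a = 2 * d - 1")
      case True
      then have "concat (map \<theta> p') = w0"
        using p(2) rhs by (simp add: a \<theta>_def)
      moreover have "concat (map \<theta> p') = p'"
        by (rule triv) (use dist True in \<open>simp add: a\<close>)
      ultimately show ?thesis
        by (simp add: a True p0_def)
    next
      case False
      then have "\<theta> a = [a]"
        by (simp add: \<theta>_def)
      then have "a # concat (map \<theta> p') = 0 # 0 # w0"
        using p(2) rhs by (simp add: a)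
      then have "a = 0" and rest: "concat (map \<theta> p') = 0 # w0"
        by simp_all
      then have "p' \<noteq> []"
        by (intro notI) simp
      then obtain b p'' where b: "p' = b # p''"
        by (cases p') simp_all
      then have "b \<noteq> 0"
        using dist a \<open>a = 0\<close> by auto
      then show ?thesis
        using rest by (auto simp: b \<theta>_def w0_def split: if_splits)
    qed
  qed
  have "Poly_Mapping.lookup f (Word (concat (map \<theta> p0)))
      = (\<Sum>w\<in>permutations_of_set J. if w = p0 then word_sign p0 else 0)"
    unfolding look by (rule sum.cong) (use unique in auto)
  also have "\<dots> = word_sign p0"
    using p0 by simp
  also have "\<dots> \<noteq> 0"
    using word_sign_square[of p0, where 'a='a] by auto
  finally have "f \<noteq> 0"
    by auto
  have "mat_identity d f"
    unfolding mat_identity_iff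
  proof (intro allI impI)
    fix a :: "nat \<Rightarrow> nat \<Rightarrow> nat \<Rightarrow> 'a" and i j
    assume ij: "i < d" "j < d"
    have "word_sum (\<lambda>w. mword d a w i j) f = alt_sum J (\<lambda>w. mword d (\<lambda>l. mword d a (\<theta> l)) w i j)"
      by (simp add: f_def word_sum_sum alt_sum_def mword_concat[OF ij(1)])
    also have "\<dots> = 0"
      by (rule amitsur_levitzki[OF _ ij]) (simp add: J_def)
    finally show "word_sum (\<lambda>w. mword d a w i j) f = 0" .
  qed
  then show ?thesis
    using that[of f] nc_vars_subset[OF vars] nc_degree_homogeneous[OF \<open>f \<noteq> 0\<close> len] by blast
qed

section \<open>Counting parameters, and the resulting number of lines\<close>

lemma linear_alt_poly_funs:
  assumes "finite X" "\<And>b j. b < m \<Longrightarrow> j \<in> I \<Longrightarrow> (r, b, j) \<in> X" "card I = m"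
  shows "(\<lambda>x. linear_alt m I (\<lambda>b j. x (r, b, j))) \<in> poly_funs X m"
  unfolding linear_alt_def alt_sum_def
proof (intro poly_funs_sum poly_funs_scale)
  fix w assume w: "w \<in> permutations_of_set I"
  have "(\<lambda>x. \<Prod>b<m. x (r, b, w ! b)) \<in> poly_funs X (card {..<m} * 1)"
  proof (intro poly_funs_prod poly_funs_var assms)
    fix b assume "b \<in> {..<m}"
    then show "w ! b \<in> I"
      using w length_finite_permutations_of_set[OF w] assms(3) by (auto simp: permutations_of_set_def)
  qed auto
  then show "(\<lambda>x. \<Prod>b<m. x (r, b, w ! b)) \<in> poly_funs X m"
    by simp
qed

lemma exists_high_rank_target:
  assumes "R * m * n < n choose m"
  shows "\<exists>c :: nat set \<Rightarrow> 'a::field_char_0.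
    \<forall>lf. \<exists>I\<subseteq>{..<n}. card I = m \<and> (\<Sum>r<R. linear_alt m I (lf r)) \<noteq> c I"
proof -
  \<comment> \<open>The unknowns: \<open>(r, b, j)\<close> stands for the coefficient of variable
    \<open>j\<close> in the \<open>b\<close>-th form of the \<open>r\<close>-th product.\<close>
  define X where "X = {..<R} \<times> {..<m} \<times> {..<n}"
  define \<I> where "\<I> = {I. I \<subseteq> {..<n} \<and> card I = m}"
  have "finite X" "card X = R * m * n"
    by (simp_all add: X_def card_cartesian_product)
  moreover have "finite \<I>" "card \<I> = n choose m"
    using n_subsets[of "{..<n}" m] by (auto simp: \<I>_def)
  moreover have "(\<lambda>x. \<Sum>r<R. linear_alt m I (\<lambda>b j. x (r, b, j))) \<in> poly_funs X m" if "I \<in> \<I>" for I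
    using that by (intro poly_funs_sum linear_alt_poly_funs) (auto simp: X_def \<I>_def)
  ultimately obtain c :: "nat set \<Rightarrow> 'a" where
    c: "\<And>x. \<exists>I\<in>\<I>. (\<Sum>r<R. linear_alt m I (\<lambda>b j. x (r, b, j))) \<noteq> c I"
    using exists_point_outside_image[of X \<I> "\<lambda>I x. \<Sum>r<R. linear_alt m I (\<lambda>b j. x (r, b, j))" m] assms
    by metis
  show ?thesis
  proof (rule exI[of _ c], rule allI)
    fix lf :: "nat \<Rightarrow> nat \<Rightarrow> nat \<Rightarrow> 'a"
    show "\<exists>I\<subseteq>{..<n}. card I = m \<and> (\<Sum>r<R. linear_alt m I (lf r)) \<noteq> c I"
      using c[of "\<lambda>(r, b, j). lf r b j"] by (auto simp: \<I>_def)
  qed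
qed

text \<open>A vector that no sum of \<open>R\<close> products reaches is realised by a combination
  of standard polynomials; a proof with too few lines would express it as such a sum.\<close>

lemma hard_identity:
  fixes B :: "'a::field_char_0 ncpoly set"
  assumes "finite B" "identity_basis d B" "\<And>h. h \<in> B \<Longrightarrow> computes (K h) h"
    and m: "m = 2 * d + 1" and "R * m * n < n choose m"
  obtains f where "nc_vars f \<subseteq> {..<n}" "nc_degree f = m" "mat_identity d f"
    "\<And>F \<pi>. computes F f \<Longrightarrow> proof_of B K (F, const_circuit 0) \<pi>
      \<Longrightarrow> R < (\<Sum>h\<in>B. card (low_words m h)) * length \<pi>"
proof -
  obtain c :: "nat set \<Rightarrow> 'a" where
    c: "\<And>lf. \<exists>I\<subseteq>{..<n}. card I = m \<and> (\<Sum>r<R. linear_alt m I (lf r)) \<noteq> c I"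
    using exists_high_rank_target[OF assms(5)] by blast
  define \<I> where "\<I> = {I. I \<subseteq> {..<n} \<and> card I = m}"
  \<comment> \<open>The division cancels the factorial in
    \<open>alt_coeff_standard_sum\<close>.\<close>
  define f where "f = standard_sum \<I> (\<lambda>I. c I / fact m)"
  have fin: "finite \<I>"
    by (simp add: \<I>_def)
  have f: "alt_coeff I f = c I" if "I \<subseteq> {..<n}" "card I = m" for I
    using that alt_coeff_standard_sum[OF fin, of I "\<lambda>I. c I / fact m"] finite_subset[OF that(1)]
    by (simp add: \<I>_def f_def)
  have words: "distinct w \<and> set w \<in> \<I>" if "Poly_Mapping.lookup f (Word w) \<noteq> 0" for w
    using that by (auto simp: f_def lookup_standard_sum[OF fin] split: if_splits)
  \<comment> \<open>Products of zero forms sum to 0, so the unreachable vector \<open>c\<close> is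
    not zero; this makes the degree of \<open>f\<close> exactly \<open>m\<close>.\<close>
  have "f \<noteq> 0"
  proof
    assume "f = 0"
    then have "c I = 0" if "I \<subseteq> {..<n}" "card I = m" for I
      using f[OF that] by simp
    then show False
      using c[of "\<lambda>_ _ _. 0"] m by (auto simp: linear_alt_0)
  qed
  show ?thesis
  proof (rule that)
    show "nc_vars f \<subseteq> {..<n}"
      by (rule nc_vars_subset) (use words in \<open>auto simp: \<I>_def\<close>)
    show "nc_degree f = m"
      by (rule nc_degree_homogeneous[OF \<open>f \<noteq> 0\<close>]) (use words distinct_card in \<open>fastforce simp: \<I>_def\<close>)
    show "mat_identity d f"
      unfolding f_def by (rule mat_identity_standard_sum) (simp add: \<I>_def m)
    fix F \<pi> assume "computes F f" "proof_of B K (F, const_circuit 0) \<pi>"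
    then obtain T where T: "finite T" "card T \<le> length \<pi>" "T \<subseteq> subst_instances B" "f \<in> two_sided_ideal T"
      using proof_of_sound[OF _ _ assms(3)] by blast
    have id: "\<And>h. h \<in> B \<Longrightarrow> mat_identity d h"
      using assms(2) by (simp add: identity_basis_def)
    let ?C = "\<Sum>h\<in>B. card (low_words m h)"
    obtain lf where lf: "\<And>I. card I = m \<Longrightarrow> alt_coeff I f = (\<Sum>r<?C * length \<pi>. linear_alt m I (lf r))"
      using alt_coeff_ideal_rank[OF assms(1) id m T] by blast
    show "R < ?C * length \<pi>"
    proof (rule ccontr)
      assume "\<not> R < ?C * length \<pi>"
      define lf' where "lf' r = (if r < ?C * length \<pi> then lf r else (\<lambda>_ _. 0))" for r
      have "(\<Sum>r<R. linear_alt m I (lf' r)) = c I" if "I \<subseteq> {..<n}" "card I = m" for I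
      proof -
        have "c I = (\<Sum>r<?C * length \<pi>. linear_alt m I (lf' r))"
          using lf[OF that(2)] f[OF that] by (simp add: lf'_def)
        also have "\<dots> = (\<Sum>r<R. linear_alt m I (lf' r))"
          using \<open>\<not> R < ?C * length \<pi>\<close> m
          by (intro sum.mono_neutral_left) (auto simp: lf'_def linear_alt_0)
        finally show ?thesis ..
      qed
      then show False
        using c[of lf'] by blast
    qed
  qed
qed

text \<open>\<open>R\<close> is the largest number with \<open>R * m * n < n choose m\<close>.
  Together with \<open>(n / m) ^ m \<le> n choose m\<close> this makes it of order
  \<open>n ^ (m - 1)\<close>.\<close>

lemma line_count_bound:
  fixes n m C t R :: nat
  assumes "0 < m" "m \<le> n" "R = ((n choose m) - 1) div (m * n)" "R < C * t"
  shows "real n ^ (m - 1) / (real (C + 1) * real m ^ (m + 1)) \<le> real t"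
proof -
  have n: "0 < n"
    using assms by simp
  have "(n choose m) \<le> (R + 1) * (m * n)"
  proof -
    have "(n choose m) - 1 < (R + 1) * (m * n)"
      using dividend_less_div_times[of "m * n" "(n choose m) - 1"] assms(1,3) n
      by (simp add: algebra_simps)
    then show ?thesis
      by linarith
  qed
  also have "\<dots> \<le> (C + 1) * t * (m * n)"
    using assms(4) by (intro mult_right_mono) auto
  finally have "real (n choose m) \<le> real ((C + 1) * t * (m * n))"
    by (simp only: of_nat_le_iff)
  moreover have "(real n / real m) ^ m \<le> real (n choose m)"
    using binomial_ge_n_over_k_pow_k[OF assms(2), where 'a=real] .
  ultimately have "real n ^ m / real m ^ m \<le> real (C + 1) * real t * (real m * real n)"
    unfolding power_divide of_nat_mult by linarith
  then have "real n ^ m \<le> real (C + 1) * real t * (real m * real n) * real m ^ m"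
    using assms(1) by (simp add: pos_divide_le_eq)
  moreover have "real n ^ m = real n ^ (m - 1) * real n"
    using assms(1) by (cases m) auto
  ultimately have "real n ^ (m - 1) * real n \<le> (real t * (real (C + 1) * real m ^ (m + 1))) * real n"
    by (simp add: mult_ac)
  then have "real n ^ (m - 1) \<le> real t * (real (C + 1) * real m ^ (m + 1))"
    using n by (simp only: mult_le_cancel_right)
  then show ?thesis
    using assms(1) by (simp add: pos_divide_le_eq)
qed

theorem theorem1:
  fixes d :: nat
    and B :: "'a::field_char_0 ncpoly set"
    and K :: "'a ncpoly \<Rightarrow> 'a circuit"
  assumes "d > 2"
    and "finite B"
    and "identity_basis d B"
    and "\<And>h. h \<in> B \<Longrightarrow> computes (K h) h"
  shows "\<exists>c::real. c > 0 \<and>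
    (\<forall>n \<ge> 2 * d - 1. \<exists>f. nc_vars f \<subseteq> {..<n} \<and> nc_degree f = 2 * d + 1 \<and> mat_identity d f \<and>
      (\<forall>F. computes F f \<longrightarrow>
        (\<forall>\<pi>. proof_of B K (F, const_circuit 0) \<pi> \<longrightarrow>
          real (length \<pi>) \<ge> c * real n ^ (2 * d))))"
proof -
  define m where "m = 2 * d + 1"
  define C where "C = (\<Sum>h\<in>B. card (low_words m h))"
  \<comment> \<open>\<open>m ^ m\<close> comes from the lower bound on the binomial coefficient and
    one more \<open>m\<close> from the \<open>m * n\<close> parameters of a product;
    \<open>C + 1\<close> keeps the denominator positive even if \<open>C = 0\<close>.\<close>
  define c where "c = 1 / (real (C + 1) * real m ^ (m + 1))"
  show ?thesis
  proof (intro exI[of _ c] conjI allI impI)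
    show "c > 0"
      by (simp add: c_def m_def)
    fix n assume n: "2 * d - 1 \<le> n"
    show "\<exists>f. nc_vars f \<subseteq> {..<n} \<and> nc_degree f = 2 * d + 1 \<and> mat_identity d f \<and>
      (\<forall>F. computes F f \<longrightarrow>
        (\<forall>\<pi>. proof_of B K (F, const_circuit 0) \<pi> \<longrightarrow> real (length \<pi>) \<ge> c * real n ^ (2 * d)))"
    proof (cases "m \<le> n")
      case True
      define R where "R = ((n choose m) - 1) div (m * n)"
      have "0 < n choose m"
        using True by (simp add: zero_less_binomial)
      moreover have "R * m * n \<le> (n choose m) - 1"
        unfolding R_def mult.assoc by (rule div_times_less_eq_dividend)
      ultimately have "R * m * n < n choose m"
        by linarith
      then obtain f where f: "nc_vars f \<subseteq> {..<n}" "nc_degree f = m" "mat_identity d f"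
        "\<And>F \<pi>. computes F f \<Longrightarrow> proof_of B K (F, const_circuit 0) \<pi> \<Longrightarrow> R < C * length \<pi>"
        using hard_identity[OF assms(2-4) m_def, of R n] unfolding C_def by blast
      have "c * real n ^ (2 * d) \<le> real (length \<pi>)"
        if "computes F f" "proof_of B K (F, const_circuit 0) \<pi>" for F \<pi>
        using line_count_bound[OF _ True R_def f(4)[OF that]] by (simp add: c_def m_def)
      then show ?thesis
        using f(1-3) by (auto simp: m_def)
    next
      case False
      \<comment> \<open>Here \<open>n \<le> 2 * d\<close>, where the claimed bound is at most 1 and
        a proof has at least one line, so any identity of the right degree will do.\<close>
      obtain f :: "'a ncpoly" where f: "nc_vars f \<subseteq> {..<2 * d - 1}" "nc_degree f = 2 * d + 1" "mat_identity d f"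
        using identity_in_few_variables[OF assms(1)] .
      have "real n ^ (2 * d) \<le> real m ^ (2 * d)"
        using False by (intro power_mono) auto
      also have "\<dots> \<le> real m ^ (m + 1)"
        by (intro power_increasing) (auto simp: m_def)
      also have "\<dots> \<le> real (C + 1) * real m ^ (m + 1)"
        using mult_right_mono[of 1 "real (C + 1)" "real m ^ (m + 1)"] by simp
      finally have "c * real n ^ (2 * d) \<le> 1"
        by (simp add: c_def m_def pos_divide_le_eq)
      moreover have "1 \<le> real (length \<pi>)" if "proof_of B K e \<pi>" for e \<pi>
        using that by (cases \<pi>) (auto simp: proof_of_def)
      ultimately have "c * real n ^ (2 * d) \<le> real (length \<pi>)" if "proof_of B K e \<pi>" for e \<pi>
        using that by (meson order_trans)
      then show ?thesis
        using f n by (intro exI[of _ f]) auto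
    qed
  qed
qed

end
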